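(* Let $A$ be the localization of $\mathbb{Z}$ at some nonzero integer, and let $\mathfrak{a}\subseteq(X_1,\ldots,X_n)A[X]$ be a nonzero ideal of $A[X]=A[X_1,\ldots,X_n]$. Then for every prime $p\gg 0$ (i.e. every prime $p$ larger than some bound depending only on $\mathfrak{a}$) and for every ideal $J\subseteq(X_1,\ldots,X_n)A[X]$ containing $\mathfrak{a}$ in its radical, we have $$b_{\mathfrak{a},0}(\nu^J_{\mathfrak{a}}(p^e))=0\ \text{ in }\ \mathbb{F}_p$$ for all $e\ge 1$.
   Context: Localization of $\mathbb{Z}$ at a nonzero integer $m$ means $\mathbb{Z}[1/m]$. Write $\mathbb{F}_p=\mathbb{Z}/p\mathbb{Z}$. Invariants mod $p$: for a prime $p$ that is large enough (so that in particular $p$ is not invertible in $A$), let $R_p=\mathbb{F}_p[X_1,\ldots,X_n]_{(X_1,\ldots,X_n)}$, $\mathfrak{a}_p:=\mathfrak{a}\cdot R_p$ and $J_p:=J\cdot R_p$ (for $p$ large, $\mathfrak{a}_p\ne 0$). Put $\nu^J_{\mathfrak{a}}(p^e):=\max\{r\in\mathbb{N}\mid\mathfrak{a}_p^r\not\subseteq J_p^{[p^e]}\}$, where $J_p^{[p^e]}=(y^{p^e}\mid y\in J_p)$. Bernstein-Sato polynomial: let $I\subseteq\mathbb{C}[X_1,\ldots,X_n]$ be a nonzero ideal with nonzero generators $f_1,\ldots,f_r$, and let $s_1,\ldots,s_r$ be indeterminates. The Bernstein-Sato polynomial $b_I$ is the monic polynomial in one variable of minimal degree for which there is an equation $$b_I(s_1+\cdots+s_r)\prod_{i=1}^r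 f_i^{s_i}=\sum_c P_c(s,X,\partial_X)\bullet\prod_{j,\,c_j<0}\binom{s_j}{-c_j}\prod_{i=1}^r f_i^{s_i+c_i},$$ where the sum is over finitely many $c\in\mathbb{Z}^r$ with $\sum_j c_j=1$, each $P_c\in\mathbb{C}[s_j,X_i,\partial_{X_i}\mid j\le r,\,i\le n]$ is a differential operator, $\binom{s_j}{-c_j}=s_j(s_j-1)\cdots(s_j+c_j+1)/(-c_j)!$, $\bullet$ is the action of differential operators, and the equation is understood formally. Requiring the equation to hold only in some neighborhood of the origin in $\mathbb{C}^n$ (i.e. allowing the $P_c$ to have coefficients in $X$ regular near the origin) gives the local Bernstein-Sato polynomial $b_{I,0}$. These polynomials do not depend on the choice of generators. $b_{\mathfrak{a},0}$ denotes the local Bernstein-Sato polynomial of $I=\mathfrak{a}\cdot\mathbb{C}[X_1,\ldots,X_n]$. All its roots are known to be rational, so $b_{\mathfrak{a},0}\in\mathbb{Q}[s]$; hence for $p$ large its coefficients lie in $\mathbb{Z}_{(p)}$, and for every integer $m$ the value $b_{\mathfrak{a},0}(m)$ has a well-defined class in $\mathbb{F}_p$. *)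

theory Defs
  imports
    "HOL-Library.Poly_Mapping"
    "HOL-Computational_Algebra.Polynomial"
    "HOL-Computational_Algebra.Fraction_Field"
    "HOL-Number_Theory.Modular_Inverse"
    "HOL-Algebra.Ideal_Product"
begin

text \<open>
  Multivariate polynomials are finitely supported functions from exponent vectors to coefficients;
  the variables are \<open>X\<^sub>0, X\<^sub>1, \<dots>\<close>, so \<open>K[X\<^sub>1,\<dots>,X\<^sub>n]\<close> is modelled on the variables of index \<open>< n\<close>.
\<close>

type_synonym 'a mpoly = "(nat \<Rightarrow>\<^sub>0 nat) \<Rightarrow>\<^sub>0 'a"

abbreviation X_var :: "nat \<Rightarrow> 'a::zero_neq_one mpoly" where
  "X_var i \<equiv> Poly_Mapping.single (Poly_Mapping.single i 1) 1"

abbreviation const_mpoly :: "'a::zero \<Rightarrow> 'a mpoly" where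
  "const_mpoly c \<equiv> Poly_Mapping.single 0 c"

definition mpolys :: "nat \<Rightarrow> 'a::zero set \<Rightarrow> 'a mpoly set" where
  "mpolys n A = {f. \<forall>u\<in>Poly_Mapping.keys f.
     Poly_Mapping.lookup f u \<in> A \<and> Poly_Mapping.keys u \<subseteq> {..<n}}"

text \<open>The polynomial ring \<open>A[X\<^sub>1,\<dots>,X\<^sub>n]\<close> over a subring \<open>A\<close> of a type-class ring.\<close>

definition mpoly_ring :: "nat \<Rightarrow> 'a::comm_ring_1 set \<Rightarrow> 'a mpoly ring" where
  "mpoly_ring n A =
     \<lparr>carrier = mpolys n A, mult = (*), one = 1, zero = 0, add = (+)\<rparr>"

text \<open>\<open>\<int>[1/m]\<close>, as a subring of the rationals.\<close>

definition int_localization :: "int \<Rightarrow> rat set" where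
  "int_localization m = {of_int a / of_int m ^ k |a k. True}"

text \<open>\<open>(\<int>/p\<int>)[X\<^sub>1,\<dots>,X\<^sub>n]\<close>, with the coefficients represented in \<open>{0..<p}\<close>.\<close>

definition Fp_mpoly_ring :: "nat \<Rightarrow> nat \<Rightarrow> int mpoly ring" where
  "Fp_mpoly_ring p n =
     \<lparr>carrier = mpolys n {0..<int p},
      mult = (\<lambda>f g. Poly_Mapping.map (\<lambda>c. c mod int p) (f * g)),
      one = 1, zero = 0,
      add = (\<lambda>f g. Poly_Mapping.map (\<lambda>c. c mod int p) (f + g))\<rparr>"

text \<open>
  The residue map from the rationals with denominator prime to \<open>p\<close> to \<open>\<int>/p\<int> = {0..<p}\<close>.  It has no
  meaning on rationals whose denominator is divisible by \<open>p\<close>; in a fixed \<open>\<int>[1/m]\<close>, and among the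
  coefficients of a fixed polynomial, such denominators occur for finitely many primes \<open>p\<close> only.
\<close>

definition residue_Fp :: "nat \<Rightarrow> rat \<Rightarrow> int" where
  "residue_Fp p x =
     (case quotient_of x of (a, d) \<Rightarrow> (a * modular_inverse (int p) d) mod int p)"

text \<open>The ideal \<open>(X\<^sub>1,\<dots>,X\<^sub>n)\<close> of a polynomial ring \<open>R\<close> in \<open>n\<close> variables.\<close>

definition vars_ideal :: "nat \<Rightarrow> 'a::zero_neq_one mpoly ring \<Rightarrow> 'a mpoly set" where
  "vars_ideal n R = genideal R (X_var ` {..<n})"

definition radical :: "('a, 'm) ring_scheme \<Rightarrow> 'a set \<Rightarrow> 'a set" where
  "radical R J = {x \<in> carrier R. \<exists>k::nat. x [^]\<^bsub>R\<^esub> k \<in> J}"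

text \<open>The localization of a commutative ring \<open>R\<close> at a multiplicative subset \<open>S\<close>.\<close>

definition frac_rel :: "('a, 'm) ring_scheme \<Rightarrow> 'a set \<Rightarrow> (('a \<times> 'a) \<times> ('a \<times> 'a)) set" where
  "frac_rel R S = {((a, s), (b, t)). a \<in> carrier R \<and> s \<in> S \<and> b \<in> carrier R \<and> t \<in> S \<and>
     (\<exists>u\<in>S. u \<otimes>\<^bsub>R\<^esub> (a \<otimes>\<^bsub>R\<^esub> t) = u \<otimes>\<^bsub>R\<^esub> (b \<otimes>\<^bsub>R\<^esub> s))}"

definition frac :: "('a, 'm) ring_scheme \<Rightarrow> 'a set \<Rightarrow> 'a \<Rightarrow> 'a \<Rightarrow> ('a \<times> 'a) set" where
  "frac R S a s = frac_rel R S `` {(a, s)}"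

definition localization :: "('a, 'm) ring_scheme \<Rightarrow> 'a set \<Rightarrow> ('a \<times> 'a) set ring" where
  "localization R S =
     \<lparr>carrier = (carrier R \<times> S) // frac_rel R S,
      mult = (\<lambda>x y. \<Union>(a, s)\<in>x. \<Union>(b, t)\<in>y. frac R S (a \<otimes>\<^bsub>R\<^esub> b) (s \<otimes>\<^bsub>R\<^esub> t)),
      one = frac R S \<one>\<^bsub>R\<^esub> \<one>\<^bsub>R\<^esub>,
      zero = frac R S \<zero>\<^bsub>R\<^esub> \<one>\<^bsub>R\<^esub>,
      add = (\<lambda>x y. \<Union>(a, s)\<in>x. \<Union>(b, t)\<in>y.
               frac R S ((a \<otimes>\<^bsub>R\<^esub> t) \<oplus>\<^bsub>R\<^esub> (b \<otimes>\<^bsub>R\<^esub> s)) (s \<otimes>\<^bsub>R\<^esub> t))\<rparr>"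

definition away_from_origin :: "nat \<Rightarrow> nat \<Rightarrow> int mpoly set" where
  "away_from_origin p n = carrier (Fp_mpoly_ring p n) - vars_ideal n (Fp_mpoly_ring p n)"

text \<open>\<open>R\<^sub>p = \<int>/p\<int>[X]\<close> localized at \<open>(X\<^sub>1,\<dots>,X\<^sub>n)\<close>, the map \<open>A[X] \<rightarrow> R\<^sub>p\<close>, and the extension of an ideal of \<open>A[X]\<close> to \<open>R\<^sub>p\<close>.\<close>

definition local_ring_Fp :: "nat \<Rightarrow> nat \<Rightarrow> (int mpoly \<times> int mpoly) set ring" where
  "local_ring_Fp p n = localization (Fp_mpoly_ring p n) (away_from_origin p n)"

definition reduce_Fp :: "nat \<Rightarrow> nat \<Rightarrow> rat mpoly \<Rightarrow> (int mpoly \<times> int mpoly) set" where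
  "reduce_Fp p n f = frac (Fp_mpoly_ring p n) (away_from_origin p n)
     (Poly_Mapping.map (residue_Fp p) f) \<one>\<^bsub>Fp_mpoly_ring p n\<^esub>"

definition extend_Fp :: "nat \<Rightarrow> nat \<Rightarrow> rat mpoly set \<Rightarrow> (int mpoly \<times> int mpoly) set set" where
  "extend_Fp p n I = genideal (local_ring_Fp p n) (reduce_Fp p n ` I)"

definition frobenius_power :: "('a, 'm) ring_scheme \<Rightarrow> 'a set \<Rightarrow> nat \<Rightarrow> 'a set" where
  "frobenius_power R J q = genideal R {y [^]\<^bsub>R\<^esub> q |y. y \<in> J}"

text \<open>
  If \<open>\<aa>\<close> is contained in the radical of \<open>J \<subseteq> (X\<^sub>1,\<dots>,X\<^sub>n)\<close> and \<open>p\<close> is a prime that is not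
  invertible in \<open>A\<close>, the set below is finite and contains \<open>0\<close>.
  Powers of ideals are powers in the monoid of ideals, with \<open>\<aa>\<^sup>0\<close> the unit ideal.
\<close>

definition nu :: "nat \<Rightarrow> rat mpoly set \<Rightarrow> rat mpoly set \<Rightarrow> nat \<Rightarrow> nat \<Rightarrow> nat" where
  "nu n \<aa> J p e = Max {r::nat.
     \<not> extend_Fp p n \<aa> [^]\<^bsub>ideals_set (local_ring_Fp p n)\<^esub> r
         \<subseteq> frobenius_power (local_ring_Fp p n) (extend_Fp p n J) (p ^ e)}"

text \<open>Partial derivatives of polynomials and of rational functions.\<close>

lift_definition pderiv_mpoly :: "nat \<Rightarrow> 'a::comm_ring_1 mpoly \<Rightarrow> 'a mpoly"
  is "\<lambda>i f u. of_nat (Poly_Mapping.lookup u i + 1) * f (u + Poly_Mapping.single i 1)"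
proof -
  fix i :: nat and f :: "(nat \<Rightarrow>\<^sub>0 nat) \<Rightarrow> 'a"
  assume fin: "finite {u. f u \<noteq> 0}"
  have "inj (\<lambda>u. u + Poly_Mapping.single i (1::nat))"
    by (rule injI) simp
  from finite_vimageI[OF fin this]
  have "finite {u. f (u + Poly_Mapping.single i 1) \<noteq> 0}"
    by (simp add: vimage_def)
  then show "finite {u. of_nat (Poly_Mapping.lookup u i + 1) * f (u + Poly_Mapping.single i 1) \<noteq> 0}"
    by (rule rev_finite_subset) auto
qed

lemma pderiv_mpoly_add: "pderiv_mpoly i (f + g) = pderiv_mpoly i f + pderiv_mpoly i g"
  by transfer (auto simp: algebra_simps)

lemma pderiv_mpoly_0 [simp]: "pderiv_mpoly i 0 = 0"
  by transfer auto

lemma pderiv_mpoly_single: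
  "pderiv_mpoly i (Poly_Mapping.single u c) =
     Poly_Mapping.single (u - Poly_Mapping.single i 1) (of_nat (Poly_Mapping.lookup u i) * c)"
proof (rule poly_mapping_eqI)
  fix v
  show "Poly_Mapping.lookup (pderiv_mpoly i (Poly_Mapping.single u c)) v =
     Poly_Mapping.lookup (Poly_Mapping.single (u - Poly_Mapping.single i 1)
       (of_nat (Poly_Mapping.lookup u i) * c)) v"
  proof (cases "Poly_Mapping.lookup u i = 0")
    case True
    then have "u \<noteq> v + Poly_Mapping.single i 1"
      by (auto simp: lookup_add)
    with True show ?thesis
      by (simp add: pderiv_mpoly.rep_eq lookup_single)
  next
    case False
    have "u = v + Poly_Mapping.single i 1 \<longleftrightarrow> u - Poly_Mapping.single i 1 = v"
    proof
      assume "u - Poly_Mapping.single i 1 = v"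
      then show "u = v + Poly_Mapping.single i 1"
        using False by (auto intro!: poly_mapping_eqI simp: lookup_add lookup_minus lookup_single when_def)
    qed simp
    then show ?thesis
      by (cases "u = v + Poly_Mapping.single i 1")
        (simp_all add: pderiv_mpoly.rep_eq lookup_single when_def lookup_add)
  qed
qed

lemma pderiv_mpoly_mult:
  "pderiv_mpoly i (f * g) = pderiv_mpoly i f * g + f * pderiv_mpoly i g"
proof -
  have shift: "(u - Poly_Mapping.single i 1) + v = u + v - Poly_Mapping.single i (1::nat)"
    if "Poly_Mapping.lookup u i \<noteq> 0" for u v :: "nat \<Rightarrow>\<^sub>0 nat"
    using that by (auto intro!: poly_mapping_eqI simp: lookup_add lookup_minus lookup_single when_def)
  have singles: "pderiv_mpoly i (Poly_Mapping.single u c * Poly_Mapping.single v d) =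
      pderiv_mpoly i (Poly_Mapping.single u c) * Poly_Mapping.single v d +
      Poly_Mapping.single u c * pderiv_mpoly i (Poly_Mapping.single v d)" for u v and c d :: 'a
  proof -
    have "Poly_Mapping.single (u - Poly_Mapping.single i 1 + v)
            (of_nat (Poly_Mapping.lookup u i) * c * d) =
          Poly_Mapping.single (u + v - Poly_Mapping.single i 1)
            (of_nat (Poly_Mapping.lookup u i) * c * d)"
      by (cases "Poly_Mapping.lookup u i = 0") (simp_all add: shift del: One_nat_def)
    moreover have "Poly_Mapping.single (u + (v - Poly_Mapping.single i 1))
            (c * (of_nat (Poly_Mapping.lookup v i) * d)) =
          Poly_Mapping.single (u + v - Poly_Mapping.single i 1)
            (c * (of_nat (Poly_Mapping.lookup v i) * d))"
      by (cases "Poly_Mapping.lookup v i = 0") (simp_all add: shift[of v u] add.commute[of u] del: One_nat_def)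
    ultimately show ?thesis
      by (simp add: mult_single pderiv_mpoly_single lookup_add single_add[symmetric] algebra_simps)
  qed
  show ?thesis
  proof (induction f rule: update_induct)
    case const
    show ?case by simp
  next
    case (update f u c)
    have split_f: "Poly_Mapping.update u c f = f + Poly_Mapping.single u c"
      using update.hyps(1)
      by (auto intro!: poly_mapping_eqI simp: lookup_update lookup_add lookup_single when_def
          in_keys_iff)
    have "pderiv_mpoly i (Poly_Mapping.single u c * g) =
      pderiv_mpoly i (Poly_Mapping.single u c) * g + Poly_Mapping.single u c * pderiv_mpoly i g"
    proof (induction g rule: update_induct)
      case const
      show ?case by simp
    next
      case (update g v d)
      have "Poly_Mapping.update v d g = g + Poly_Mapping.single v d"
        using update.hyps(1)
        by (auto intro!: poly_mapping_eqI simp: lookup_update lookup_add lookup_single when_def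
            in_keys_iff)
      then show ?case
        using update.IH by (simp add: pderiv_mpoly_add distrib_left distrib_right singles)
    qed
    then show ?case
      using update.IH by (simp add: split_f pderiv_mpoly_add distrib_left distrib_right)
  qed
qed

lift_definition pderiv_fract :: "nat \<Rightarrow> 'a::idom mpoly fract \<Rightarrow> 'a mpoly fract"
  is "\<lambda>i q. (pderiv_mpoly i (fst q) * snd q - fst q * pderiv_mpoly i (snd q), snd q * snd q)"
proof -
  fix i and q r :: "'a mpoly \<times> 'a mpoly"
  assume "fractrel q r"
  obtain a b where q: "q = (a, b)" by (cases q)
  obtain c d where r: "r = (c, d)" by (cases r)
  from \<open>fractrel q r\<close> have nz: "b \<noteq> 0" "d \<noteq> 0" and eq: "a * d = c * b"
    by (auto simp: q r fractrel_def)
  from arg_cong[OF eq, of "pderiv_mpoly i"]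
  have eq': "pderiv_mpoly i a * d + a * pderiv_mpoly i d =
      pderiv_mpoly i c * b + c * pderiv_mpoly i b"
    by (simp add: pderiv_mpoly_mult)
  have "(pderiv_mpoly i a * b - a * pderiv_mpoly i b) * (d * d) -
        (pderiv_mpoly i c * d - c * pderiv_mpoly i d) * (b * b) =
      (pderiv_mpoly i a * d + a * pderiv_mpoly i d -
        (pderiv_mpoly i c * b + c * pderiv_mpoly i b)) * (b * d) -
      (a * d - c * b) * (pderiv_mpoly i b * d + b * pderiv_mpoly i d)"
    by (simp add: algebra_simps)
  also have "\<dots> = 0"
    using eq eq' by simp
  finally show "fractrel
      (pderiv_mpoly i (fst q) * snd q - fst q * pderiv_mpoly i (snd q), snd q * snd q)
      (pderiv_mpoly i (fst r) * snd r - fst r * pderiv_mpoly i (snd r), snd r * snd r)"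
    using nz by (simp add: q r)
qed

text \<open>
  For nonzero \<open>f\<^sub>1,\<dots>,f\<^sub>r\<close> the formal expressions \<open>u \<cdot> \<Prod>f\<^sub>i^s\<^sub>i\<close> with \<open>u \<in> \<complex>(X)[s\<^sub>1,\<dots>,s\<^sub>r]\<close> form a free
  module of rank one, represented by \<open>u\<close>.  A derivation acts on \<open>u \<cdot> \<Prod>f\<^sub>i^s\<^sub>i\<close> through its action
  on the coefficients of \<open>u\<close> and by logarithmic differentiation of \<open>\<Prod>f\<^sub>i^s\<^sub>i\<close>, and
  \<open>\<Prod>f\<^sub>i^(s\<^sub>i + c\<^sub>i) = \<Prod>f\<^sub>i^c\<^sub>i \<cdot> \<Prod>f\<^sub>i^s\<^sub>i\<close>.
\<close>

type_synonym bs_fun = "complex mpoly fract mpoly"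

definition pderiv_fs :: "complex mpoly list \<Rightarrow> nat \<Rightarrow> bs_fun \<Rightarrow> bs_fun" where
  "pderiv_fs fs i u = Poly_Mapping.map (pderiv_fract i) u +
     u * (\<Sum>j<length fs. X_var j * const_mpoly (Fract (pderiv_mpoly i (fs ! j)) (fs ! j)))"

text \<open>\<open>\<partial>\<^sup>\<alpha>\<close>; the derivations commute, so the order of the composition is immaterial.\<close>

definition multi_pderiv_fs :: "nat \<Rightarrow> complex mpoly list \<Rightarrow> (nat \<Rightarrow>\<^sub>0 nat) \<Rightarrow> bs_fun \<Rightarrow> bs_fun" where
  "multi_pderiv_fs n fs \<alpha> = fold (\<lambda>i. pderiv_fs fs i ^^ Poly_Mapping.lookup \<alpha> i) [0..<n]"

text \<open>
  A differential operator is given in its normal form \<open>\<Sum>\<^sub>\<alpha> g\<^sub>\<alpha>(s,X) \<partial>\<^sub>X^\<alpha>\<close>, that is, by the finitely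
  supported function \<open>\<alpha> \<mapsto> g\<^sub>\<alpha>\<close>.  For the local Bernstein-Sato polynomial the \<open>g\<^sub>\<alpha>\<close> are polynomials
  in \<open>s\<close> whose coefficients are rational functions of \<open>X\<close> that are regular at the origin.
\<close>

definition apply_diffop :: "nat \<Rightarrow> complex mpoly list \<Rightarrow> bs_fun mpoly \<Rightarrow> bs_fun \<Rightarrow> bs_fun" where
  "apply_diffop n fs P u = (\<Sum>\<alpha>\<in>Poly_Mapping.keys P.
     Poly_Mapping.lookup P \<alpha> * multi_pderiv_fs n fs \<alpha> u)"

definition regular_at_origin :: "nat \<Rightarrow> complex mpoly fract set" where
  "regular_at_origin n = {Fract g h |g h.
     g \<in> mpolys n UNIV \<and> h \<in> mpolys n UNIV \<and> Poly_Mapping.lookup h 0 \<noteq> 0}"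

definition local_diffops :: "nat \<Rightarrow> nat \<Rightarrow> bs_fun mpoly set" where
  "local_diffops n r = mpolys n (mpolys r (regular_at_origin n))"

definition bs_const :: "complex \<Rightarrow> bs_fun" where
  "bs_const z = const_mpoly (Fract (const_mpoly z) 1)"

text \<open>The binomial coefficient \<open>s\<^sub>j(s\<^sub>j - 1)\<cdots>(s\<^sub>j - k + 1)/k!\<close>.\<close>

definition s_binomial :: "nat \<Rightarrow> nat \<Rightarrow> bs_fun" where
  "s_binomial j k = bs_const (1 / fact k) * (\<Prod>l<k. X_var j - of_nat l)"

definition bs_term :: "complex mpoly list \<Rightarrow> int list \<Rightarrow> bs_fun" where
  "bs_term fs c =
     (\<Prod>j\<in>{j. j < length fs \<and> c ! j < 0}. s_binomial j (nat (- (c ! j)))) *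
     const_mpoly (\<Prod>j<length fs. power_int (Fract (fs ! j) 1) (c ! j))"

definition local_bs_equation :: "nat \<Rightarrow> complex mpoly list \<Rightarrow> complex poly \<Rightarrow> bool" where
  "local_bs_equation n fs b \<longleftrightarrow>
     (\<exists>C P. finite C \<and>
       (\<forall>c\<in>C. length c = length fs \<and> sum_list c = 1 \<and> P c \<in> local_diffops n (length fs)) \<and>
       poly (map_poly bs_const b) (\<Sum>j<length fs. X_var j) =
         (\<Sum>c\<in>C. apply_diffop n fs (P c) (bs_term fs c)))"

text \<open>
  \<open>b\<close> is the local Bernstein-Sato polynomial of the ideal \<open>I\<close> of \<open>\<complex>[X\<^sub>1,\<dots>,X\<^sub>n]\<close>, computed from some
  finite system of nonzero generators of \<open>I\<close>.
\<close>

definition is_local_bs_poly :: "nat \<Rightarrow> complex mpoly set \<Rightarrow> complex poly \<Rightarrow> bool" where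
  "is_local_bs_poly n I b \<longleftrightarrow>
     (\<exists>fs. set fs \<subseteq> mpolys n UNIV - {0} \<and> genideal (mpoly_ring n UNIV) (set fs) = I \<and>
       lead_coeff b = 1 \<and> local_bs_equation n fs b \<and>
       (\<forall>b'. lead_coeff b' = 1 \<and> local_bs_equation n fs b' \<longrightarrow> degree b \<le> degree b'))"

definition extend_complex :: "nat \<Rightarrow> rat mpoly set \<Rightarrow> complex mpoly set" where
  "extend_complex n I = genideal (mpoly_ring n UNIV) (Poly_Mapping.map of_rat ` I)"

end

theory Submission
  imports Defs
begin

text \<open>
  Substituting natural numbers \<open>\<alpha>\<^sub>1, \<dots>, \<alpha>\<^sub>r\<close> with sum \<open>\<nu>\<close> for \<open>s\<^sub>1, \<dots>, s\<^sub>r\<close> in the functional equation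
  shows that \<open>b(\<nu>) f\<^sup>\<alpha>\<close> arises, up to a unit at the origin, by applying differential operators to
  monomials of degree \<open>\<nu> + 1\<close> in the generators.  Modulo \<open>p\<close> these monomials lie in \<open>J^[p\<^sup>e]\<close>, which
  is stable under differential operators because \<open>p\<^sup>e\<close>-th powers are constants for derivations in
  characteristic \<open>p\<close>.  If \<open>b(\<nu>)\<close> were nonzero modulo \<open>p\<close>, then \<open>\<aa>\<^sup>\<nu>\<close> would be contained in \<open>J^[p\<^sup>e]\<close>,
  against the choice of \<open>\<nu>\<close>.

  The generators and the operators are only given over \<open>\<complex>\<close>.  Their finitely many coefficients
  lie in a subring \<open>B\<close> of \<open>\<complex>\<close> in which almost all primes are non-units, and the argument takes place
  in \<open>B[X]\<close> modulo \<open>p\<close>; as \<open>B/pB\<close> is a nonzero vector space over \<open>\<int>/p\<int>\<close>, containments of ideals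
  descend along a linear functional with \<open>1 \<mapsto> 1\<close>.
\<close>

subsection \<open>Primes that are invertible in finitely generated rings\<close>

text \<open>The bound on p must not depend on J or e. So everything extracted from the functional
  equation (operator coefficients, a common denominator, the change of generators between \<aa> and
  \<open>fs\<close>) is fixed over \<complex> beforehand, and B is built from these finitely many
  numbers. B comes with no map to \<int>/p\<int>, and its residue fields above p may be larger, so
  reduction modulo p is replaced by membership in ideals of B[X] that contain p. The return to A[X]
  uses a map that is only additive; this suffices because the ideal in question is generated by
  polynomials over A. The local ring is removed in the same spirit: an inclusion in it says that
  multiples v x with v of constant coefficient 1 lie in an ideal of A[X], a condition that makes
  sense over every coefficient ring. Negative powers of generators, present in the equation when
  some c_j < 0, disappear at a natural point \<alpha>: if \<alpha> + c has a negative entry, a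
  binomial factor vanishes. Finally, \<open>nu\<close> is a \<open>Max\<close>, so its defining set
  must be shown finite and nonempty; finiteness rests on finitely many elements that generate \<aa>
  after one nonzero constant is inverted.\<close>

abbreviation "lookup \<equiv> Poly_Mapping.lookup"
abbreviation "keys \<equiv> Poly_Mapping.keys"

definition unital_subring :: "'a::comm_ring_1 set \<Rightarrow> bool" where
  "unital_subring C \<longleftrightarrow> 1 \<in> C \<and> (\<forall>x\<in>C. \<forall>y\<in>C. x - y \<in> C \<and> x * y \<in> C)"

lemma unital_subring_UNIV [simp]: "unital_subring UNIV"
  by (simp add: unital_subring_def)

context
  fixes C :: "'a::comm_ring_1 set"
  assumes C: "unital_subring C"
begin

lemma subring_1: "1 \<in> C"
  and subring_diff: "x \<in> C \<Longrightarrow> y \<in> C \<Longrightarrow> x - y \<in> C"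
  and subring_mult: "x \<in> C \<Longrightarrow> y \<in> C \<Longrightarrow> x * y \<in> C"
  using C by (auto simp: unital_subring_def)

lemma subring_0: "0 \<in> C"
  using subring_diff[OF subring_1 subring_1] by simp

lemma subring_uminus: "x \<in> C \<Longrightarrow> - x \<in> C"
  using subring_diff[OF subring_0] by force

lemma subring_add: "x \<in> C \<Longrightarrow> y \<in> C \<Longrightarrow> x + y \<in> C"
  using subring_diff[of x "- y"] subring_uminus by simp

lemma subring_sum: "(\<And>i. i \<in> I \<Longrightarrow> f i \<in> C) \<Longrightarrow> sum f I \<in> C"
  by (induction I rule: infinite_finite_induct) (auto intro: subring_0 subring_add)

lemma subring_prod: "(\<And>i. i \<in> I \<Longrightarrow> f i \<in> C) \<Longrightarrow> prod f I \<in> C"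
  by (induction I rule: infinite_finite_induct) (auto intro: subring_1 subring_mult)

lemma subring_power: "x \<in> C \<Longrightarrow> x ^ k \<in> C"
  by (induction k) (auto intro: subring_1 subring_mult)

lemma subring_of_nat: "of_nat k \<in> C"
  by (induction k) (auto intro: subring_0 subring_1 subring_add)

lemma subring_of_int: "of_int k \<in> C"
  by (cases k) (auto intro: subring_of_nat subring_diff subring_uminus subring_1)

end

lemmas subring_intros = subring_0 subring_1 subring_add subring_diff subring_uminus subring_mult
  subring_sum subring_prod subring_power subring_of_nat subring_of_int

section \<open>Adjoining one element to a subring\<close>

definition polys_over :: "'a::comm_ring_1 set \<Rightarrow> 'a poly set" where
  "polys_over C = {q. \<forall>i. poly.coeff q i \<in> C}"

lemma unital_subring_polys_over: "unital_subring C \<Longrightarrow> unital_subring (polys_over C)"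
  unfolding unital_subring_def[of "polys_over C"]
  by (auto simp: polys_over_def coeff_mult coeff_1 intro!: subring_intros)

lemma monom_in_polys_over: "unital_subring C \<Longrightarrow> c \<in> C \<Longrightarrow> monom c k \<in> polys_over C"
  by (auto simp: polys_over_def subring_0)

lemma smult_in_polys_over: "unital_subring C \<Longrightarrow> c \<in> C \<Longrightarrow> q \<in> polys_over C \<Longrightarrow> smult c q \<in> polys_over C"
  by (auto simp: polys_over_def subring_mult)

lemma const_in_polys_over: "unital_subring C \<Longrightarrow> c \<in> C \<Longrightarrow> [:c:] \<in> polys_over C"
  using monom_in_polys_over[of C c 0] by (simp add: monom_0)

definition adjoin :: "'a::comm_ring_1 set \<Rightarrow> 'a \<Rightarrow> 'a set" where
  "adjoin C x = (\<lambda>q. poly q x) ` polys_over C"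

lemma unital_subring_adjoin:
  assumes "unital_subring C"
  shows "unital_subring (adjoin C x)"
proof -
  have *: "unital_subring (polys_over C)"
    using assms by (rule unital_subring_polys_over)
  have "poly 1 x \<in> adjoin C x"
    unfolding adjoin_def using subring_1[OF *] by blast
  moreover have "poly p x - poly q x \<in> adjoin C x \<and> poly p x * poly q x \<in> adjoin C x"
    if "p \<in> polys_over C" "q \<in> polys_over C" for p q
  proof -
    have "poly (p - q) x \<in> adjoin C x" "poly (p * q) x \<in> adjoin C x"
      unfolding adjoin_def using subring_diff[OF * that] subring_mult[OF * that] by blast+
    then show ?thesis by simp
  qed
  ultimately show ?thesis
    by (auto simp: unital_subring_def adjoin_def)
qed

lemma subset_adjoin: "unital_subring C \<Longrightarrow> C \<subseteq> adjoin C x"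
  using const_in_polys_over by (force simp: adjoin_def)

lemma in_adjoin: "unital_subring C \<Longrightarrow> x \<in> adjoin C x"
  using monom_in_polys_over[of C 1 1] by (force simp: adjoin_def poly_monom subring_1)

text \<open>Division with remainder that never divides by the leading coefficient of
  \<open>r\<close>: each step multiplies the dividend by it and then cancels the top term, which
  accounts for the factor \<open>lead_coeff r ^ j\<close>.\<close>

lemma pseudo_division_over:
  fixes C :: "'a::idom set"
  assumes C: "unital_subring C" and r: "r \<in> polys_over C" "r \<noteq> 0" and q: "q \<in> polys_over C"
  shows "\<exists>j. \<exists>a\<in>polys_over C. \<exists>s\<in>polys_over C.
    smult (lead_coeff r ^ j) q = a * r + s \<and> (s = 0 \<or> degree s < degree r)"
  using q
\<comment> \<open>A nonzero constant and 0 both have degree 0. The measure separates them, which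
  matters when \<open>r\<close> is itself constant.\<close>
proof (induction "if q = 0 then 0 else Suc (degree q)" arbitrary: q rule: less_induct)
  case less
  note P = unital_subring_polys_over[OF C]
  show ?case
  proof (cases "q = 0 \<or> degree q < degree r")
    case True
    then show ?thesis
      using less.prems subring_0[OF P] by (intro exI[of _ 0] bexI[of _ 0] bexI[of _ q]) auto
  next
    case False
    define l where "l = lead_coeff r"
    define t where "t = monom (lead_coeff q) (degree q - degree r)"
    define q' where "q' = smult l q - t * r"
    have l: "l \<in> C" "l \<noteq> 0"
      using r by (auto simp: l_def polys_over_def)
    have t: "t \<in> polys_over C"
      unfolding t_def using less.prems by (intro monom_in_polys_over[OF C]) (auto simp: polys_over_def)
    have q': "q' \<in> polys_over C"
      unfolding q'_def by (intro subring_intros[OF P] smult_in_polys_over C l t r less.prems)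
    have "t \<noteq> 0"
      using False by (simp add: t_def)
    have dt: "degree (t * r) = degree q"
      using \<open>t \<noteq> 0\<close> r False by (simp add: degree_mult_eq t_def degree_monom_eq)
    have lt: "lead_coeff (t * r) = l * lead_coeff q"
      using False by (simp only: lead_coeff_mult) (simp add: t_def l_def degree_monom_eq)
    have "q' = 0 \<or> degree q' < degree q"
    proof (rule ccontr)
      assume H: "\<not> ?thesis"
      have "degree q' \<le> degree q"
        unfolding q'_def using dt by (intro degree_diff_le) (auto simp: degree_smult_le)
      with H have "degree q' = degree q" by linarith
      moreover have "poly.coeff q' (degree q) = 0"
        using lt by (simp add: q'_def dt)
      ultimately show False using H by (metis leading_coeff_0_iff)
    qed
    then have "(if q' = 0 then 0 else Suc (degree q')) <
        (if q = 0 then 0 else Suc (degree q))"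
      using False by auto
    from less.hyps[OF this q'] obtain j a s where jas: "a \<in> polys_over C" "s \<in> polys_over C"
      "smult (l ^ j) q' = a * r + s" "s = 0 \<or> degree s < degree r"
      unfolding l_def by blast
    have "smult (l ^ Suc j) q = (a + smult (l ^ j) t) * r + s"
    proof -
      have "smult (l ^ Suc j) q = smult (l ^ j) (q' + t * r)"
        by (simp add: q'_def mult.commute)
      also have "\<dots> = a * r + s + smult (l ^ j) (t * r)"
        by (simp only: smult_add_right jas)
      finally show ?thesis by (simp add: algebra_simps)
    qed
    moreover have "a + smult (l ^ j) t \<in> polys_over C"
      by (intro subring_intros[OF P] smult_in_polys_over C l t jas subring_power[OF C])
    ultimately show ?thesis
      unfolding l_def using jas by blast
  qed
qed

text \<open>
  Allowing powers of arbitrary nonzero \<open>c\<close>, that is, allowing \<open>c\<close> to be inverted, makes the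
  property inductive under the adjunction of elements.
\<close>

definition almost_no_prime_invertible :: "'a::field_char_0 set \<Rightarrow> bool" where
  "almost_no_prime_invertible C \<longleftrightarrow>
     (\<forall>c\<in>C - {0}. finite {p::nat. prime p \<and> (\<exists>k. \<exists>g\<in>C. c ^ k = of_nat p * g)})"

lemma unital_subring_range_of_int: "unital_subring (range of_int)"
  unfolding unital_subring_def
  by (auto simp: image_iff simp flip: of_int_diff of_int_mult intro: exI[of _ 1])

lemma almost_no_prime_invertible_of_int:
  "almost_no_prime_invertible (range of_int :: 'a::field_char_0 set)"
  unfolding almost_no_prime_invertible_def
proof
  fix c :: 'a assume "c \<in> range of_int - {0}"
  then obtain z where z: "c = of_int z" "z \<noteq> 0" by auto
  have "p \<le> nat \<bar>z\<bar>" if p: "prime p" and "\<exists>k. \<exists>g\<in>range of_int. c ^ k = of_nat p * g" for p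
  proof -
    from that obtain k g where "of_int z ^ k = (of_nat p * of_int g :: 'a)" by (auto simp: z)
    then have "of_int (z ^ k) = (of_int (int p * g) :: 'a)" by simp
    then have "z ^ k = int p * g" by (simp only: of_int_eq_iff)
    then have "int p dvd z ^ k" by simp
    then have "int p dvd z"
      using p prime_dvd_power[of "int p" z k] by simp
    then show ?thesis using dvd_imp_le_int[of z "int p"] z by linarith
  qed
  then have "{p. prime p \<and> (\<exists>k. \<exists>g\<in>range of_int. c ^ k = of_nat p * g)} \<subseteq> {..nat \<bar>z\<bar>}"
    by auto
  then show "finite {p. prime p \<and> (\<exists>k. \<exists>g\<in>range of_int. c ^ k = of_nat p * g)}"
    by (rule finite_subset) simp
qed

text \<open>A relation \<open>c ^ k = of_nat p * g\<close> over C[x] is pushed down to one over C,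
  for a fixed nonzero element of C that does not depend on p. If \<open>x\<close> is transcendental
  over C, the relation is an identity of polynomials and leading coefficients are compared. If
  \<open>x\<close> is algebraic, \<open>c\<close> is first replaced by a nonzero multiple in C, and
  constant coefficients are compared after reduction modulo a relation of least degree.\<close>

lemma almost_no_prime_invertible_adjoin:
  fixes C :: "'a::field_char_0 set"
  assumes C: "unital_subring C" and fin: "almost_no_prime_invertible C"
  shows "almost_no_prime_invertible (adjoin C x)"
  unfolding almost_no_prime_invertible_def
proof
  note P = unital_subring_polys_over[OF C]
  fix c assume c: "c \<in> adjoin C x - {0}"
  let ?bad = "\<lambda>c C. {p::nat. prime p \<and> (\<exists>k. \<exists>g\<in>C. c ^ k = of_nat p * g)}"
  have fin': "finite (?bad c C)" if "c \<in> C" "c \<noteq> 0" for c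
    using fin that by (auto simp: almost_no_prime_invertible_def)
  show "finite (?bad c (adjoin C x))"
  proof (cases "\<exists>\<mu>\<in>polys_over C. \<mu> \<noteq> 0 \<and> poly \<mu> x = 0")
    case False
    from c obtain q where q: "q \<in> polys_over C" "c = poly q x" "q \<noteq> 0"
      by (fastforce simp: adjoin_def)
    have "?bad c (adjoin C x) \<subseteq> ?bad (lead_coeff q) C"
    proof safe
      fix p k g assume p: "prime p" and g: "g \<in> adjoin C x" and eq: "c ^ k = of_nat p * g"
      from g obtain h where h: "h \<in> polys_over C" "g = poly h x"
        by (auto simp: adjoin_def)
      have "poly (q ^ k - smult (of_nat p) h) x = 0"
        using eq h q by (simp add: poly_power)
      moreover have "q ^ k - smult (of_nat p) h \<in> polys_over C"
        by (intro subring_intros[OF P] smult_in_polys_over C subring_of_nat[OF C] q h)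
      ultimately have "q ^ k = smult (of_nat p) h"
        using False by force
      then have "lead_coeff q ^ k = of_nat p * lead_coeff h"
        using lead_coeff_power[of q k] lead_coeff_smult[of "of_nat p" h] by metis
      moreover have "lead_coeff h \<in> C" using h by (auto simp: polys_over_def)
      ultimately show "\<exists>k. \<exists>g\<in>C. lead_coeff q ^ k = of_nat p * g" by blast
    qed
    moreover have "finite (?bad (lead_coeff q) C)"
      using q by (intro fin') (auto simp: polys_over_def)
    ultimately show ?thesis by (rule finite_subset)
  next
    case True
    let ?A = "{\<mu>. \<mu> \<in> polys_over C \<and> \<mu> \<noteq> 0 \<and> poly \<mu> x = 0}"
    \<comment> \<open>A nonzero relation of least degree. It need not be monic, so every reduction
      modulo \<open>\<mu>\<close> costs a power of its leading coefficient \<open>d\<close>.\<close>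
    define \<mu> where "\<mu> = arg_min degree (\<lambda>\<mu>. \<mu> \<in> ?A)"
    have \<mu>: "\<mu> \<in> polys_over C" "\<mu> \<noteq> 0" "poly \<mu> x = 0"
      using True arg_min_natI[of "\<lambda>\<mu>. \<mu> \<in> ?A" _ degree] unfolding \<mu>_def by blast+
    have min: "q = 0" if "q \<in> polys_over C" "poly q x = 0" "degree q < degree \<mu>" for q
      using arg_min_nat_le[of "\<lambda>\<mu>. \<mu> \<in> ?A" q degree] that unfolding \<mu>_def
      by fastforce
    have deg: "degree \<mu> > 0"
    proof (rule ccontr)
      assume "\<not> ?thesis"
      then obtain a where "\<mu> = [:a:]" by (metis degree_eq_zeroE neq0_conv)
      with \<mu> show False by auto
    qed
    define d where "d = lead_coeff \<mu>"
    have d: "d \<in> C" "d \<noteq> 0" using \<mu> by (auto simp: d_def polys_over_def)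
    \<comment> \<open>For algebraic \<open>x\<close> a nonzero element of C[x] has a nonzero
      multiple in C: a polynomial \<open>r\<close> of least degree whose value at \<open>x\<close>
      is a nonzero multiple of \<open>c\<close> turns out to be constant.\<close>
    obtain h where h: "h \<in> adjoin C x" "c * h \<in> C" "c * h \<noteq> 0"
    proof -
      let ?B = "{r. r \<in> polys_over C \<and> poly r x \<noteq> 0 \<and> (\<exists>h\<in>adjoin C x. poly r x = c * h)}"
      note Ad = unital_subring_adjoin[OF C, of x]
      obtain q where "q \<in> polys_over C" "c = poly q x"
        using c by (auto simp: adjoin_def)
      then have ne: "\<exists>r. r \<in> ?B"
        using c subring_1[OF Ad] by (intro exI[of _ q]) (auto intro!: bexI[of _ 1])
      define r where "r = arg_min degree (\<lambda>r. r \<in> ?B)"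
      have r: "r \<in> ?B"
        using ne arg_min_natI[of "\<lambda>r. r \<in> ?B" _ degree] unfolding r_def by blast
      have rmin: "degree r \<le> degree r'" if "r' \<in> ?B" for r'
        using arg_min_nat_le[of "\<lambda>r. r \<in> ?B" r' degree] that unfolding r_def by blast
      have "r \<noteq> 0" using r by auto
      \<comment> \<open>The remainder of \<open>r\<close> modulo \<open>\<mu>\<close> has the value
        \<open>d ^ j * poly r x\<close>, so it is a candidate as well and minimality applies to
        it.\<close>
      have deg_r: "degree r < degree \<mu>"
      proof -
        obtain j a s where s: "a \<in> polys_over C" "s \<in> polys_over C" "smult (d ^ j) r = a * \<mu> + s"
          "s = 0 \<or> degree s < degree \<mu>"
          using pseudo_division_over[OF C \<mu>(1,2), of r] r unfolding d_def by blast
        have "poly s x = d ^ j * poly r x"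
          using arg_cong[OF s(3), of "\<lambda>q. poly q x"] \<mu> by simp
        moreover from r obtain h where "h \<in> adjoin C x" "poly r x = c * h" by blast
        moreover have "d ^ j * h \<in> adjoin C x"
          using \<open>h \<in> adjoin C x\<close> d subset_adjoin[OF C] subring_power[OF Ad] subring_mult[OF Ad] by blast
        ultimately have "s \<in> ?B"
          using s r d by (auto intro!: bexI[of _ "d ^ j * h"] simp: algebra_simps)
        with rmin[of s] s show ?thesis by auto
      qed
      have "degree r = 0"
      proof (rule ccontr)
        \<comment> \<open>Dividing \<open>\<mu>\<close> by \<open>r\<close> leaves a remainder whose
          value at \<open>x\<close> is a multiple of \<open>c\<close>. Minimality of
          \<open>r\<close> makes that value 0, hence the remainder is 0, and the quotient becomes a
          relation for \<open>x\<close> of smaller degree than \<open>\<mu>\<close>.\<close>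
        assume r0: "degree r \<noteq> 0"
        define l where "l = lead_coeff r"
        obtain j a s where s: "a \<in> polys_over C" "s \<in> polys_over C" "smult (l ^ j) \<mu> = a * r + s"
          "s = 0 \<or> degree s < degree r"
          using pseudo_division_over[OF C _ \<open>r \<noteq> 0\<close> \<mu>(1)] r unfolding l_def by blast
        have l: "l \<noteq> 0" using \<open>r \<noteq> 0\<close> by (simp add: l_def)
        have eq: "poly s x = - poly a x * poly r x"
          using arg_cong[OF s(3), of "\<lambda>q. poly q x"] \<mu> by (simp add: add_eq_0_iff)
        obtain h where hh: "h \<in> adjoin C x" "poly r x = c * h" using r by blast
        have "poly s x = c * (- poly a x * h)" using eq hh by simp
        moreover have "- poly a x * h \<in> adjoin C x"
          using s(1) hh by (intro subring_mult[OF Ad] subring_uminus[OF Ad]) (auto simp: adjoin_def)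
        ultimately have "poly s x = 0"
          using rmin[of s] s r0 by (metis (mono_tags, lifting) bot_nat_0.not_eq_extremum degree_0 linorder_not_less mem_Collect_eq)
        then have "s = 0" using min[of s] s deg_r by auto
        have "poly a x = 0" using eq \<open>poly s x = 0\<close> r by auto
        have "a \<noteq> 0" using s(3) \<open>s = 0\<close> l \<mu> by auto
        have "degree \<mu> = degree a + degree r"
          using s(3) \<open>s = 0\<close> l \<open>a \<noteq> 0\<close> \<open>r \<noteq> 0\<close>
          by (metis add.right_neutral degree_mult_eq degree_smult_eq power_not_zero)
        then have "a = 0" using min[of a] s(1) \<open>poly a x = 0\<close> r0 by simp
        with \<open>a \<noteq> 0\<close> show False by simp
      qed
      then obtain w where w: "r = [:w:]" by (metis degree_eq_zeroE)
      then have "w \<in> C" using r by (auto simp: polys_over_def split: nat.splits dest: spec[of _ 0])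
      with r w that show thesis by auto
    qed
    define c' where "c' = c * h"
    have c'': "c' * d \<in> C" "c' * d \<noteq> 0"
      using h d subring_mult[OF C] by (auto simp: c'_def)
    have "?bad c (adjoin C x) \<subseteq> ?bad (c' * d) C"
    proof safe
      fix p k g assume p: "prime p" and g: "g \<in> adjoin C x" and eq: "c ^ k = of_nat p * g"
      note Ad = unital_subring_adjoin[OF C, of x]
      have "g * h ^ k \<in> adjoin C x"
        by (intro subring_intros[OF Ad] g h)
      then obtain q where q: "q \<in> polys_over C" "g * h ^ k = poly q x"
        by (auto simp: adjoin_def)
      obtain j a s where s: "a \<in> polys_over C" "s \<in> polys_over C" "smult (d ^ j) q = a * \<mu> + s"
        "s = 0 \<or> degree s < degree \<mu>"
        using pseudo_division_over[OF C \<mu>(1,2) q(1)] unfolding d_def by blast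
      have "poly s x = d ^ j * poly q x"
        using arg_cong[OF s(3), of "\<lambda>q. poly q x"] \<mu> by simp
      then have "of_nat p * poly s x = d ^ j * c' ^ k"
        using eq q(2) by (simp add: c'_def power_mult_distrib)
      \<comment> \<open>A relation for \<open>x\<close> of degree below that of \<open>\<mu>\<close>
        is the zero polynomial, so the constant coefficients on both sides agree.\<close>
      then have "poly ([:d ^ j * c' ^ k:] - smult (of_nat p) s) x = 0"
        by simp
      moreover have "[:d ^ j * c' ^ k:] - smult (of_nat p) s \<in> polys_over C"
        by (intro subring_intros[OF P] smult_in_polys_over const_in_polys_over C
            subring_intros[OF C] d s h(2)[folded c'_def])
      moreover have "degree ([:d ^ j * c' ^ k:] - smult (of_nat p) s) < degree \<mu>"
        using s(4) deg by (intro degree_diff_less) (auto intro: le_less_trans[OF degree_smult_le])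
      ultimately have "[:d ^ j * c' ^ k:] = smult (of_nat p) s"
        using min by force
      then have "poly.coeff [:d ^ j * c' ^ k:] 0 = of_nat p * poly.coeff s 0"
        by (simp only: coeff_smult)
      then have "d ^ j * c' ^ k = of_nat p * poly.coeff s 0" by simp
      \<comment> \<open>The factor \<open>d ^ k * c' ^ j\<close> equalizes the two exponents, so
        that a power of the single element \<open>c' * d\<close> appears.\<close>
      then have "(c' * d) ^ (j + k) = of_nat p * (poly.coeff s 0 * d ^ k * c' ^ j)"
        by (simp add: power_mult_distrib power_add algebra_simps)
      moreover have "poly.coeff s 0 * d ^ k * c' ^ j \<in> C"
        using s(2) by (intro subring_intros[OF C] d h(2)[folded c'_def]) (auto simp: polys_over_def)
      ultimately show "\<exists>k. \<exists>g\<in>C. (c' * d) ^ k = of_nat p * g" by blast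
    qed
    then show ?thesis by (rule finite_subset[OF _ fin'[OF c'']])
  qed
qed

text \<open>The elements of \<open>E\<close> are adjoined to the integers one at a time. For
  \<open>c = 1\<close> the invariant says that only finitely many primes are units of C, and
  \<open>N\<close> bounds them.\<close>

proposition finite_subset_subring_almost_no_prime_invertible:
  fixes E :: "'a::field_char_0 set"
  assumes "finite E"
  shows "\<exists>C. unital_subring C \<and> E \<subseteq> C \<and> (\<exists>N. \<forall>p::nat. prime p \<and> p > N \<longrightarrow> (\<forall>g\<in>C. of_nat p * g \<noteq> 1))"
proof -
  from assms have "\<exists>C. unital_subring C \<and> E \<subseteq> C \<and> almost_no_prime_invertible C"
  proof induction
    case empty
    show ?case
      using unital_subring_range_of_int almost_no_prime_invertible_of_int by blast
  next
    case (insert x E)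
    then obtain C where "unital_subring C" "E \<subseteq> C" "almost_no_prime_invertible C" by blast
    then show ?case
      using unital_subring_adjoin[of C x] almost_no_prime_invertible_adjoin[of C x]
        subset_adjoin[of C x] in_adjoin[of C x] by blast
  qed
  then obtain C where C: "unital_subring C" "E \<subseteq> C" "almost_no_prime_invertible C" by blast
  let ?bad = "{p::nat. prime p \<and> (\<exists>k. \<exists>g\<in>C. 1 ^ k = of_nat p * g)}"
  have "finite ?bad"
    using bspec[OF C(3)[unfolded almost_no_prime_invertible_def], of 1] subring_1[OF C(1)] by simp
  then obtain N where N: "\<forall>p\<in>?bad. p \<le> N"
    unfolding finite_nat_set_iff_bounded_le by blast
  have "of_nat p * g \<noteq> 1" if "prime p" "p > N" "g \<in> C" for p g
  proof
    assume "of_nat p * g = 1"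
    then have "p \<in> ?bad"
      using that by (auto intro!: bexI[of _ g])
    then show False using N that by auto
  qed
  then have "\<forall>p. prime p \<and> p > N \<longrightarrow> (\<forall>g\<in>C. of_nat p * g \<noteq> 1)"
    by blast
  then show ?thesis using C by blast
qed

subsection \<open>Polynomials with restricted coefficients\<close>

lemma poly_mapping_add_induct [case_names zero single add]:
  assumes "P 0" and "\<And>u c. P (Poly_Mapping.single u c)" and "\<And>f g. P f \<Longrightarrow> P g \<Longrightarrow> P (f + g)"
  shows "P f"
proof (induction f rule: update_induct)
  case (update f u c)
  have "Poly_Mapping.update u c f = f + Poly_Mapping.single u c"
    using update.hyps(1)
    by (auto intro!: poly_mapping_eqI simp: lookup_update lookup_add lookup_single when_def in_keys_iff)
  then show ?case
    using assms update.IH by simp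
qed (rule assms)

lemma poly_mapping_sum_single: "f = (\<Sum>u\<in>keys f. Poly_Mapping.single u (lookup f u))"
  by (rule poly_mapping_eqI) (auto simp: lookup_sum lookup_single when_def sum.delta in_keys_iff)

lemma mult_eq_sum_single:
  fixes f g :: "('u::monoid_add) \<Rightarrow>\<^sub>0 ('a::semiring_0)"
  shows "f * g = (\<Sum>u\<in>keys f. \<Sum>v\<in>keys g.
    Poly_Mapping.single (u + v) (lookup f u * lookup g v))"
  using arg_cong2[OF poly_mapping_sum_single[of f] poly_mapping_sum_single[of g], of "(*)"]
  by (simp add: sum_product mult_single)

lemma lookup_map_zero: "h 0 = 0 \<Longrightarrow> lookup (Poly_Mapping.map h f) u = h (lookup f u)"
  by (simp add: Poly_Mapping.map.rep_eq when_def)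

lemma map_single_zero: "h 0 = 0 \<Longrightarrow> Poly_Mapping.map h (Poly_Mapping.single u c) = Poly_Mapping.single u (h c)"
  by (rule poly_mapping_eqI) (simp add: lookup_map_zero lookup_single when_def)

lemma map_add_hom:
  "h 0 = 0 \<Longrightarrow> (\<And>x y. h (x + y) = h x + h y) \<Longrightarrow>
    Poly_Mapping.map h (f + g) = Poly_Mapping.map h f + Poly_Mapping.map h g"
  by (rule poly_mapping_eqI) (simp add: lookup_map_zero lookup_add)

lemma map_mult_hom:
  fixes f g :: "('u::monoid_add) \<Rightarrow>\<^sub>0 ('a::semiring_0)" and h :: "'a \<Rightarrow> 'b::semiring_0"
  assumes h0: "h 0 = 0" and ha: "\<And>x y. h (x + y) = h x + h y" and hm: "\<And>x y. h (x * y) = h x * h y"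
  shows "Poly_Mapping.map h (f * g) = Poly_Mapping.map h f * Poly_Mapping.map h g"
proof (induction f rule: poly_mapping_add_induct)
  case zero
  show ?case by (simp add: map_eq_zero_iff[THEN iffD2])
next
  case (single u c)
  show ?case
  proof (induction g rule: poly_mapping_add_induct)
    case zero
    show ?case by (simp add: map_eq_zero_iff[THEN iffD2])
  next
    case (single v d)
    show ?case by (simp add: map_single_zero h0 mult_single hm)
  next
    case (add f g)
    then show ?case by (simp add: distrib_left map_add_hom[of h, OF h0 ha])
  qed
next
  case (add f f')
  then show ?case by (simp add: distrib_right map_add_hom[of h, OF h0 ha])
qed

definition of_rat_mpoly :: "rat mpoly \<Rightarrow> complex mpoly" where
  "of_rat_mpoly = Poly_Mapping.map of_rat"

definition of_int_mpoly :: "int mpoly \<Rightarrow> rat mpoly" where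
  "of_int_mpoly = Poly_Mapping.map of_int"

lemma of_rat_mpoly_simps [simp]:
  "of_rat_mpoly 0 = 0" "of_rat_mpoly 1 = 1"
  "of_rat_mpoly (f + g) = of_rat_mpoly f + of_rat_mpoly g"
  "of_rat_mpoly (f * g) = of_rat_mpoly f * of_rat_mpoly g"
  "lookup (of_rat_mpoly f) u = of_rat (lookup f u)"
  unfolding of_rat_mpoly_def
  by (simp_all add: poly_mapping_eq_iff fun_eq_iff lookup_map_zero map_add_hom map_mult_hom of_rat_add of_rat_mult
      lookup_one when_def del: map_single)

lemma of_int_mpoly_simps [simp]:
  "of_int_mpoly 0 = 0" "of_int_mpoly 1 = 1"
  "of_int_mpoly (f + g) = of_int_mpoly f + of_int_mpoly g"
  "of_int_mpoly (f * g) = of_int_mpoly f * of_int_mpoly g"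
  "lookup (of_int_mpoly f) u = of_int (lookup f u)"
  unfolding of_int_mpoly_def
  by (simp_all add: poly_mapping_eq_iff fun_eq_iff lookup_map_zero map_add_hom map_mult_hom
      lookup_one when_def del: map_single)

lemma of_rat_mpoly_power [simp]: "of_rat_mpoly (f ^ k) = of_rat_mpoly f ^ k"
  by (induction k) auto

lemma of_rat_mpoly_diff [simp]: "of_rat_mpoly (f - g) = of_rat_mpoly f - of_rat_mpoly g"
  by (rule poly_mapping_eqI) (simp add: lookup_minus of_rat_diff)

lemma of_rat_mpoly_of_nat [simp]: "of_rat_mpoly (of_nat k) = of_nat k"
  by (rule poly_mapping_eqI) (simp add: lookup_of_nat when_def)

lemma lookup_mult_zero:
  fixes f g :: "'a::comm_semiring_0 mpoly"
  shows "lookup (f * g) 0 = lookup f 0 * lookup g 0"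
proof (induction f rule: poly_mapping_add_induct)
  case (single u c)
  show ?case
  proof (induction g rule: poly_mapping_add_induct)
    case (single v d)
    have "u + v = 0 \<longleftrightarrow> u = 0 \<and> v = 0"
      by (auto simp: poly_mapping_eq_iff fun_eq_iff lookup_add)
    then show ?case by (auto simp: mult_single lookup_single when_def)
  qed (auto simp: distrib_left lookup_add)
qed (auto simp: distrib_right lookup_add)

lemma lookup_power_zero:
  fixes f :: "'a::comm_ring_1 mpoly"
  shows "lookup (f ^ k) 0 = lookup f 0 ^ k"
  by (induction k) (auto simp: lookup_mult_zero)

lemma lookup_const_mult:
  fixes f :: "'a::comm_semiring_0 mpoly"
  shows "lookup (const_mpoly c * f) u = c * lookup f u"
  by (simp flip: mult_map_scale_conv_mult add: lookup_map_zero)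

lemma lookup_of_nat_mult:
  fixes f :: "'a::comm_ring_1 mpoly"
  shows "lookup (of_nat k * f) u = of_nat k * lookup f u"
  by (simp add: lookup_const_mult flip: single_of_nat)

lemma mpolys_iff:
  "0 \<in> A \<Longrightarrow> f \<in> mpolys n A \<longleftrightarrow>
    (\<forall>u. lookup f u \<in> A) \<and> (\<forall>u. lookup f u \<noteq> 0 \<longrightarrow> keys u \<subseteq> {..<n})"
  by (force simp: mpolys_def in_keys_iff)

lemma mpolys_mono: "A \<subseteq> B \<Longrightarrow> mpolys n A \<subseteq> mpolys n B"
  by (auto simp: mpolys_def)

lemma single_in_mpolys: "c \<in> A \<Longrightarrow> keys u \<subseteq> {..<n} \<Longrightarrow> Poly_Mapping.single u c \<in> mpolys n A"
  by (auto simp: mpolys_def)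

lemma const_in_mpolys: "c \<in> A \<Longrightarrow> const_mpoly c \<in> mpolys n A"
  by (rule single_in_mpolys) auto

lemma X_var_in_mpolys: "1 \<in> A \<Longrightarrow> i < n \<Longrightarrow> X_var i \<in> mpolys n A"
  by (rule single_in_mpolys) auto

lemma unital_subring_mpolys:
  fixes A :: "'a::comm_ring_1 set"
  assumes A: "unital_subring A"
  shows "unital_subring (mpolys n A)"
proof -
  note it = mpolys_iff[OF subring_0[OF A]]
  have one: "1 \<in> mpolys n A"
    using const_in_mpolys[OF subring_1[OF A]] by simp
  have zero: "0 \<in> mpolys n A"
    by (simp add: mpolys_def)
  have add: "f + g \<in> mpolys n A" if "f \<in> mpolys n A" "g \<in> mpolys n A" for f g
    using that by (auto simp: it lookup_add subring_add[OF A]) (metis add_0 subsetD lessThan_iff)+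
  have sum: "sum f I \<in> mpolys n A" if "\<And>i. i \<in> I \<Longrightarrow> f i \<in> mpolys n A" for f :: "(nat \<Rightarrow>\<^sub>0 nat) \<Rightarrow> _" and I
    using that by (induction I rule: infinite_finite_induct) (auto intro: zero add)
  have diff: "f - g \<in> mpolys n A" if "f \<in> mpolys n A" "g \<in> mpolys n A" for f g
    using that by (auto simp: it lookup_minus subring_diff[OF A]) (metis diff_self subsetD lessThan_iff)+
  have mult: "f * g \<in> mpolys n A" if f: "f \<in> mpolys n A" and g: "g \<in> mpolys n A" for f g
  proof -
    show ?thesis
      unfolding mult_eq_sum_single[of f g]
    proof (intro sum single_in_mpolys)
      fix u v assume uv: "u \<in> keys f" "v \<in> keys g"
      then show "lookup f u * lookup g v \<in> A"
        using f g by (auto simp: mpolys_def intro: subring_mult[OF A])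
      show "keys (u + v) \<subseteq> {..<n}"
        using uv f g keys_add[of u v] unfolding mpolys_def by blast
    qed
  qed
  show ?thesis
    unfolding unital_subring_def using one diff mult by blast
qed

lemma pderiv_in_mpolys:
  assumes A: "unital_subring A" and f: "f \<in> mpolys n A"
  shows "pderiv_mpoly i f \<in> mpolys n A"
proof -
  note it = mpolys_iff[OF subring_0[OF A]]
  have "keys u \<subseteq> {..<n}" if "lookup (pderiv_mpoly i f) u \<noteq> 0" for u
  proof -
    have "lookup f (u + Poly_Mapping.single i 1) \<noteq> 0"
      using that by (auto simp: pderiv_mpoly.rep_eq)
    then have *: "keys (u + Poly_Mapping.single i 1) \<subseteq> {..<n}"
      using f by (auto simp: it)
    have "keys u \<subseteq> keys (u + Poly_Mapping.single i 1)"
      by (auto simp: in_keys_iff lookup_add)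
    with * show ?thesis by blast
  qed
  moreover have "lookup (pderiv_mpoly i f) u \<in> A" for u
    using f unfolding pderiv_mpoly.rep_eq
    by (intro subring_mult[OF A] subring_of_nat[OF A]) (simp add: it)
  ultimately show ?thesis by (simp add: it)
qed

lemma of_rat_mpoly_in_mpolys:
  assumes "f \<in> mpolys n A" "of_rat ` A \<subseteq> B"
  shows "of_rat_mpoly f \<in> mpolys n B"
  using assms by (auto simp: mpolys_def in_keys_iff)

lemma of_int_mpoly_in_mpolys:
  assumes "f \<in> mpolys n UNIV" "unital_subring A"
  shows "of_int_mpoly f \<in> mpolys n A"
  using assms subring_of_int by (auto simp: mpolys_def in_keys_iff)

text \<open>For \<open>G\<close> inside a subring C this is the ideal of C generated by
  \<open>G\<close>. Keeping the coefficients as a set parameter lets one type carry spans over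
  \<complex>[X] and over B[X] at the same time.\<close>

inductive_set span_over :: "'a::comm_ring_1 set \<Rightarrow> 'a set \<Rightarrow> 'a set" for C G where
  zero: "0 \<in> span_over C G"
| step: "c \<in> C \<Longrightarrow> g \<in> G \<Longrightarrow> x \<in> span_over C G \<Longrightarrow> c * g + x \<in> span_over C G"

lemma span_over_add: "x \<in> span_over C G \<Longrightarrow> y \<in> span_over C G \<Longrightarrow> x + y \<in> span_over C G"
  by (induction x rule: span_over.induct) (auto intro: span_over.intros simp: add.assoc)

lemma span_over_least:
  assumes "x \<in> span_over C G" "0 \<in> I" "\<And>x y. x \<in> I \<Longrightarrow> y \<in> I \<Longrightarrow> x + y \<in> I"
    and "\<And>c g. c \<in> C \<Longrightarrow> g \<in> G \<Longrightarrow> c * g \<in> I"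
  shows "x \<in> I"
  using assms(1) by induction (use assms in auto)

lemma of_rat_mpoly_span_over:
  assumes "x \<in> span_over C G" "of_rat_mpoly ` C \<subseteq> D" "of_rat_mpoly ` G \<subseteq> H"
  shows "of_rat_mpoly x \<in> span_over D H"
  using assms(1) by induction (use assms in \<open>auto intro!: span_over.intros\<close>)

context
  fixes C :: "'a::comm_ring_1 set"
  assumes C: "unital_subring C"
begin

lemma span_over_mult: "c \<in> C \<Longrightarrow> x \<in> span_over C G \<Longrightarrow> c * x \<in> span_over C G"
  by (rotate_tac, induction x rule: span_over.induct)
    (auto intro: span_over.intros subring_mult[OF C] simp: distrib_left mult.assoc[symmetric])

lemma span_over_superset: "g \<in> G \<Longrightarrow> g \<in> span_over C G"
  using span_over.step[OF subring_1[OF C] _ span_over.zero] by force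

lemma span_over_mult_gen: "c \<in> C \<Longrightarrow> g \<in> G \<Longrightarrow> c * g \<in> span_over C G"
  by (intro span_over_mult span_over_superset)

lemma span_over_diff: "x \<in> span_over C G \<Longrightarrow> y \<in> span_over C G \<Longrightarrow> x - y \<in> span_over C G"
  using span_over_add[of x C G "- 1 * y"] span_over_mult[of "- 1" y] C
  by (simp add: subring_uminus subring_1)

lemma span_over_subset: "G \<subseteq> C \<Longrightarrow> span_over C G \<subseteq> C"
  by (auto elim!: span_over_least intro: subring_intros[OF C])

lemma span_over_trans:
  assumes "x \<in> span_over C G" "G \<subseteq> span_over C H"
  shows "x \<in> span_over C H"
  by (rule span_over_least[OF assms(1)])
    (use assms(2) in \<open>auto intro: span_over.zero span_over_add span_over_mult\<close>)

lemma span_over_product: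
  assumes x: "x \<in> span_over C G" and y: "y \<in> span_over C H"
    and gh: "\<And>g h. g \<in> G \<Longrightarrow> h \<in> H \<Longrightarrow> g * h \<in> K"
  shows "x * y \<in> span_over C K"
proof (rule span_over_least[OF x, of "{x. x * y \<in> span_over C K}", simplified])
  fix c g assume cg: "c \<in> C" "g \<in> G"
  have "g * y \<in> span_over C K"
  proof (rule span_over_least[OF y, of "{y. g * y \<in> span_over C K}", simplified])
    fix d h assume "d \<in> C" "h \<in> H"
    then have "d * (g * h) \<in> span_over C K"
      by (intro span_over_mult_gen gh cg)
    then show "g * (d * h) \<in> span_over C K"
      by (simp add: mult.left_commute)
  qed (auto simp: distrib_left intro: span_over.zero span_over_add)
  then show "c * g * y \<in> span_over C K"
    using cg by (simp add: mult.assoc span_over_mult)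
qed (auto simp: distrib_right intro: span_over.zero span_over_add)

end

text \<open>These elements generate the r-th power of the ideal generated by \<open>G\<close>;
  containments of ideal powers are tested on them.\<close>

fun products :: "'a::comm_ring_1 set \<Rightarrow> nat \<Rightarrow> 'a set" where
  "products G 0 = {1}"
| "products G (Suc r) = {x * g |x g. x \<in> products G r \<and> g \<in> G}"

lemma products_subset: "unital_subring C \<Longrightarrow> G \<subseteq> C \<Longrightarrow> products G r \<subseteq> C"
  by (induction r) (auto intro: subring_intros)

lemma products_span_over:
  assumes C: "unital_subring C" and G: "G \<subseteq> span_over C H"
  shows "products G r \<subseteq> span_over C (products H r)"
proof (induction r)
  case 0
  show ?case using span_over_superset[OF C, of 1 "{1}"] by simp
next
  case (Suc r)
  show ?case
  proof
    fix z assume "z \<in> products G (Suc r)"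
    then obtain x g where z: "z = x * g" "x \<in> products G r" "g \<in> G" by auto
    have "x \<in> span_over C (products H r)" "g \<in> span_over C H"
      using z Suc G by auto
    then show "z \<in> span_over C (products H (Suc r))"
      unfolding z(1) by (rule span_over_product[OF C]) auto
  qed
qed

lemma products_list:
  assumes "x \<in> products (set fs) r"
  shows "\<exists>\<alpha>::nat \<Rightarrow> nat. (\<Sum>j<length fs. \<alpha> j) = r \<and> x = (\<Prod>j<length fs. fs ! j ^ \<alpha> j)"
  using assms
proof (induction r arbitrary: x)
  case 0
  then show ?case by (intro exI[of _ "\<lambda>_. 0"]) auto
next
  case (Suc r)
  then obtain y i where y: "y \<in> products (set fs) r" "i < length fs" "x = y * fs ! i"
    by (auto simp: in_set_conv_nth)
  from Suc.IH[OF y(1)] obtain \<alpha> where \<alpha>: "(\<Sum>j<length fs. \<alpha> j) = r" "y = (\<Prod>j<length fs. fs ! j ^ \<alpha> j)"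
    by blast
  let ?\<beta> = "\<lambda>j. \<alpha> j + (if j = i then 1 else 0)"
  have "(\<Sum>j<length fs. ?\<beta> j) = Suc r"
    using y(2) \<alpha>(1) by (simp add: sum.distrib)
  moreover have "(\<Prod>j<length fs. fs ! j ^ ?\<beta> j) = x"
    using y(2,3) \<alpha>(2) by (simp add: power_add prod.distrib if_distrib[of "\<lambda>k. _ ^ k"] cong: if_cong)
  ultimately show ?case by (intro exI[of _ ?\<beta>]) auto
qed

lemma prod_list_in_products:
  assumes "\<And>j. j < length fs \<Longrightarrow> fs ! j \<in> G"
  shows "(\<Prod>j<length fs. fs ! j ^ \<alpha> j) \<in> products G (\<Sum>j<length fs. \<alpha> j)"
proof -
  have *: "x * g ^ k \<in> products G (r + k)" if "x \<in> products G r" "g \<in> G" for x g r k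
  proof (induction k)
    case (Suc k)
    have "x * g ^ Suc k = x * g ^ k * g" by (simp add: ac_simps)
    with Suc show ?case
      using that(2) by (simp del: power_Suc) blast
  qed (use that in simp)
  have "(\<Prod>j<l. fs ! j ^ \<alpha> j) \<in> products G (\<Sum>j<l. \<alpha> j)" if "l \<le> length fs" for l
    using that by (induction l) (auto intro!: * assms)
  then show ?thesis by simp
qed

text \<open>Pigeonhole principle: some generator occurs at least \<open>t\<close> times.\<close>

lemma products_subset_if_powers:
  assumes C: "unital_subring C" and fin: "finite G" "G \<subseteq> C" and t: "\<And>g. g \<in> G \<Longrightarrow> g ^ t \<in> I"
    and r: "r > card G * t" and I: "\<And>c x. c \<in> C \<Longrightarrow> x \<in> I \<Longrightarrow> c * x \<in> I"
  shows "products G r \<subseteq> I"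
proof
  fix x assume x: "x \<in> products G r"
  obtain fs where fs: "set fs = G" "distinct fs" using finite_distinct_list[OF fin(1)] by blast
  then have len: "length fs = card G" by (metis distinct_card)
  obtain \<alpha> where \<alpha>: "(\<Sum>j<length fs. \<alpha> j) = r" "x = (\<Prod>j<length fs. fs ! j ^ \<alpha> j)"
    using products_list[of x fs r] x fs by blast
  have "\<exists>j<length fs. \<alpha> j \<ge> t"
  proof (rule ccontr)
    assume "\<not> ?thesis"
    then have "(\<Sum>j<length fs. \<alpha> j) \<le> (\<Sum>j<length fs. t)"
      by (intro sum_mono) auto
    then show False using \<alpha> r len by simp
  qed
  then obtain j where j: "j < length fs" "\<alpha> j \<ge> t" by blast
  have jG: "fs ! j \<in> G" using j fs by auto
  have "x = fs ! j ^ \<alpha> j * (\<Prod>i\<in>{..<length fs} - {j}. fs ! i ^ \<alpha> i)"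
    unfolding \<alpha>(2) using j by (subst prod.remove[of _ j]) auto
  also have "fs ! j ^ \<alpha> j = fs ! j ^ (\<alpha> j - t) * fs ! j ^ t"
    using j by (simp flip: power_add)
  finally have x_eq: "x = (fs ! j ^ (\<alpha> j - t) * (\<Prod>i\<in>{..<length fs} - {j}. fs ! i ^ \<alpha> i)) * fs ! j ^ t"
    by (simp add: algebra_simps)
  have "fs ! i \<in> C" if "i < length fs" for i
    using that fs fin by auto
  then show "x \<in> I"
    unfolding x_eq using j by (intro I t jG subring_intros[OF C]) auto
qed

text \<open>A representation of \<open>x\<close> involves finitely many coefficients and stays valid
  over each subring that contains them. The generators are left alone, so \<open>G\<close> may be
  infinite.\<close>

lemma span_over_finite_coeffs:
  assumes "x \<in> span_over (mpolys n UNIV) G"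
  shows "\<exists>E. finite E \<and> (\<forall>C. unital_subring C \<and> E \<subseteq> C \<longrightarrow> x \<in> span_over (mpolys n C) G)"
  using assms
proof induction
  case zero
  show ?case by (auto intro: span_over.zero)
next
  case (step c g x)
  then obtain E where E: "finite E" "\<And>C. unital_subring C \<Longrightarrow> E \<subseteq> C \<Longrightarrow> x \<in> span_over (mpolys n C) G"
    by blast
  let ?E = "E \<union> lookup c ` keys c"
  have "c \<in> mpolys n C" if "?E \<subseteq> C" for C
    using that step.hyps(1) by (auto simp: mpolys_def)
  then show ?case
    using E step.hyps by (intro exI[of _ ?E]) (auto intro!: span_over.step)
qed

section \<open>Ideals of record rings in terms of the type-class operations\<close>

definition set_ring :: "'a::comm_ring_1 set \<Rightarrow> 'a ring" where
  "set_ring C = \<lparr>carrier = C, mult = (*), one = 1, zero = 0, add = (+)\<rparr>"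

lemma mpoly_ring_eq_set_ring: "mpoly_ring n A = set_ring (mpolys n A)"
  by (simp add: mpoly_ring_def set_ring_def)

lemma set_ring_simps [simp]:
  "carrier (set_ring C) = C" "mult (set_ring C) = (*)" "one (set_ring C) = 1"
  "zero (set_ring C) = 0" "add (set_ring C) = (+)"
  by (simp_all add: set_ring_def)

context
  fixes C :: "'a::comm_ring_1 set"
  assumes C: "unital_subring C"
begin

lemma cring_set_ring: "cring (set_ring C)"
proof (rule cringI)
  show "abelian_group (set_ring C)"
  proof (rule abelian_groupI)
    show "\<exists>y\<in>carrier (set_ring C). y \<oplus>\<^bsub>set_ring C\<^esub> x = \<zero>\<^bsub>set_ring C\<^esub>"
      if "x \<in> carrier (set_ring C)" for x
      using that by (auto intro!: bexI[of _ "- x"] subring_uminus[OF C])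
  qed (auto intro: subring_intros[OF C] simp: algebra_simps)
  show "comm_monoid (set_ring C)"
    by (rule comm_monoidI) (auto intro: subring_intros[OF C] simp: algebra_simps)
qed (auto simp: algebra_simps)

lemma nat_pow_set_ring [simp]: "x [^]\<^bsub>set_ring C\<^esub> (k::nat) = x ^ k"
proof -
  have "monoid (set_ring C)"
    using cring_set_ring by (simp add: cring_def ring_def)
  then show ?thesis
    by (induction k) (simp_all add: monoid.nat_pow_0 monoid.nat_pow_Suc nat_pow_def mult.commute)
qed

lemma ideal_set_ringD:
  assumes "ideal I (set_ring C)"
  shows "I \<subseteq> C" "0 \<in> I" "x \<in> I \<Longrightarrow> y \<in> I \<Longrightarrow> x + y \<in> I" "c \<in> C \<Longrightarrow> x \<in> I \<Longrightarrow> c * x \<in> I"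
    "x \<in> I \<Longrightarrow> y \<in> I \<Longrightarrow> x - y \<in> I"
proof -
  interpret ideal I "set_ring C" by fact
  show "I \<subseteq> C" using Icarr by auto
  show "0 \<in> I" using additive_subgroup.zero_closed[OF ideal.axioms(1)[OF assms]] by simp
  show add: "x \<in> I \<Longrightarrow> y \<in> I \<Longrightarrow> x + y \<in> I" for x y using additive_subgroup.a_closed[OF ideal.axioms(1)[OF assms], of x y] by simp
  show mult: "c \<in> C \<Longrightarrow> x \<in> I \<Longrightarrow> c * x \<in> I" for c x using I_l_closed[of x c] by simp
  show "x \<in> I \<Longrightarrow> y \<in> I \<Longrightarrow> x - y \<in> I"
    using add[of x "- 1 * y"] mult[of "- 1" y] by (simp add: subring_intros[OF C])
qed

lemma ideal_set_ringI:
  assumes "I \<subseteq> C" "0 \<in> I" "\<And>x y. x \<in> I \<Longrightarrow> y \<in> I \<Longrightarrow> x + y \<in> I" "\<And>c x. c \<in> C \<Longrightarrow> x \<in> I \<Longrightarrow> c * x \<in> I"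
  shows "ideal I (set_ring C)"
proof -
  interpret cring "set_ring C" by (rule cring_set_ring)
  show ?thesis
  proof (rule idealI)
    show "ring (set_ring C)" by (rule ring_axioms)
    have inv: "\<ominus>\<^bsub>set_ring C\<^esub> x = - x" if "x \<in> C" for x
      using that minus_equality[of "- x" x] by (simp add: subring_uminus[OF C])
    show "subgroup I (add_monoid (set_ring C))"
    proof (rule add.subgroupI)
      fix x assume "x \<in> I"
      then have "x \<in> C" "- x \<in> I"
        using assms(4)[of "- 1" x] assms(1) by (auto simp: subring_intros[OF C])
      then show "\<ominus>\<^bsub>set_ring C\<^esub> x \<in> I"
        by (simp add: inv)
    qed (use assms in auto)
    show "a \<otimes>\<^bsub>set_ring C\<^esub> x \<in> I" if "a \<in> I" "x \<in> carrier (set_ring C)" for a x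
      using assms(4)[of x a] that by (simp add: mult.commute)
  qed (use assms in auto)
qed

lemma genideal_set_ring:
  assumes "G \<subseteq> C"
  shows "genideal (set_ring C) G = span_over C G"
proof
  interpret cring "set_ring C" by (rule cring_set_ring)
  have "ideal (span_over C G) (set_ring C)"
    using span_over_subset[OF C assms]
    by (intro ideal_set_ringI) (auto intro: span_over.zero span_over_add span_over_mult[OF C])
  then show "genideal (set_ring C) G \<subseteq> span_over C G"
    by (rule genideal_minimal) (auto intro: span_over_superset[OF C])
  have "ideal (genideal (set_ring C) G) (set_ring C)"
    using assms by (intro genideal_ideal) auto
  note I = ideal_set_ringD[OF this]
  have "G \<subseteq> genideal (set_ring C) G"
    using assms by (intro genideal_self) auto
  then show "span_over C G \<subseteq> genideal (set_ring C) G"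
    using I by (auto elim!: span_over_least)
qed

end

subsection \<open>Dickson's lemma and finite generation up to constants\<close>

text \<open>Every sequence has a monotone subsequence. If that one is nonincreasing, it is constant
  from the place of its minimum on, hence also nondecreasing after a shift.\<close>

lemma nat_seq_mono_subseq:
  fixes s :: "nat \<Rightarrow> nat"
  shows "\<exists>h::nat \<Rightarrow> nat. strict_mono h \<and> mono (s \<circ> h)"
proof -
  obtain h :: "nat \<Rightarrow> nat" where h: "strict_mono h" "monoseq (\<lambda>k. s (h k))"
    using seq_monosub[of s] by blast
  consider "mono (s \<circ> h)" | "\<forall>m. \<forall>n\<ge>m. s (h n) \<le> s (h m)"
    using h(2) by (auto simp: monoseq_def monotone_def)
  then show ?thesis
  proof cases
    case 2
    define K where "K = arg_min (\<lambda>k. s (h k)) (\<lambda>_. True)"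
    have "s (h K) \<le> s (h k)" for k
      unfolding K_def by (rule arg_min_nat_le) simp
    with 2 have "s (h (K + k)) = s (h K)" for k
      by (simp add: antisym)
    then have "mono (s \<circ> (\<lambda>k. h (K + k)))"
      by (simp add: monotone_def)
    moreover have "strict_mono (\<lambda>k. h (K + k))"
      using h(1) by (simp add: strict_mono_def)
    ultimately show ?thesis by blast
  qed (use h in blast)
qed

text \<open>Coordinates are treated one after the other: a further subsequence repairs the next
  coordinate and keeps the earlier ones monotone.\<close>

lemma exponents_mono_subseq:
  fixes u :: "nat \<Rightarrow> nat \<Rightarrow>\<^sub>0 nat"
  shows "\<exists>g::nat \<Rightarrow> nat. strict_mono g \<and> (\<forall>x<n. mono (\<lambda>k. lookup (u (g k)) x))"
proof (induction n)
  case 0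
  show ?case by (intro exI[of _ id]) (simp add: strict_mono_def)
next
  case (Suc n)
  then obtain g :: "nat \<Rightarrow> nat" where g: "strict_mono g" "\<forall>x<n. mono (\<lambda>k. lookup (u (g k)) x)" by blast
  obtain h :: "nat \<Rightarrow> nat" where h: "strict_mono h" "mono ((\<lambda>k. lookup (u (g k)) n) \<circ> h)"
    using nat_seq_mono_subseq by blast
  have "strict_mono (g \<circ> h)"
    using g(1) h(1) by (simp add: strict_mono_def)
  moreover have "mono (\<lambda>k. lookup (u ((g \<circ> h) k)) x)" if "x < Suc n" for x
  proof (cases "x = n")
    case False
    then have "mono (\<lambda>k. lookup (u (g k)) x)" using g(2) that by simp
    moreover have "mono h" using h(1) by (rule strict_mono_mono)
    ultimately show ?thesis by (simp add: monotone_def)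
  qed (use h in \<open>simp add: o_def\<close>)
  ultimately show ?case by blast
qed

lemma dickson_sequence:
  fixes u :: "nat \<Rightarrow> nat \<Rightarrow>\<^sub>0 nat"
  assumes "\<And>k. keys (u k) \<subseteq> {..<n}"
  shows "\<exists>i j. i < j \<and> lookup (u i) \<le> lookup (u j)"
proof -
  obtain g :: "nat \<Rightarrow> nat" where g: "strict_mono g" "\<forall>x<n. mono (\<lambda>k. lookup (u (g k)) x)"
    using exponents_mono_subseq by blast
  have "lookup (u (g 0)) x \<le> lookup (u (g 1)) x" for x
  proof (cases "x < n")
    case True
    then show ?thesis using g(2) by (simp add: monotone_def)
  next
    case False
    then have "lookup (u (g 0)) x = 0"
      using assms[of "g 0"] by (auto simp: in_keys_iff)
    then show ?thesis by simp
  qed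
  moreover have "g 0 < g 1" using g(1) by (simp add: strict_mono_def)
  ultimately show ?thesis by (auto simp: le_fun_def)
qed

text \<open>Otherwise one could choose elements of \<open>M\<close> forever, none of them above an
  earlier one, against \<open>dickson_sequence\<close>.\<close>

lemma dickson_finite_basis:
  fixes M :: "(nat \<Rightarrow>\<^sub>0 nat) set"
  assumes M: "\<And>u. u \<in> M \<Longrightarrow> keys u \<subseteq> {..<n}"
  shows "\<exists>F. finite F \<and> F \<subseteq> M \<and> (\<forall>u\<in>M. \<exists>v\<in>F. lookup v \<le> lookup u)"
proof (rule ccontr)
  assume "\<not> ?thesis"
  moreover define D :: "(nat \<Rightarrow>\<^sub>0 nat) \<Rightarrow> (nat \<Rightarrow>\<^sub>0 nat) \<Rightarrow> bool"
    where "D v u \<longleftrightarrow> lookup v \<le> lookup u" for v u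
  ultimately have H: "\<not> (\<exists>F. finite F \<and> F \<subseteq> M \<and> (\<forall>u\<in>M. \<exists>v\<in>F. D v u))"
    by simp
  define pick where "pick F = (SOME u. u \<in> M \<and> (\<forall>v\<in>F. \<not> D v u))" for F
  have pick: "pick F \<in> M \<and> (\<forall>v\<in>F. \<not> D v (pick F))" if F: "finite F" "F \<subseteq> M" for F
    unfolding pick_def
  proof (rule someI_ex[of "\<lambda>u. u \<in> M \<and> (\<forall>v\<in>F. \<not> D v u)"], rule ccontr)
    assume "\<nexists>u. u \<in> M \<and> (\<forall>v\<in>F. \<not> D v u)"
    then have "\<forall>u\<in>M. \<exists>v\<in>F. D v u" by blast
    with F have "\<exists>F. finite F \<and> F \<subseteq> M \<and> (\<forall>u\<in>M. \<exists>v\<in>F. D v u)"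
      by (intro exI[of _ F]) simp
    with H show False by (rule notE)
  qed
  define F where "F k = ((\<lambda>F. insert (pick F) F) ^^ k) {}" for k
  have F_Suc: "F (Suc k) = insert (pick (F k)) (F k)" for k by (simp add: F_def)
  have F: "finite (F k) \<and> F k \<subseteq> M" for k
  proof (induction k)
    case (Suc k)
    then show ?case using pick[of "F k"] by (simp add: F_Suc)
  qed (simp add: F_def)
  have "keys (pick (F k)) \<subseteq> {..<n}" for k
    using M pick[of "F k"] F[of k] by simp
  from dickson_sequence[of "\<lambda>k. pick (F k)", OF this]
  obtain i j where ij: "i < j" "D (pick (F i)) (pick (F j))"
    unfolding D_def by blast
  have "pick (F i) \<in> F (Suc i + k)" for k
    by (induction k) (simp_all add: F_Suc)
  then have "pick (F i) \<in> F j"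
    using ij(1) by (metis Suc_leI le_add_diff_inverse)
  then show False using pick[of "F j"] F[of j] ij(2) by simp
qed

text \<open>The order \<open><=\<close> on exponents is the lexicographic linear order, which serves
  as the monomial order; \<open>lookup u <= lookup v\<close> is divisibility of monomials.\<close>

lemma lookup_le_imp_le:
  fixes u v :: "nat \<Rightarrow>\<^sub>0 nat"
  assumes "lookup u \<le> lookup v"
  shows "u \<le> v"
proof (rule ccontr)
  assume "\<not> u \<le> v"
  then have "v < u" by simp
  then obtain k where "lookup v k < lookup u k"
    by (auto simp: less_poly_mapping.rep_eq less_fun_def)
  then show False using assms by (auto simp: le_fun_def not_le dest: spec[of _ k])
qed

text \<open>With infinitely many variables the lexicographic order has infinite descending chains
  (the variables themselves form one). With n variables such a chain contradicts
  \<open>dickson_sequence\<close>, because divisibility implies \<open><=\<close>.\<close>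

lemma wf_exponents:
  "wf {(u, v :: nat \<Rightarrow>\<^sub>0 nat). u < v \<and> keys u \<subseteq> {..<n} \<and> keys v \<subseteq> {..<n}}"
  unfolding wf_iff_no_infinite_down_chain
proof
  assume "\<exists>f. \<forall>i. (f (Suc i), f i) \<in>
    {(u, v :: nat \<Rightarrow>\<^sub>0 nat). u < v \<and> keys u \<subseteq> {..<n} \<and> keys v \<subseteq> {..<n}}"
  then obtain f :: "nat \<Rightarrow> nat \<Rightarrow>\<^sub>0 nat" where f: "\<And>i. f (Suc i) < f i" "\<And>i. keys (f i) \<subseteq> {..<n}"
    by blast
  obtain i j where ij: "i < j" "lookup (f i) \<le> lookup (f j)"
    using dickson_sequence[OF f(2)] by blast
  have "f j < f i"
    using ij(1) f(1) by (induction j) (auto simp: less_Suc_eq intro: less_trans)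
  then show False using lookup_le_imp_le[OF ij(2)] by simp
qed

lemma lookup_single_mult:
  fixes g :: "'a::comm_semiring_0 mpoly"
  shows "lookup (Poly_Mapping.single w c * g) (w + v) = c * lookup g v"
  by (induction g rule: poly_mapping_add_induct)
    (auto simp: mult_single lookup_single when_def distrib_left lookup_add)

text \<open>Meaningful for nonzero polynomials only: for \<open>f = 0\<close> this is
  \<open>Max {}\<close>, so the zero polynomial is treated separately.\<close>

abbreviation lead_exp :: "'a::zero mpoly \<Rightarrow> nat \<Rightarrow>\<^sub>0 nat" where
  "lead_exp f \<equiv> Max (keys f)"

text \<open>
  Dividing by finitely many elements whose leading exponents dominate all leading exponents only
  inverts their leading coefficients.
\<close>

proposition ideal_finitely_generated_up_to_constant:
  fixes A :: "'a::idom set"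
  assumes A: "unital_subring A" and I: "ideal I (set_ring (mpolys n A))"
  shows "\<exists>G N. finite G \<and> G \<subseteq> I \<and> N \<in> A - {0} \<and>
    (\<forall>f\<in>I. \<exists>k. const_mpoly N ^ k * f \<in> span_over (mpolys n A) G)"
proof -
  note P = unital_subring_mpolys[OF A, of n]
  note I = ideal_set_ringD[OF P I]
  have keys_I: "keys u \<subseteq> {..<n}" "lookup f u \<in> A"
    if "f \<in> I" "u \<in> keys f" for f u
    using that I(1) by (auto simp: mpolys_def)
  have lead: "lead_exp f \<in> keys f" if "f \<noteq> 0" for f :: "'a mpoly"
    using that by (intro Max_in) (auto simp: keys_eq_empty)
  define M where "M = lead_exp ` (I - {0})"
  have "\<exists>F. finite F \<and> F \<subseteq> M \<and> (\<forall>u\<in>M. \<exists>v\<in>F. lookup v \<le> lookup u)"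
    unfolding M_def by (rule dickson_finite_basis[of _ n]) (use keys_I lead in force)
  then obtain F where F: "finite F" "F \<subseteq> M" "\<And>u. u \<in> M \<Longrightarrow> \<exists>v\<in>F. lookup v \<le> lookup u"
    by blast
  have "\<forall>v\<in>F. \<exists>g\<in>I - {0}. lead_exp g = v"
    using F(2) unfolding M_def by blast
  then obtain g where "\<forall>v\<in>F. g v \<in> I - {0} \<and> lead_exp (g v) = v"
    by (auto dest!: bchoice simp: Bex_def)
  then have g: "\<And>v. v \<in> F \<Longrightarrow> g v \<in> I \<and> g v \<noteq> 0 \<and> lead_exp (g v) = v"
    by blast
  define l where "l v = lookup (g v) v" for v
  have l: "l v \<in> A" "l v \<noteq> 0" if "v \<in> F" for v
    using g[OF that] lead[of "g v"] keys_I(2)[of "g v" v] by (auto simp: l_def in_keys_iff)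
  \<comment> \<open>Inverting \<open>N\<close> inverts all leading coefficients of the basis at
    once.\<close>
  define N where "N = (\<Prod>v\<in>F. l v)"
  have N: "N \<in> A" "N \<noteq> 0"
    using l F(1) by (auto simp: N_def intro: subring_prod[OF A])
  have "\<exists>k. const_mpoly N ^ k * f \<in> span_over (mpolys n A) (g ` F)" if "f \<in> I" "keys u \<subseteq> {..<n}" "f = 0 \<or> lead_exp f = u" for f u
    using that
  proof (induction u arbitrary: f rule: wf_induct_rule[OF wf_exponents[of n]])
    case (1 u)
    show ?case
    proof (cases "f = 0")
      case True
      then show ?thesis by (auto intro: span_over.zero)
    next
      case False
      then have u: "lead_exp f = u" using 1(4) by simp
      then have "u \<in> M" using 1(2) False by (auto simp: M_def)
      then obtain v where v: "v \<in> F" "lookup v \<le> lookup u"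
        using F(3) by blast
      define w where "w = u - v"
      have wv: "u = w + v"
        using v(2) by (auto intro!: poly_mapping_eqI simp: w_def lookup_add lookup_minus le_fun_def)
      define N' where "N' = (\<Prod>v\<in>F - {v}. l v)"
      have N': "N = N' * l v" "N' \<in> A"
        using v(1) F(1) l by (auto simp: N_def N'_def prod.remove mult.commute intro: subring_prod[OF A])
      \<comment> \<open>Chosen so that \<open>q * g v\<close> has the same leading term as
        \<open>const_mpoly N * f\<close>: \<open>l v\<close> is one factor of \<open>N\<close>, and
        \<open>N'\<close> is its cofactor.\<close>
      define q where "q = Poly_Mapping.single w (N' * lookup f u)"
      have "keys w \<subseteq> {..<n}"
        using 1(3) by (auto simp: wv in_keys_iff lookup_add subset_iff)
      moreover have "lookup f u \<in> A"
        using keys_I(2)[OF 1(2)] lead[OF False] u by simp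
      ultimately have q: "q \<in> mpolys n A"
        unfolding q_def by (intro single_in_mpolys subring_mult[OF A] N')
      define f' where "f' = const_mpoly N * f - q * g v"
      have CN: "const_mpoly N \<in> mpolys n A" using N by (intro const_in_mpolys)
      have f'I: "f' \<in> I"
        unfolding f'_def using g[OF v(1)] by (intro I q CN 1(2)) auto
      have lu: "lookup f' u = 0"
        unfolding f'_def lookup_minus lookup_const_mult q_def
        by (subst (3) wv) (simp add: lookup_single_mult N'(1) l_def)
      \<comment> \<open>Adding \<open>w\<close> preserves the monomial order, so the exponents of
        \<open>q * g v\<close> do not exceed \<open>w + v = u\<close>. Together with the
        cancellation at \<open>u\<close>, the leading exponent drops.\<close>
      have le_u: "t \<le> u" if "t \<in> keys f'" for t
      proof -
        have "t \<in> keys f \<or> t \<in> keys (q * g v)"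
          using that by (auto simp: f'_def in_keys_iff lookup_minus lookup_const_mult)
        then show ?thesis
        proof
          assume "t \<in> keys f"
          then show ?thesis using u by (metis Max_ge finite_keys)
        next
          assume "t \<in> keys (q * g v)"
          then obtain a b where "t = a + b" "a \<in> keys q" "b \<in> keys (g v)"
            using keys_mult[of q "g v"] by blast
          then have "t = w + b" "b \<le> lead_exp (g v)"
            by (auto simp: q_def split: if_splits)
          then show ?thesis using g[OF v(1)] by (simp add: wv)
        qed
      qed
      obtain k where k: "const_mpoly N ^ k * f' \<in> span_over (mpolys n A) (g ` F)"
      proof (cases "f' = 0")
        case True
        then show thesis using that[of 0] by (simp add: span_over.zero)
      next
        case False
        have "lead_exp f' < u"
          using le_u[OF lead[OF False]] lu lead[OF False] by (auto simp: in_keys_iff less_le)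
        moreover have "keys (lead_exp f') \<subseteq> {..<n}"
          using keys_I(1)[OF f'I lead[OF False]] .
        ultimately show thesis
          using 1(1)[of "lead_exp f'" f'] 1(3) f'I that by blast
      qed
      have "const_mpoly N ^ Suc k * f = const_mpoly N ^ k * f' + const_mpoly N ^ k * q * g v"
        by (simp add: f'_def algebra_simps)
      also have "\<dots> \<in> span_over (mpolys n A) (g ` F)"
        using v(1) by (intro span_over_add k span_over_mult_gen[OF P] subring_mult[OF P] subring_power[OF P] CN q) auto
      finally show ?thesis by blast
    qed
  qed
  note reduce = this
  have "\<exists>k. const_mpoly N ^ k * f \<in> span_over (mpolys n A) (g ` F)" if "f \<in> I" for f
  proof (cases "f = 0")
    case True
    then show ?thesis by (auto intro: span_over.zero)
  next
    case False
    show ?thesis using reduce[OF that keys_I(1)[OF that lead[OF False]]] by simp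
  qed
  moreover have "g ` F \<subseteq> I" using g by auto
  ultimately show ?thesis using F(1) N by (intro exI[of _ "g ` F"] exI[of _ N]) auto
qed

subsection \<open>Reduction modulo a prime and localization at the origin\<close>

text \<open>The definition uses the reduced denominator \<open>e\<close> of \<open>x\<close>. It
  divides every \<open>d\<close> for which \<open>x * of_int d\<close> is integral; hence if p does
  not divide \<open>d\<close>, then \<open>e\<close> is prime to p and its modular inverse is
  genuine.\<close>

lemma residue_Fp_cong:
  assumes p: "prime p" and d: "\<not> int p dvd d" and x: "x * of_int d = of_int z"
  shows "[residue_Fp p x * d = z] (mod int p)"
proof -
  obtain a e where ae: "quotient_of x = (a, e)" by (cases "quotient_of x")
  have e: "e > 0" "coprime a e" using quotient_of_denom_pos[OF ae] quotient_of_coprime[OF ae] by auto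
  have x_eq: "x = of_int a / of_int e" using quotient_of_div[OF ae] .
  have "of_int (a * d) = (of_int (z * e) :: rat)"
    using x e(1) unfolding x_eq by (simp add: field_simps)
  then have ad: "a * d = z * e" by (simp only: of_int_eq_iff)
  then have "e dvd d"
    using e(2) by (metis coprime_commute coprime_dvd_mult_right_iff dvd_triv_right)
  then have pe: "\<not> int p dvd e" using d dvd_trans by blast
  then have cop: "coprime (int p) e"
    using p by (simp add: prime_imp_coprime)
  then have "[modular_inverse (int p) e * e = 1] (mod int p)"
    by (intro cong_modular_inverse2) (simp add: coprime_commute)
  then have "[a * d * (modular_inverse (int p) e * e) = z * e * 1] (mod int p)"
    unfolding ad by (rule cong_mult[OF cong_refl])
  moreover have "[residue_Fp p x = a * modular_inverse (int p) e] (mod int p)"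
    by (simp add: residue_Fp_def ae cong_def)
  then have "[residue_Fp p x * (d * e) = a * modular_inverse (int p) e * (d * e)] (mod int p)"
    by (rule cong_mult[OF _ cong_refl])
  ultimately have "[residue_Fp p x * d * e = z * e] (mod int p)"
    by (metis (no_types, opaque_lifting) cong_trans mult.assoc mult.commute mult.right_neutral)
  then show ?thesis
    using cop cong_mult_rcancel[of e "int p"] by (simp add: coprime_commute)
qed

lemma residue_Fp_range: "p > 0 \<Longrightarrow> residue_Fp p x \<in> {0..<int p}"
  by (simp add: residue_Fp_def split: prod.split)

lemma residue_Fp_0 [simp]: "residue_Fp p 0 = 0"
  by (simp add: residue_Fp_def)

lemma unital_subring_int_localization:
  assumes "m \<noteq> 0"
  shows "unital_subring (int_localization m)"
proof -
  have "1 \<in> int_localization m"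
    unfolding int_localization_def by (rule CollectI, rule exI[of _ 1], rule exI[of _ 0]) simp
  moreover have "x - y \<in> int_localization m \<and> x * y \<in> int_localization m"
    if "x \<in> int_localization m" "y \<in> int_localization m" for x y
  proof -
    from that obtain a k b l where xy: "x = of_int a / of_int m ^ k" "y = of_int b / of_int m ^ l"
      by (auto simp: int_localization_def)
    have "x - y = of_int (a * m ^ l - b * m ^ k) / of_int m ^ (k + l)"
        "x * y = of_int (a * b) / of_int m ^ (k + l)"
      using assms unfolding xy by (simp_all add: field_simps power_add)
    then show ?thesis unfolding int_localization_def by blast
  qed
  ultimately show ?thesis by (simp add: unital_subring_def)
qed

text \<open>Here p is not a unit of A. Elements of \<open>F\<close> and \<open>R\<close> are
  represented by lifts in \<open>Z\<close>: \<open>\<rho>\<close> identifies two lifts exactly when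
  they differ by an element of \<open>pZ\<close>, and \<open>\<Theta> f s\<close> is the fraction
  with lifted numerator and denominator. Claims about \<open>R\<close> thereby become congruences
  modulo p in A[X].\<close>

locale mod_p_reduction =
  fixes p n :: nat and m :: int
  assumes p: "prime p" and m: "\<not> int p dvd m"
begin

abbreviation "A \<equiv> int_localization m"
abbreviation "Z \<equiv> mpolys n A"
abbreviation "F \<equiv> Fp_mpoly_ring p n"
abbreviation "R \<equiv> local_ring_Fp p n"

definition pA :: "rat set" where "pA = {of_nat p * y |y. y \<in> A}"

definition pZ :: "rat mpoly set" where "pZ = {of_nat p * g |g. g \<in> Z}"

definition \<rho> :: "rat mpoly \<Rightarrow> int mpoly" where "\<rho> = Poly_Mapping.map (residue_Fp p)"

definition units0 :: "rat mpoly set" where "units0 = {s \<in> Z. lookup s 0 \<notin> pA}"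

definition \<Theta> :: "rat mpoly \<Rightarrow> rat mpoly \<Rightarrow> (int mpoly \<times> int mpoly) set" where
  "\<Theta> f s = frac F (away_from_origin p n) (\<rho> f) (\<rho> s)"

lemma m0: "m \<noteq> 0" using m by auto

lemma A: "unital_subring A" by (rule unital_subring_int_localization[OF m0])

lemma Z: "unital_subring Z" by (rule unital_subring_mpolys[OF A])

lemma p_not_dvd_pow: "\<not> int p dvd m ^ k"
  using m p prime_dvd_power[of "int p" m k] by auto

lemma A_mem: "x \<in> A \<Longrightarrow> \<exists>a k. x = of_int a / of_int m ^ k"
  by (auto simp: int_localization_def)

lemma in_A: "of_int a / of_int m ^ k \<in> A"
  by (auto simp: int_localization_def)

lemma of_int_in_pA_iff: "of_int a / of_int m ^ k \<in> pA \<longleftrightarrow> int p dvd a"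
proof
  assume "of_int a / of_int m ^ k \<in> pA"
  then obtain y where "y \<in> A" "of_int a / of_int m ^ k = of_nat p * y"
    by (auto simp: pA_def)
  then obtain b l where "of_int a / of_int m ^ k = of_nat p * (of_int b / of_int m ^ l :: rat)"
    using A_mem[of y] by blast
  then have "of_int (a * m ^ l) = (of_int (int p * b * m ^ k) :: rat)"
    using m0 by (simp add: field_simps)
  then have "a * m ^ l = int p * b * m ^ k" by (simp only: of_int_eq_iff)
  then have "int p dvd a * m ^ l" by simp
  then show "int p dvd a" using p p_not_dvd_pow by (simp add: prime_dvd_mult_iff)
next
  assume "int p dvd a"
  then obtain b where "a = int p * b" by auto
  then have "of_int a / of_int m ^ k = of_nat p * (of_int b / of_int m ^ k :: rat)" by simp
  then show "of_int a / of_int m ^ k \<in> pA"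
    unfolding pA_def using in_A by blast
qed

lemma of_int_in_pA_iff': "of_int a \<in> pA \<longleftrightarrow> int p dvd a"
  using of_int_in_pA_iff[of a 0] by simp

lemma pA_diff: "x \<in> pA \<Longrightarrow> y \<in> pA \<Longrightarrow> x - y \<in> pA"
  unfolding pA_def using subring_diff[OF A] by (auto simp flip: right_diff_distrib)

lemma pA_0: "0 \<in> pA"
  using of_int_in_pA_iff'[of 0] by simp

lemma pA_prime: "x \<in> A \<Longrightarrow> y \<in> A \<Longrightarrow> x * y \<in> pA \<Longrightarrow> x \<in> pA \<or> y \<in> pA"
proof -
  assume "x \<in> A" "y \<in> A" and xy: "x * y \<in> pA"
  then obtain a k b l where *: "x = of_int a / of_int m ^ k" "y = of_int b / of_int m ^ l"
    using A_mem by blast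
  have "x * y = of_int (a * b) / of_int m ^ (k + l)"
    by (simp add: * power_add)
  then have "int p dvd a * b" using xy of_int_in_pA_iff by metis
  then show ?thesis using p by (auto simp: * of_int_in_pA_iff prime_dvd_mult_iff)
qed

text \<open>This identifies A/pA with the representatives in \<open>{0..<p}\<close>. The power of
  \<open>m\<close> in the denominator of \<open>x\<close> is prime to p and can be cancelled from
  the congruence.\<close>

lemma residue_Fp_eq_iff:
  assumes x: "x \<in> A" and r: "r \<in> {0..<int p}"
  shows "residue_Fp p x = r \<longleftrightarrow> x - of_int r \<in> pA"
proof -
  obtain a k where a: "x = of_int a / of_int m ^ k" using A_mem[OF x] by blast
  have cong: "[residue_Fp p x * m ^ k = a] (mod int p)"
    using m0 by (intro residue_Fp_cong p p_not_dvd_pow) (simp add: a)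
  have "x - of_int r = of_int (a - r * m ^ k) / of_int m ^ k"
    using m0 by (simp add: a field_simps)
  then have "x - of_int r \<in> pA \<longleftrightarrow> int p dvd (a - r * m ^ k)"
    by (simp only: of_int_in_pA_iff)
  also have "\<dots> \<longleftrightarrow> [r * m ^ k = a] (mod int p)"
    by (metis cong_iff_dvd_diff cong_sym_eq)
  also have "\<dots> \<longleftrightarrow> [r * m ^ k = residue_Fp p x * m ^ k] (mod int p)"
    using cong cong_sym cong_trans by blast
  also have "\<dots> \<longleftrightarrow> [r = residue_Fp p x] (mod int p)"
  proof (rule cong_mult_rcancel)
    have "coprime (int p) (m ^ k)"
      by (rule prime_imp_coprime) (use p p_not_dvd_pow in auto)
    then show "coprime (m ^ k) (int p)" by (rule coprime_commute[THEN iffD1])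
  qed
  also have "\<dots> \<longleftrightarrow> r = residue_Fp p x"
    using r residue_Fp_range[of p x] prime_gt_0_nat[OF p] by (auto simp: cong_def)
  finally show ?thesis by auto
qed

lemma pZ_iff:
  assumes "f \<in> Z"
  shows "f \<in> pZ \<longleftrightarrow> (\<forall>u. lookup f u \<in> pA)"
proof
  assume "f \<in> pZ"
  then obtain g where "g \<in> Z" "f = of_nat p * g" by (auto simp: pZ_def)
  then show "\<forall>u. lookup f u \<in> pA"
    by (auto simp: pA_def lookup_of_nat_mult mpolys_iff subring_0[OF A])
next
  assume f: "\<forall>u. lookup f u \<in> pA"
  let ?g = "Poly_Mapping.map (\<lambda>x. x / of_nat p) f"
  have p0: "of_nat p \<noteq> (0 :: rat)" using prime_gt_0_nat[OF p] by simp
  have "lookup ?g u \<in> A" for u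
    using f[rule_format, of u] p0 by (auto simp: lookup_map_zero pA_def)
  then have "?g \<in> Z"
    using assms by (auto simp: mpolys_iff subring_0[OF A] lookup_map_zero)
  moreover have "f = of_nat p * ?g"
    using p0 by (intro poly_mapping_eqI) (simp add: lookup_of_nat_mult lookup_map_zero)
  ultimately show "f \<in> pZ" unfolding pZ_def by blast
qed

lemma pZ_0: "0 \<in> pZ"
  unfolding pZ_def using subring_0[OF Z] by force

lemma pZ_add: "x \<in> pZ \<Longrightarrow> y \<in> pZ \<Longrightarrow> x + y \<in> pZ"
  unfolding pZ_def using subring_add[OF Z] by (auto simp flip: distrib_left)

lemma pZ_diff: "x \<in> pZ \<Longrightarrow> y \<in> pZ \<Longrightarrow> x - y \<in> pZ"
  unfolding pZ_def using subring_diff[OF Z] by (auto simp flip: right_diff_distrib)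

lemma pZ_mult: "x \<in> Z \<Longrightarrow> y \<in> pZ \<Longrightarrow> x * y \<in> pZ"
  unfolding pZ_def using subring_mult[OF Z] by (auto simp: mult.left_commute[of x])

lemma pZ_mult': "x \<in> Z \<Longrightarrow> y \<in> pZ \<Longrightarrow> y * x \<in> pZ"
  using pZ_mult by (simp add: mult.commute)

section \<open>The polynomial ring over the prime field as a quotient of A[X]\<close>

lemma carrier_F: "carrier F = mpolys n {0..<int p}"
  by (simp add: Fp_mpoly_ring_def)

lemma carrier_F_iff: "g \<in> carrier F \<longleftrightarrow> (\<forall>u. lookup g u \<in> {0..<int p}) \<and>
    (\<forall>u. lookup g u \<noteq> 0 \<longrightarrow> keys u \<subseteq> {..<n})"
  unfolding carrier_F using prime_gt_0_nat[OF p] by (intro mpolys_iff) simp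

lemma lookup_\<rho>: "lookup (\<rho> f) u = residue_Fp p (lookup f u)"
  by (simp add: \<rho>_def lookup_map_zero)

lemma \<rho>_in_carrier: "f \<in> Z \<Longrightarrow> \<rho> f \<in> carrier F"
  unfolding carrier_F_iff lookup_\<rho> mpolys_iff[OF subring_0[OF A]]
  using residue_Fp_range[OF prime_gt_0_nat[OF p]] residue_Fp_0 by metis

lemma carrier_F_in_Z: "g \<in> carrier F \<Longrightarrow> of_int_mpoly g \<in> Z"
  unfolding carrier_F using mpolys_mono[of "{0..<int p}" UNIV] by (intro of_int_mpoly_in_mpolys A) auto

lemma \<rho>_eq_iff:
  assumes "f \<in> Z" "g \<in> carrier F"
  shows "\<rho> f = g \<longleftrightarrow> f - of_int_mpoly g \<in> pZ"
proof -
  have "f - of_int_mpoly g \<in> Z"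
    using assms by (intro subring_diff[OF Z] carrier_F_in_Z)
  moreover have "lookup f u \<in> A" for u
    using assms by (simp add: mpolys_iff subring_0[OF A])
  ultimately show ?thesis
    using assms by (auto simp: poly_mapping_eq_iff fun_eq_iff lookup_\<rho> pZ_iff lookup_minus carrier_F_iff
        residue_Fp_eq_iff)
qed

lemma \<rho>_cong: "f \<in> Z \<Longrightarrow> f - of_int_mpoly (\<rho> f) \<in> pZ"
  using \<rho>_eq_iff[of f "\<rho> f"] \<rho>_in_carrier by simp

lemma \<rho>_eq_\<rho>_iff:
  assumes "f \<in> Z" "g \<in> Z"
  shows "\<rho> f = \<rho> g \<longleftrightarrow> f - g \<in> pZ"
proof -
  let ?r = "of_int_mpoly (\<rho> g)"
  have "f - g = (f - ?r) - (g - ?r)" "f - ?r = (f - g) + (g - ?r)" by simp_all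
  then have "f - ?r \<in> pZ \<longleftrightarrow> f - g \<in> pZ"
    using pZ_add[OF _ \<rho>_cong[OF assms(2)]] pZ_diff[OF _ \<rho>_cong[OF assms(2)]] by metis
  then show ?thesis using \<rho>_eq_iff[OF assms(1) \<rho>_in_carrier[OF assms(2)]] by simp
qed

lemma \<rho>_of_int_mpoly: "g \<in> carrier F \<Longrightarrow> \<rho> (of_int_mpoly g) = g"
  using \<rho>_eq_iff[of "of_int_mpoly g" g] carrier_F_in_Z pZ_0 by simp

lemma carrier_F_\<rho>: "carrier F = \<rho> ` Z"
proof
  show "carrier F \<subseteq> \<rho> ` Z"
  proof
    fix g assume "g \<in> carrier F"
    then show "g \<in> \<rho> ` Z"
      using image_eqI[of g \<rho> "of_int_mpoly g" Z] by (simp add: carrier_F_in_Z \<rho>_of_int_mpoly)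
  qed
qed (auto intro: \<rho>_in_carrier)

lemma mod_in_carrier:
  assumes "h \<in> mpolys n UNIV"
  shows "Poly_Mapping.map (\<lambda>c. c mod int p) h \<in> carrier F"
  using assms prime_gt_0_nat[OF p] by (auto simp: carrier_F_iff lookup_map_zero mpolys_def in_keys_iff)

lemma mod_cong:
  assumes "h \<in> mpolys n UNIV"
  shows "of_int_mpoly h - of_int_mpoly (Poly_Mapping.map (\<lambda>c. c mod int p) h) \<in> pZ"
proof -
  have "of_int_mpoly h - of_int_mpoly (Poly_Mapping.map (\<lambda>c. c mod int p) h) \<in> Z"
    using assms by (intro subring_diff[OF Z] of_int_mpoly_in_mpolys[OF _ A] carrier_F_in_Z mod_in_carrier)
  then show ?thesis
    by (auto simp: pZ_iff lookup_minus lookup_map_zero simp flip: of_int_diff intro!: of_int_in_pA_iff'[THEN iffD2])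
qed

lemma \<rho>_mod:
  assumes "f \<in> Z" "h \<in> mpolys n UNIV" "f - of_int_mpoly h \<in> pZ"
  shows "Poly_Mapping.map (\<lambda>c. c mod int p) h = \<rho> f"
  using \<rho>_eq_iff[OF assms(1) mod_in_carrier[OF assms(2)]] pZ_add[OF assms(3) mod_cong[OF assms(2)]] by simp

lemma carrier_F_subset: "carrier F \<subseteq> mpolys n UNIV"
  unfolding carrier_F by (rule mpolys_mono) simp

lemma \<rho>_mult: assumes "f \<in> Z" "g \<in> Z" shows "\<rho> f \<otimes>\<^bsub>F\<^esub> \<rho> g = \<rho> (f * g)"
proof -
  have "f * g - of_int_mpoly (\<rho> f * \<rho> g) =
      (f - of_int_mpoly (\<rho> f)) * g + of_int_mpoly (\<rho> f) * (g - of_int_mpoly (\<rho> g))"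
    by (simp add: algebra_simps)
  also have "\<dots> \<in> pZ"
    using assms by (intro pZ_add pZ_mult pZ_mult' \<rho>_cong carrier_F_in_Z \<rho>_in_carrier)
  finally have "Poly_Mapping.map (\<lambda>c. c mod int p) (\<rho> f * \<rho> g) = \<rho> (f * g)"
    using assms carrier_F_subset \<rho>_in_carrier
    by (intro \<rho>_mod subring_mult[OF Z] subring_mult[OF unital_subring_mpolys]) auto
  then show ?thesis by (simp add: Fp_mpoly_ring_def)
qed

lemma \<rho>_add: assumes "f \<in> Z" "g \<in> Z" shows "\<rho> f \<oplus>\<^bsub>F\<^esub> \<rho> g = \<rho> (f + g)"
proof -
  have "f + g - of_int_mpoly (\<rho> f + \<rho> g) = (f - of_int_mpoly (\<rho> f)) + (g - of_int_mpoly (\<rho> g))"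
    by (simp add: algebra_simps)
  also have "\<dots> \<in> pZ"
    using assms by (intro pZ_add \<rho>_cong)
  finally have "Poly_Mapping.map (\<lambda>c. c mod int p) (\<rho> f + \<rho> g) = \<rho> (f + g)"
    using assms carrier_F_subset \<rho>_in_carrier
    by (intro \<rho>_mod subring_add[OF Z] subring_add[OF unital_subring_mpolys]) auto
  then show ?thesis by (simp add: Fp_mpoly_ring_def)
qed

lemma one_F_in_carrier: "1 \<in> carrier F"
  using prime_gt_1_nat[OF p] by (simp add: carrier_F mpolys_def)

lemma zero_F: "\<zero>\<^bsub>F\<^esub> = \<rho> 0"
  using \<rho>_eq_iff[of 0 0] subring_0[OF Z] pZ_0 prime_gt_0_nat[OF p]
  by (simp add: Fp_mpoly_ring_def mpolys_def)

lemma one_F: "\<one>\<^bsub>F\<^esub> = \<rho> 1"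
  using \<rho>_eq_iff[OF subring_1[OF Z] one_F_in_carrier] pZ_0
  by (simp add: Fp_mpoly_ring_def)

lemma cring_F: "cring F"
proof (rule cringI)
  show "abelian_group F"
  proof (rule abelian_groupI)
    show "\<exists>y\<in>carrier F. y \<oplus>\<^bsub>F\<^esub> x = \<zero>\<^bsub>F\<^esub>" if "x \<in> carrier F" for x
    proof -
      from that obtain f where "f \<in> Z" "x = \<rho> f" by (auto simp: carrier_F_\<rho>)
      then show ?thesis
        by (auto simp: zero_F carrier_F_\<rho> \<rho>_add subring_uminus[OF Z] intro!: bexI[of _ "- f"])
    qed
  qed (auto simp: carrier_F_\<rho> zero_F \<rho>_add intro!: imageI subring_intros[OF Z] arg_cong[of _ _ \<rho>]
      simp: subring_intros[OF Z] algebra_simps)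
  show "comm_monoid F"
    by (rule comm_monoidI) (auto simp: carrier_F_\<rho> one_F \<rho>_mult subring_intros[OF Z] algebra_simps
        intro!: imageI subring_intros[OF Z])
qed (auto simp: carrier_F_\<rho> \<rho>_mult \<rho>_add subring_intros[OF Z] algebra_simps)

text \<open>A polynomial without constant term is a sum of monomials each divisible by some
  variable, which gives one inclusion by induction on the terms. Conversely, vanishing of the
  constant coefficient defines an ideal because that coefficient is additive and multiplicative
  modulo p.\<close>

lemma vars_ideal_F: "vars_ideal n F = {g \<in> carrier F. lookup g 0 = 0}"
proof
  interpret F: cring F by (rule cring_F)
  have X: "X_var ` {..<n} \<subseteq> carrier F"
    using prime_gt_1_nat[OF p] by (auto simp: carrier_F mpolys_def)
  show "vars_ideal n F \<subseteq> {g \<in> carrier F. lookup g 0 = 0}"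
    unfolding vars_ideal_def
  proof (rule F.genideal_minimal)
    have lz: "lookup (\<rho> f) 0 = 0 \<longleftrightarrow> lookup f 0 \<in> pA" if "f \<in> Z" for f
      using residue_Fp_eq_iff[of "lookup f 0" 0] that prime_gt_0_nat[OF p]
      by (simp add: lookup_\<rho> mpolys_iff subring_0[OF A])
    have pA_add: "x + y \<in> pA" if "x \<in> pA" "y \<in> pA" for x y
      using pA_diff[OF that(1) pA_diff[OF pA_diff[OF that(2) that(2)] that(2)]] by simp
    have pA_mult: "x * y \<in> pA" if "x \<in> A" "y \<in> pA" for x y
      using that subring_mult[OF A] unfolding pA_def by (auto simp: mult.left_commute[of x])
    have pA_mult': "x * y \<in> pA" if "x \<in> pA" "y \<in> A" for x y
      using pA_mult[OF that(2,1)] by (simp add: mult.commute)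
    have A0: "lookup f u \<in> A" if "f \<in> Z" for f u
      using that by (simp add: mpolys_iff subring_0[OF A])
    show "ideal {g \<in> carrier F. lookup g 0 = 0} F"
    proof (rule idealI)
      show "subgroup {g \<in> carrier F. lookup g 0 = 0} (add_monoid F)"
      proof (rule F.add.subgroupI)
        show "{g \<in> carrier F. lookup g 0 = 0} \<noteq> {}"
          by (auto simp: Fp_mpoly_ring_def mpolys_def intro!: exI[of _ 0])
      next
        fix g assume "g \<in> {g \<in> carrier F. lookup g 0 = 0}"
        then obtain f where f: "f \<in> Z" "g = \<rho> f" "lookup (\<rho> f) 0 = 0" by (auto simp: carrier_F_\<rho>)
        then have "\<ominus>\<^bsub>F\<^esub> g = \<rho> (- f)"
          by (intro F.minus_equality) (auto simp: carrier_F_\<rho> \<rho>_add zero_F subring_uminus[OF Z])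
        moreover have "- lookup f 0 \<in> pA"
          using f lz pA_diff[OF pA_0, of "lookup f 0"] by auto
        ultimately show "\<ominus>\<^bsub>F\<^esub> g \<in> {g \<in> carrier F. lookup g 0 = 0}"
          using f by (auto simp: lz \<rho>_in_carrier subring_uminus[OF Z])
      qed (auto simp: carrier_F_\<rho> \<rho>_add lz lookup_add pA_add subring_add[OF Z])
      fix a x assume "a \<in> {g \<in> carrier F. lookup g 0 = 0}" "x \<in> carrier F"
      then obtain f g where "f \<in> Z" "a = \<rho> f" "lookup f 0 \<in> pA" "g \<in> Z" "x = \<rho> g"
        using lz by (auto simp: carrier_F_\<rho>)
      then show "x \<otimes>\<^bsub>F\<^esub> a \<in> {g \<in> carrier F. lookup g 0 = 0}"
        "a \<otimes>\<^bsub>F\<^esub> x \<in> {g \<in> carrier F. lookup g 0 = 0}"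
        by (simp_all add: \<rho>_mult lz lookup_mult_zero subring_mult[OF Z] pA_mult pA_mult' A0 \<rho>_in_carrier)
    qed (rule F.ring_axioms)
  qed (use X in \<open>auto simp: lookup_single when_def poly_mapping_eq_iff fun_eq_iff\<close>)
  show "{g \<in> carrier F. lookup g 0 = 0} \<subseteq> vars_ideal n F"
  proof safe
    interpret V: ideal "vars_ideal n F" F
      unfolding vars_ideal_def by (rule F.genideal_ideal[OF X])
    fix g assume "g \<in> carrier F" "lookup g 0 = 0"
    then show "g \<in> vars_ideal n F"
    proof (induction g rule: update_induct)
      case const
      show ?case using V.zero_closed by (simp add: Fp_mpoly_ring_def)
    next
      case (update g u c)
      have g0: "lookup g u = 0" using update.hyps by (simp add: in_keys_iff)
      have u0: "u \<noteq> 0" using update.prems update.hyps by (auto simp: lookup_update)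
      have look: "lookup (Poly_Mapping.update u c g) v = (if v = u then c else lookup g v)" for v
        by (auto simp: lookup_update)
      have up: "(if v = u then c else lookup g v) \<in> {0..<int p} \<and>
          ((if v = u then c else lookup g v) \<noteq> 0 \<longrightarrow> keys v \<subseteq> {..<n})" for v
        using update.prems(1) unfolding carrier_F_iff look by simp
      have "lookup g v \<in> {0..<int p} \<and>
          (lookup g v \<noteq> 0 \<longrightarrow> keys v \<subseteq> {..<n})" for v
        using up[of v] g0 prime_gt_0_nat[OF p] by (cases "v = u") simp_all
      then have gF: "g \<in> carrier F"
        unfolding carrier_F_iff by blast
      have c: "c \<in> {0..<int p}" "keys u \<subseteq> {..<n}"
        using up[of u] update.hyps(2) by simp_all
      from u0 obtain i where i: "lookup u i \<noteq> 0"
        by (auto simp: poly_mapping_eq_iff fun_eq_iff)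
      then have "i \<in> keys u" by (simp add: in_keys_iff)
      then have "i < n" using c(2) by auto
      define w where "w = u - Poly_Mapping.single i 1"
      have uw: "u = Poly_Mapping.single i 1 + w"
        using i by (auto intro!: poly_mapping_eqI simp: w_def lookup_add lookup_minus lookup_single when_def)
      have "keys w \<subseteq> {..<n}"
        using c(2) by (auto simp: uw in_keys_iff lookup_add subset_iff)
      then have "Poly_Mapping.single w c \<in> carrier F"
        unfolding carrier_F using c by (intro single_in_mpolys)
      moreover have "X_var i \<in> vars_ideal n F"
        unfolding vars_ideal_def using F.genideal_self[OF X] \<open>i < n\<close> by blast
      ultimately have "X_var i \<otimes>\<^bsub>F\<^esub> Poly_Mapping.single w c \<in> vars_ideal n F"
        by (rule V.I_r_closed[rotated])
      also have "X_var i \<otimes>\<^bsub>F\<^esub> Poly_Mapping.single w c = Poly_Mapping.single u c"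
        using c(1) by (simp add: Fp_mpoly_ring_def mult_single uw poly_mapping_eq_iff fun_eq_iff lookup_map_zero lookup_single when_def)
      finally have su: "Poly_Mapping.single u c \<in> vars_ideal n F" .
      have "g \<in> vars_ideal n F"
        using update.IH gF update.prems(2) u0 by (auto simp: lookup_update)
      then have "g \<oplus>\<^bsub>F\<^esub> Poly_Mapping.single u c \<in> vars_ideal n F"
        using su by (rule V.a_closed)
      also have "g \<oplus>\<^bsub>F\<^esub> Poly_Mapping.single u c = Poly_Mapping.update u c g"
      proof (rule poly_mapping_eqI)
        fix v
        have "lookup g v mod int p = lookup g v"
          using gF by (auto simp: carrier_F_iff)
        then show "lookup (g \<oplus>\<^bsub>F\<^esub> Poly_Mapping.single u c) v =
            lookup (Poly_Mapping.update u c g) v"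
          using c(1) g0
          by (cases "v = u") (simp_all add: Fp_mpoly_ring_def lookup_map_zero lookup_add lookup_single when_def look)
      qed
      finally show ?case .
    qed
  qed
qed

section \<open>Fractions regular at the origin, represented by lifts\<close>

lemma away_from_origin_eq: "away_from_origin p n = \<rho> ` units0"
proof -
  have "lookup (\<rho> f) 0 = 0 \<longleftrightarrow> lookup f 0 \<in> pA" if "f \<in> Z" for f
    using residue_Fp_eq_iff[of "lookup f 0" 0] that prime_gt_0_nat[OF p]
    by (simp add: lookup_\<rho> mpolys_iff subring_0[OF A])
  then show ?thesis
    unfolding away_from_origin_def vars_ideal_F by (auto simp: carrier_F_\<rho> units0_def)
qed

lemma units0_Z: "s \<in> units0 \<Longrightarrow> s \<in> Z"
  by (simp add: units0_def)

lemma lookup_in_A: "f \<in> Z \<Longrightarrow> lookup f u \<in> A"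
  by (simp add: mpolys_iff subring_0[OF A])

lemma units0_1: "1 \<in> units0"
  using of_int_in_pA_iff'[of 1] prime_gt_1_nat[OF p] subring_1[OF Z] by (simp add: units0_def)

lemma units0_mult: "s \<in> units0 \<Longrightarrow> t \<in> units0 \<Longrightarrow> s * t \<in> units0"
  using pA_prime lookup_in_A by (auto simp: units0_def lookup_mult_zero subring_mult[OF Z])

text \<open>\<open>frac_rel\<close> written on lifts: equality in \<open>F\<close> becomes
  congruence modulo \<open>pZ\<close>, and the extra factor \<open>u\<close> comes from the general
  construction of a localization.\<close>

definition frac_eq :: "rat mpoly \<Rightarrow> rat mpoly \<Rightarrow> rat mpoly \<Rightarrow> rat mpoly \<Rightarrow> bool" where
  "frac_eq f s g t \<longleftrightarrow> (\<exists>u\<in>units0. u * (f * t - g * s) \<in> pZ)"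

lemma frac_rel_iff:
  assumes "f \<in> Z" "s \<in> units0" "g \<in> Z" "t \<in> units0"
  shows "((\<rho> f, \<rho> s), (\<rho> g, \<rho> t)) \<in> frac_rel F (away_from_origin p n) \<longleftrightarrow> frac_eq f s g t"
  using assms units0_Z
  by (auto simp: frac_rel_def away_from_origin_eq carrier_F_\<rho> frac_eq_def \<rho>_mult \<rho>_eq_\<rho>_iff
      subring_mult[OF Z] right_diff_distrib)

lemma frac_eq_refl: "frac_eq f s f s"
  using units0_1 pZ_0 by (auto simp: frac_eq_def mult.commute[of f])

lemma frac_eq_sym:
  assumes "frac_eq f s g t"
  shows "frac_eq g t f s"
proof -
  obtain u where "u \<in> units0" "u * (f * t - g * s) \<in> pZ"
    using assms by (auto simp: frac_eq_def)
  then show ?thesis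
    using pZ_diff[OF pZ_0, of "u * (f * t - g * s)"] by (auto simp: frac_eq_def algebra_simps)
qed

lemma frac_eq_trans:
  assumes "frac_eq f s g t" "frac_eq g t h w" "t \<in> units0" "s \<in> Z" "w \<in> Z"
  shows "frac_eq f s h w"
proof -
  obtain u v where uv: "u \<in> units0" "u * (f * t - g * s) \<in> pZ" "v \<in> units0" "v * (g * w - h * t) \<in> pZ"
    using assms by (auto simp: frac_eq_def)
  have "u * v * t * (f * w - h * s) = (v * w) * (u * (f * t - g * s)) + (u * s) * (v * (g * w - h * t))"
    by (simp add: algebra_simps)
  also have "\<dots> \<in> pZ"
    by (rule pZ_add; rule pZ_mult) (use uv assms units0_Z in \<open>auto intro!: subring_mult[OF Z]\<close>)
  finally show ?thesis
    using uv assms units0_mult by (auto simp: frac_eq_def intro!: bexI[of _ "u * v * t"])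
qed

lemma frac_eq_mult:
  assumes "frac_eq f s f' s'" "frac_eq g t g' t'" "g \<in> Z" "t' \<in> Z" "f' \<in> Z" "s \<in> Z"
  shows "frac_eq (f * g) (s * t) (f' * g') (s' * t')"
proof -
  obtain u v where uv: "u \<in> units0" "u * (f * s' - f' * s) \<in> pZ" "v \<in> units0" "v * (g * t' - g' * t) \<in> pZ"
    using assms by (auto simp: frac_eq_def)
  have "u * v * (f * g * (s' * t') - f' * g' * (s * t)) =
      (v * g * t') * (u * (f * s' - f' * s)) + (u * f' * s) * (v * (g * t' - g' * t))"
    by (simp add: algebra_simps)
  also have "\<dots> \<in> pZ"
    by (rule pZ_add; rule pZ_mult) (use uv assms units0_Z in \<open>auto intro!: subring_mult[OF Z]\<close>)
  finally show ?thesis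
    using uv units0_mult by (auto simp: frac_eq_def intro!: bexI[of _ "u * v"])
qed

lemma frac_eq_add:
  assumes "frac_eq f s f' s'" "frac_eq g t g' t'" "s \<in> Z" "t' \<in> Z" "s' \<in> Z" "t \<in> Z"
  shows "frac_eq (f * t + g * s) (s * t) (f' * t' + g' * s') (s' * t')"
proof -
  obtain u v where uv: "u \<in> units0" "u * (f * s' - f' * s) \<in> pZ" "v \<in> units0" "v * (g * t' - g' * t) \<in> pZ"
    using assms by (auto simp: frac_eq_def)
  have "u * v * ((f * t + g * s) * (s' * t') - (f' * t' + g' * s') * (s * t)) =
      (v * t * t') * (u * (f * s' - f' * s)) + (u * s * s') * (v * (g * t' - g' * t))"
    by (simp add: algebra_simps)
  also have "\<dots> \<in> pZ"
    by (rule pZ_add; rule pZ_mult) (use uv assms units0_Z in \<open>auto intro!: subring_mult[OF Z]\<close>)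
  finally show ?thesis
    using uv units0_mult by (auto simp: frac_eq_def intro!: bexI[of _ "u * v"])
qed

lemma mem_\<Theta>:
  assumes "f \<in> Z" "s \<in> units0"
  shows "x \<in> \<Theta> f s \<longleftrightarrow> (\<exists>g\<in>Z. \<exists>t\<in>units0. x = (\<rho> g, \<rho> t) \<and> frac_eq f s g t)"
proof
  assume x: "x \<in> \<Theta> f s"
  then have "((\<rho> f, \<rho> s), x) \<in> frac_rel F (away_from_origin p n)"
    by (simp add: \<Theta>_def frac_def)
  moreover from this obtain g t where "g \<in> Z" "t \<in> units0" "x = (\<rho> g, \<rho> t)"
    by (auto simp: frac_rel_def away_from_origin_eq carrier_F_\<rho>)
  ultimately show "\<exists>g\<in>Z. \<exists>t\<in>units0. x = (\<rho> g, \<rho> t) \<and> frac_eq f s g t"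
    using frac_rel_iff[OF assms] by blast
next
  assume "\<exists>g\<in>Z. \<exists>t\<in>units0. x = (\<rho> g, \<rho> t) \<and> frac_eq f s g t"
  then show "x \<in> \<Theta> f s"
    using frac_rel_iff[OF assms] by (auto simp: \<Theta>_def frac_def)
qed

lemma \<Theta>_eq_iff:
  assumes "f \<in> Z" "s \<in> units0" "g \<in> Z" "t \<in> units0"
  shows "\<Theta> f s = \<Theta> g t \<longleftrightarrow> frac_eq f s g t"
proof
  assume "\<Theta> f s = \<Theta> g t"
  moreover have "(\<rho> g, \<rho> t) \<in> \<Theta> g t"
    using assms frac_eq_refl mem_\<Theta> by blast
  ultimately have "(\<rho> g, \<rho> t) \<in> \<Theta> f s" by simp
  then have "((\<rho> f, \<rho> s), (\<rho> g, \<rho> t)) \<in> frac_rel F (away_from_origin p n)"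
    by (simp add: \<Theta>_def frac_def)
  then show "frac_eq f s g t" using frac_rel_iff[OF assms] by simp
next
  assume eq: "frac_eq f s g t"
  have "frac_eq f s h w \<longleftrightarrow> frac_eq g t h w" if "h \<in> Z" "w \<in> units0" for h w
    using frac_eq_trans[OF frac_eq_sym[OF eq], of h w] frac_eq_trans[OF eq, of h w] assms that units0_Z by blast
  then have "x \<in> \<Theta> f s \<longleftrightarrow> x \<in> \<Theta> g t" for x
    unfolding mem_\<Theta>[OF assms(1,2)] mem_\<Theta>[OF assms(3,4)] by blast
  then show "\<Theta> f s = \<Theta> g t" by blast
qed

lemma \<Theta>_eqI: "f \<in> Z \<Longrightarrow> s \<in> units0 \<Longrightarrow> g \<in> Z \<Longrightarrow> t \<in> units0 \<Longrightarrow> f * t = g * s \<Longrightarrow> \<Theta> f s = \<Theta> g t"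
  using \<Theta>_eq_iff[of f s g t] units0_1 pZ_0 by (auto simp: frac_eq_def)

lemma carrier_R: "carrier R = {\<Theta> f s |f s. f \<in> Z \<and> s \<in> units0}"
  unfolding local_ring_Fp_def localization_def
  by (auto simp: quotient_def carrier_F_\<rho> away_from_origin_eq \<Theta>_def frac_def)

text \<open>The operations of \<open>localization\<close> are unions over all representatives; such
  a union collapses once its members are shown to be independent of the representatives.\<close>

lemma UN_const:
  assumes "X \<noteq> {}" "Y \<noteq> {}" "\<And>a s b t. (a, s) \<in> X \<Longrightarrow> (b, t) \<in> Y \<Longrightarrow> h a s b t = W"
  shows "(\<Union>(a, s)\<in>X. \<Union>(b, t)\<in>Y. h a s b t) = W"
proof -
  have "(\<Union>(a, s)\<in>X. \<Union>(b, t)\<in>Y. h a s b t) = (\<Union>x\<in>X. \<Union>y\<in>Y. W)"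
    using assms(3) by (intro SUP_cong refl) (auto split: prod.split)
  then show ?thesis using assms(1,2) by simp
qed

lemma \<Theta>_nonempty: "f \<in> Z \<Longrightarrow> s \<in> units0 \<Longrightarrow> \<Theta> f s \<noteq> {}"
  using mem_\<Theta> frac_eq_refl by blast

lemma \<Theta>_mult:
  assumes "f \<in> Z" "s \<in> units0" "g \<in> Z" "t \<in> units0"
  shows "\<Theta> f s \<otimes>\<^bsub>R\<^esub> \<Theta> g t = \<Theta> (f * g) (s * t)"
  unfolding local_ring_Fp_def localization_def monoid.simps
proof (rule UN_const)
  fix a1 s1 b1 t1 assume "(a1, s1) \<in> \<Theta> f s" "(b1, t1) \<in> \<Theta> g t"
  then obtain f' s' g' t' where *: "f' \<in> Z" "s' \<in> units0" "a1 = \<rho> f'" "s1 = \<rho> s'" "frac_eq f s f' s'"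
    "g' \<in> Z" "t' \<in> units0" "b1 = \<rho> g'" "t1 = \<rho> t'" "frac_eq g t g' t'"
    using mem_\<Theta> assms by (metis prod.inject)
  have "\<Theta> (f' * g') (s' * t') = \<Theta> (f * g) (s * t)"
    using * assms units0_Z
    by (subst \<Theta>_eq_iff) (auto intro!: frac_eq_mult frac_eq_sym[of f] frac_eq_sym[of g] units0_mult subring_mult[OF Z])
  then show "frac F (away_from_origin p n) (a1 \<otimes>\<^bsub>F\<^esub> b1) (s1 \<otimes>\<^bsub>F\<^esub> t1) = \<Theta> (f * g) (s * t)"
    using * units0_Z by (simp add: \<rho>_mult \<Theta>_def)
qed (use \<Theta>_nonempty assms in auto)

lemma \<Theta>_add:
  assumes "f \<in> Z" "s \<in> units0" "g \<in> Z" "t \<in> units0"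
  shows "\<Theta> f s \<oplus>\<^bsub>R\<^esub> \<Theta> g t = \<Theta> (f * t + g * s) (s * t)"
  unfolding local_ring_Fp_def localization_def ring.simps
proof (rule UN_const)
  fix a1 s1 b1 t1 assume "(a1, s1) \<in> \<Theta> f s" "(b1, t1) \<in> \<Theta> g t"
  then obtain f' s' g' t' where *: "f' \<in> Z" "s' \<in> units0" "a1 = \<rho> f'" "s1 = \<rho> s'" "frac_eq f s f' s'"
    "g' \<in> Z" "t' \<in> units0" "b1 = \<rho> g'" "t1 = \<rho> t'" "frac_eq g t g' t'"
    using mem_\<Theta> assms by (metis prod.inject)
  have "\<Theta> (f' * t' + g' * s') (s' * t') = \<Theta> (f * t + g * s) (s * t)"
    using * assms units0_Z
    by (subst \<Theta>_eq_iff) (auto intro!: frac_eq_add frac_eq_sym[of f] frac_eq_sym[of g] units0_mult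
        subring_mult[OF Z] subring_add[OF Z])
  then show "frac F (away_from_origin p n) ((a1 \<otimes>\<^bsub>F\<^esub> t1) \<oplus>\<^bsub>F\<^esub> (b1 \<otimes>\<^bsub>F\<^esub> s1)) (s1 \<otimes>\<^bsub>F\<^esub> t1) = \<Theta> (f * t + g * s) (s * t)"
    using * units0_Z by (simp add: \<rho>_mult \<rho>_add subring_mult[OF Z] \<Theta>_def)
qed (use \<Theta>_nonempty assms in auto)

lemma zero_R: "\<zero>\<^bsub>R\<^esub> = \<Theta> 0 1"
  by (simp add: local_ring_Fp_def localization_def zero_F one_F \<Theta>_def)

lemma one_R: "\<one>\<^bsub>R\<^esub> = \<Theta> 1 1"
  by (simp add: local_ring_Fp_def localization_def one_F \<Theta>_def)

lemma \<Theta>_in_carrier: "f \<in> Z \<Longrightarrow> s \<in> units0 \<Longrightarrow> \<Theta> f s \<in> carrier R"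
  unfolding carrier_R by blast

lemma carrier_RE: "x \<in> carrier R \<Longrightarrow> (\<And>f s. f \<in> Z \<Longrightarrow> s \<in> units0 \<Longrightarrow> x = \<Theta> f s \<Longrightarrow> thesis) \<Longrightarrow> thesis"
  unfolding carrier_R by blast

lemmas Z_closed = units0_Z units0_mult units0_1 subring_0[OF Z] subring_1[OF Z] subring_add[OF Z]
  subring_mult[OF Z] subring_uminus[OF Z] subring_power[OF Z]

lemma \<Theta>_zero: "s \<in> units0 \<Longrightarrow> \<Theta> 0 s = \<Theta> 0 1"
  by (rule \<Theta>_eqI) (auto intro: Z_closed)

lemma cring_R: "cring R"
proof (rule cringI)
  note simps = \<Theta>_mult \<Theta>_add zero_R one_R Z_closed
  show "abelian_group R"
  proof (rule abelian_groupI)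
    show "\<exists>y\<in>carrier R. y \<oplus>\<^bsub>R\<^esub> x = \<zero>\<^bsub>R\<^esub>" if "x \<in> carrier R" for x
      using that
    proof (rule carrier_RE)
      fix f s assume "f \<in> Z" "s \<in> units0" "x = \<Theta> f s"
      then have "\<Theta> (- f) s \<oplus>\<^bsub>R\<^esub> x = \<zero>\<^bsub>R\<^esub>"
        by (simp add: simps \<Theta>_zero[of "s * s"])
      then show ?thesis
        using \<Theta>_in_carrier[of "- f" s] \<open>f \<in> Z\<close> \<open>s \<in> units0\<close> by (auto simp: simps)
    qed
  qed (auto elim!: carrier_RE simp: simps intro!: \<Theta>_in_carrier \<Theta>_eqI; simp add: algebra_simps)+
  show "comm_monoid R"
    by (rule comm_monoidI)
      (auto elim!: carrier_RE simp: simps intro!: \<Theta>_in_carrier \<Theta>_eqI; simp add: algebra_simps)+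
  fix x y z assume "x \<in> carrier R" "y \<in> carrier R" "z \<in> carrier R"
  then obtain f s g t h w where "x = \<Theta> f s" "y = \<Theta> g t" "z = \<Theta> h w"
    and *: "f \<in> Z" "s \<in> units0" "g \<in> Z" "t \<in> units0" "h \<in> Z" "w \<in> units0"
    by (metis carrier_RE)
  moreover have "\<Theta> ((f * t + g * s) * h) (s * t * w) =
      \<Theta> (f * h * (t * w) + g * h * (s * w)) (s * w * (t * w))"
    using * by (intro \<Theta>_eqI) (simp_all add: Z_closed algebra_simps)
  ultimately show "(x \<oplus>\<^bsub>R\<^esub> y) \<otimes>\<^bsub>R\<^esub> z = x \<otimes>\<^bsub>R\<^esub> z \<oplus>\<^bsub>R\<^esub> y \<otimes>\<^bsub>R\<^esub> z"
    by (simp add: simps)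
qed

lemma \<Theta>_power:
  assumes "f \<in> Z" "s \<in> units0"
  shows "\<Theta> f s [^]\<^bsub>R\<^esub> (k::nat) = \<Theta> (f ^ k) (s ^ k)" "s ^ k \<in> units0"
proof -
  interpret R: cring R by (rule cring_R)
  show u: "s ^ k \<in> units0" for k
    by (induction k) (auto intro: units0_1 units0_mult assms)
  show "\<Theta> f s [^]\<^bsub>R\<^esub> (k::nat) = \<Theta> (f ^ k) (s ^ k)"
    by (induction k) (simp_all add: one_R \<Theta>_mult u assms Z_closed mult.commute)
qed

lemma reduce_Fp_eq: "reduce_Fp p n f = \<Theta> f 1"
  by (simp add: reduce_Fp_def \<Theta>_def one_F \<rho>_def[symmetric])

section \<open>Ideals of the local ring and their counterparts in A[X]\<close>

definition localize :: "rat mpoly set \<Rightarrow> (int mpoly \<times> int mpoly) set set" where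
  "localize I = {\<Theta> f s |f s. f \<in> I \<and> s \<in> units0}"

text \<open>Equality of fractions determines a numerator only up to a factor from
  \<open>units0\<close> and up to \<open>pZ\<close>; hence the multiplier \<open>u\<close> in the
  criterion and its hypothesis \<open>pZ \<subseteq> I\<close>.\<close>

lemma
  assumes I: "ideal I (set_ring Z)"
  shows ideal_localize: "ideal (localize I) R"
    and \<Theta>_in_localize_iff: "pZ \<subseteq> I \<Longrightarrow> f \<in> Z \<Longrightarrow> s \<in> units0 \<Longrightarrow> \<Theta> f s \<in> localize I \<longleftrightarrow> (\<exists>u\<in>units0. u * f \<in> I)"
proof -
  interpret R: cring R by (rule cring_R)
  note D = ideal_set_ringD[OF Z I]
  have IZ: "f \<in> I \<Longrightarrow> f \<in> Z" for f using D(1) by blast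
  have locE: "x \<in> localize I \<Longrightarrow> (\<And>f s. f \<in> I \<Longrightarrow> s \<in> units0 \<Longrightarrow> x = \<Theta> f s \<Longrightarrow> thesis) \<Longrightarrow> thesis" for x thesis
    unfolding localize_def by blast
  have locI: "f \<in> I \<Longrightarrow> s \<in> units0 \<Longrightarrow> \<Theta> f s \<in> localize I" for f s
    unfolding localize_def by blast
  have Dm: "f \<in> I \<Longrightarrow> g \<in> Z \<Longrightarrow> f * g \<in> I" for f g
    using D(4)[of g f] by (simp add: mult.commute)
  show "ideal (localize I) R"
  proof (rule idealI)
    show "subgroup (localize I) (add_monoid R)"
    proof (rule R.add.subgroupI)
      show "localize I \<subseteq> carrier R"
        by (auto elim!: locE intro!: \<Theta>_in_carrier IZ)
      show "localize I \<noteq> {}"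
        using locI[OF D(2) units0_1] by blast
      show "\<ominus>\<^bsub>R\<^esub> x \<in> localize I" if "x \<in> localize I" for x
        using that
      proof (rule locE)
        fix f s assume *: "f \<in> I" "s \<in> units0" "x = \<Theta> f s"
        then have "\<ominus>\<^bsub>R\<^esub> x = \<Theta> (- f) s"
          using IZ by (intro R.minus_equality)
            (simp_all add: \<Theta>_add zero_R Z_closed \<Theta>_zero[of "s * s"] \<Theta>_in_carrier)
        moreover have "- f \<in> I" using D(5)[OF D(2) *(1)] by simp
        ultimately show ?thesis using * locI by simp
      qed
      show "x \<oplus>\<^bsub>R\<^esub> y \<in> localize I" if "x \<in> localize I" "y \<in> localize I" for x y
        using that by (auto elim!: locE simp: \<Theta>_add IZ intro!: locI units0_mult D(3) Dm units0_Z)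
    qed
    show "a \<otimes>\<^bsub>R\<^esub> x \<in> localize I" "x \<otimes>\<^bsub>R\<^esub> a \<in> localize I" if xa: "x \<in> carrier R" "a \<in> localize I" for a x
    proof -
      obtain f s where *: "f \<in> I" "s \<in> units0" "a = \<Theta> f s"
        using xa(2) by (rule locE)
      obtain g t where "g \<in> Z" "t \<in> units0" "x = \<Theta> g t"
        using xa(1) by (rule carrier_RE)
      with * show "a \<otimes>\<^bsub>R\<^esub> x \<in> localize I" "x \<otimes>\<^bsub>R\<^esub> a \<in> localize I"
        using D(4) Dm by (auto simp: \<Theta>_mult IZ intro!: locI units0_mult)
    qed
  qed (rule R.ring_axioms)
  show "\<Theta> f s \<in> localize I \<longleftrightarrow> (\<exists>u\<in>units0. u * f \<in> I)" if fs: "pZ \<subseteq> I" "f \<in> Z" "s \<in> units0"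
  proof
    assume "\<Theta> f s \<in> localize I"
    then obtain g t where g: "g \<in> I" "t \<in> units0" "\<Theta> f s = \<Theta> g t"
      by (rule locE)
    then obtain u where u: "u \<in> units0" "u * (f * t - g * s) \<in> pZ"
      using fs \<Theta>_eq_iff[of f s g t] IZ by (auto simp: frac_eq_def)
    have "(u * t) * f = u * (f * t - g * s) + (u * s) * g" by (simp add: algebra_simps)
    also have "\<dots> \<in> I"
    proof (rule D(3))
      show "u * (f * t - g * s) \<in> I" using u fs by blast
      show "u * s * g \<in> I" using u g fs by (intro D(4)) (simp_all add: Z_closed)
    qed
    finally show "\<exists>u\<in>units0. u * f \<in> I" using u g units0_mult by blast
  next
    assume "\<exists>u\<in>units0. u * f \<in> I"
    then obtain u where u: "u \<in> units0" "u * f \<in> I" by blast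
    then have "\<Theta> (u * f) (u * s) \<in> localize I"
      using fs by (intro locI units0_mult)
    also have "\<Theta> (u * f) (u * s) = \<Theta> f s"
      using u fs by (intro \<Theta>_eqI) (simp_all add: Z_closed)
    finally show "\<Theta> f s \<in> localize I" .
  qed
qed

text \<open>The generator p takes the place of reduction modulo p: for J inside \<open>Z\<close>
  this is the preimage in \<open>Z\<close> of the ideal of \<open>F\<close> generated by the
  residues of the q-th powers. For \<open>q = 1\<close> and an ideal J it is J + pZ.\<close>

abbreviation frob :: "rat mpoly set \<Rightarrow> nat \<Rightarrow> rat mpoly set" where
  "frob J q \<equiv> span_over Z ({y ^ q |y. y \<in> J} \<union> {of_nat p})"

lemma extend_Fp_ideal:
  assumes "J \<subseteq> Z"
  shows "ideal (extend_Fp p n J) R" "f \<in> J \<Longrightarrow> \<Theta> f 1 \<in> extend_Fp p n J"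
proof -
  interpret R: cring R by (rule cring_R)
  have *: "(\<lambda>f. \<Theta> f 1) ` J \<subseteq> carrier R"
    using assms by (auto intro!: \<Theta>_in_carrier units0_1)
  show "ideal (extend_Fp p n J) R" "f \<in> J \<Longrightarrow> \<Theta> f 1 \<in> extend_Fp p n J"
    using R.genideal_ideal[OF *] R.genideal_self[OF *] by (auto simp: extend_Fp_def reduce_Fp_eq)
qed

lemma frob_subset: "J \<subseteq> Z \<Longrightarrow> {y ^ q |y. y \<in> J} \<union> {of_nat p} \<subseteq> Z"
  by (auto intro: subring_power[OF Z] subring_of_nat[OF Z])

lemma ideal_frob: "J \<subseteq> Z \<Longrightarrow> ideal (frob J q) (set_ring Z)"
proof -
  assume "J \<subseteq> Z"
  then show ?thesis
    using span_over_subset[OF Z frob_subset[of J q]]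
    by (intro ideal_set_ringI[OF Z]) (auto intro: span_over.zero span_over_add span_over_mult[OF Z])
qed

lemma pZ_subset_frob: "pZ \<subseteq> frob J q"
  by (auto simp: pZ_def mult.commute[of "of_nat p"] intro!: span_over_mult_gen[OF Z])

text \<open>The Frobenius power is generated by the q-th powers of all elements of the extended
  ideal, not only of those coming from J. As J is an ideal, each such element is a single fraction
  with numerator \<open>y + of_nat p * d\<close>, \<open>y\<close> in J, and its q-th power has a
  numerator congruent to \<open>y ^ q\<close> modulo p.\<close>

lemma frobenius_power_iff:
  assumes J: "ideal J (set_ring Z)" and f: "f \<in> Z"
  shows "\<Theta> f 1 \<in> frobenius_power R (extend_Fp p n J) q \<longleftrightarrow> (\<exists>u\<in>units0. u * f \<in> frob J q)"
    and "ideal (frobenius_power R (extend_Fp p n J) q) R"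
proof -
  interpret R: cring R by (rule cring_R)
  note JZ = ideal_set_ringD(1)[OF Z J]
  let ?G = "{y [^]\<^bsub>R\<^esub> q |y. y \<in> extend_Fp p n J}"
  have Gc: "?G \<subseteq> carrier R"
    using extend_Fp_ideal(1)[OF JZ] by (auto intro!: R.nat_pow_closed ideal.Icarr)
  show FI: "ideal (frobenius_power R (extend_Fp p n J) q) R"
    unfolding frobenius_power_def by (rule R.genideal_ideal[OF Gc])
  interpret FI: ideal "frobenius_power R (extend_Fp p n J) q" R by (rule FI)
  show "\<Theta> f 1 \<in> frobenius_power R (extend_Fp p n J) q \<longleftrightarrow> (\<exists>u\<in>units0. u * f \<in> frob J q)"
  proof
    let ?J0 = "frob J 1"
    have J1: "{y ^ 1 |y. y \<in> J} = J" by simp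
    have J0: "\<exists>y\<in>J. \<exists>d\<in>Z. g = y + of_nat p * d" if "g \<in> ?J0" for g
    proof (rule span_over_least[OF that, of "{g. \<exists>y\<in>J. \<exists>d\<in>Z. g = y + of_nat p * d}", unfolded mem_Collect_eq])
      note D = ideal_set_ringD[OF Z J]
      show "\<exists>y\<in>J. \<exists>d\<in>Z. 0 = y + of_nat p * d"
        using D(2) subring_0[OF Z] by force
      show "\<exists>y\<in>J. \<exists>d\<in>Z. a + b = y + of_nat p * d"
        if "\<exists>y\<in>J. \<exists>d\<in>Z. a = y + of_nat p * d" "\<exists>y\<in>J. \<exists>d\<in>Z. b = y + of_nat p * d" for a b
      proof -
        from that obtain y d y' d' where "y \<in> J" "d \<in> Z" "a = y + of_nat p * d" "y' \<in> J" "d' \<in> Z" "b = y' + of_nat p * d'"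
          by blast
        then show ?thesis
          using D(3) subring_add[OF Z] by (intro bexI[of _ "y + y'"] bexI[of _ "d + d'"]) (auto simp: algebra_simps)
      qed
      show "\<exists>y\<in>J. \<exists>d\<in>Z. c * g = y + of_nat p * d" if "c \<in> Z" "g \<in> {y ^ 1 |y. y \<in> J} \<union> {of_nat p}" for c g
      proof -
        from that(2) have "g = of_nat p \<or> g \<in> J" by auto
        then show ?thesis
        proof
        assume "g = of_nat p"
        then show ?thesis using D(2) that(1) by (intro bexI[of _ 0] bexI[of _ c]) (auto simp: mult.commute)
      next
        assume "g \<in> J"
        then show ?thesis using D(4) that(1) subring_0[OF Z] by (intro bexI[of _ "c * g"] bexI[of _ 0]) auto
        qed
      qed
    qed
    have pow: "g ^ q \<in> frob J q" if g: "g \<in> ?J0" for g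
    proof -
      obtain y d where yd: "y \<in> J" "d \<in> Z" "g = y + of_nat p * d" using J0[OF g] by blast
      have yZ: "y \<in> Z" using yd JZ by blast
      have "\<exists>c\<in>Z. (y + of_nat p * d) ^ k = y ^ k + of_nat p * c" for k
      proof (induction k)
        case 0
        show ?case using subring_0[OF Z] by (intro bexI[of _ 0]) auto
      next
        case (Suc k)
        then obtain c where "c \<in> Z" "(y + of_nat p * d) ^ k = y ^ k + of_nat p * c" by blast
        then show ?case
          using yd(2) yZ
          by (intro bexI[of _ "y * c + d * y ^ k + of_nat p * d * c"])
            (auto simp: algebra_simps intro!: subring_intros[OF Z])
      qed
      then obtain c where c: "c \<in> Z" "g ^ q = y ^ q + c * of_nat p" using yd(3) by (auto simp: mult.commute)
      show ?thesis
        unfolding c(2) using yd(1) c(1)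
        by (intro span_over_add span_over_mult_gen[OF Z] span_over_superset[OF Z]) auto
    qed
    assume "\<Theta> f 1 \<in> frobenius_power R (extend_Fp p n J) q"
    also have "frobenius_power R (extend_Fp p n J) q \<subseteq> localize (frob J q)"
      unfolding frobenius_power_def
    proof (rule R.genideal_minimal[OF ideal_localize[OF ideal_frob[OF JZ]]])
      have "extend_Fp p n J \<subseteq> localize ?J0"
        unfolding extend_Fp_def
      proof (rule R.genideal_minimal[OF ideal_localize[OF ideal_frob[OF JZ]]])
        show "reduce_Fp p n ` J \<subseteq> localize ?J0"
          using units0_1 unfolding J1
          by (auto simp: reduce_Fp_eq localize_def intro!: span_over_superset[OF Z] exI)
      qed
      moreover have "x [^]\<^bsub>R\<^esub> q \<in> localize (frob J q)" if x: "x \<in> localize ?J0" for x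
      proof -
        obtain g s where g: "g \<in> ?J0" "s \<in> units0" "x = \<Theta> g s"
          using x by (auto simp: localize_def)
        moreover have "g \<in> Z"
          using g(1) ideal_set_ringD(1)[OF Z ideal_frob[OF JZ]] by blast
        ultimately show ?thesis
          using pow[OF g(1)] \<Theta>_power[of g s q] by (auto simp: localize_def)
      qed
      ultimately show "?G \<subseteq> localize (frob J q)" by blast
    qed
    finally show "\<exists>u\<in>units0. u * f \<in> frob J q"
      using \<Theta>_in_localize_iff[OF ideal_frob[OF JZ] pZ_subset_frob f units0_1] by simp
  next
    assume "\<exists>u\<in>units0. u * f \<in> frob J q"
    then obtain u where u: "u \<in> units0" "u * f \<in> frob J q" by blast
    \<comment> \<open>The numerators whose fraction over 1 lies in the Frobenius power form an ideal
      of \<open>Z\<close> containing p and the q-th powers, hence all of \<open>frob J q\<close>.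
      The factor \<open>u\<close> is divided out at the end.\<close>
    let ?K = "{g \<in> Z. \<Theta> g 1 \<in> frobenius_power R (extend_Fp p n J) q}"
    have "u * f \<in> ?K"
    proof (rule span_over_least[OF u(2)])
      show "0 \<in> ?K" using FI.zero_closed by (simp add: zero_R Z_closed)
      show "x + y \<in> ?K" if "x \<in> ?K" "y \<in> ?K" for x y
        using that FI.a_closed[of "\<Theta> x 1" "\<Theta> y 1"] by (auto simp: \<Theta>_add Z_closed)
      fix c g assume c: "c \<in> Z" and "g \<in> {y ^ q |y. y \<in> J} \<union> {of_nat p}"
      then consider y where "y \<in> J" "g = y ^ q" | "g = of_nat p" by blast
      then have "g \<in> ?K"
      proof cases
        case 1
        then have "\<Theta> y 1 [^]\<^bsub>R\<^esub> q \<in> frobenius_power R (extend_Fp p n J) q"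
          unfolding frobenius_power_def
          using R.genideal_self[OF Gc] extend_Fp_ideal(2)[OF JZ] by blast
        then show ?thesis
          using 1 JZ by (auto simp: \<Theta>_power units0_1 Z_closed subset_iff)
      next
        case 2
        have "of_nat p \<in> Z" by (rule subring_of_nat[OF Z])
        moreover have "\<Theta> (of_nat p) 1 = \<zero>\<^bsub>R\<^esub>"
          unfolding zero_R using units0_1 subring_1[OF Z]
          by (subst \<Theta>_eq_iff) (auto simp: frac_eq_def pZ_def subring_of_nat[OF Z] Z_closed intro!: bexI[of _ 1] exI[of _ 1])
        ultimately show ?thesis using 2 FI.zero_closed by simp
      qed
      then show "c * g \<in> ?K"
        using c FI.I_l_closed[of "\<Theta> g 1" "\<Theta> c 1"] \<Theta>_in_carrier[OF c units0_1]
        by (auto simp: \<Theta>_mult Z_closed)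
    qed
    then have uf: "\<Theta> (u * f) 1 \<in> frobenius_power R (extend_Fp p n J) q" by simp
    have "\<Theta> (u * f) u = \<Theta> f 1"
      using u f by (intro \<Theta>_eqI) (simp_all add: Z_closed)
    then have "\<Theta> 1 u \<otimes>\<^bsub>R\<^esub> \<Theta> (u * f) 1 = \<Theta> f 1"
      using u f by (simp add: \<Theta>_mult Z_closed)
    moreover have "\<Theta> 1 u \<in> carrier R"
      using u by (intro \<Theta>_in_carrier Z_closed)
    ultimately show "\<Theta> f 1 \<in> frobenius_power R (extend_Fp p n J) q"
      using FI.I_l_closed[OF uf] by metis
  qed
qed

text \<open>The inclusion is tested one factor at a time: a product of two ideals lies in
  \<open>K\<close> as soon as one of them lies in the ideal quotient of \<open>K\<close> by the
  other. This is why \<open>K\<close> varies in the induction.\<close>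

lemma ideal_power_subset_iff:
  assumes "I \<subseteq> Z" "ideal K R"
  shows "extend_Fp p n I [^]\<^bsub>ideals_set R\<^esub> r \<subseteq> K \<longleftrightarrow> (\<forall>x\<in>products I r. \<Theta> x 1 \<in> K)"
proof -
  interpret R: cring R by (rule cring_R)
  note E = extend_Fp_ideal[OF assms(1)]
  have prodZ: "products I r \<subseteq> Z" for r by (rule products_subset[OF Z assms(1)])
  have pow0: "extend_Fp p n I [^]\<^bsub>ideals_set R\<^esub> (0::nat) = carrier R"
    by (simp add: nat_pow_def ideals_set_def)
  have powS: "extend_Fp p n I [^]\<^bsub>ideals_set R\<^esub> (Suc r) =
      ideal_prod R (extend_Fp p n I [^]\<^bsub>ideals_set R\<^esub> r) (extend_Fp p n I)" for r
    by (simp add: nat_pow_def ideals_set_def)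
  have mem: "\<Theta> x 1 \<in> extend_Fp p n I [^]\<^bsub>ideals_set R\<^esub> r" if "x \<in> products I r" for x r
    using that
  proof (induction r arbitrary: x)
    case 0
    then show ?case unfolding pow0 using \<Theta>_in_carrier by (simp add: Z_closed)
  next
    case (Suc r)
    then obtain y g where y: "y \<in> products I r" "g \<in> I" "x = y * g" by auto
    then have "\<Theta> y 1 \<otimes>\<^bsub>R\<^esub> \<Theta> g 1 \<in> extend_Fp p n I [^]\<^bsub>ideals_set R\<^esub> (Suc r)"
      unfolding powS using Suc.IH E(2) by (intro ideal_prod.prod)
    moreover have "y \<in> Z" "g \<in> Z" using y prodZ assms(1) by blast+
    ultimately show ?case using y(3) by (simp add: \<Theta>_mult Z_closed)
  qed
  have least: "extend_Fp p n I [^]\<^bsub>ideals_set R\<^esub> r \<subseteq> K"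
    if "\<forall>x\<in>products I r. \<Theta> x 1 \<in> K" "ideal K R" for r K
    using that
  proof (induction r arbitrary: K)
    case 0
    then interpret K: ideal K R by simp
    have "\<one>\<^bsub>R\<^esub> \<in> K" using 0 by (simp add: one_R)
    then show ?case unfolding pow0 using K.one_imp_carrier by blast
  next
    case (Suc r)
    interpret K: ideal K R by (rule Suc.prems(2))
    let ?colon = "\<lambda>X. {a \<in> carrier R. \<forall>b\<in>X. a \<otimes>\<^bsub>R\<^esub> b \<in> K}"
    have colon: "ideal (?colon X) R" if X: "X \<subseteq> carrier R" for X
    proof (rule idealI)
      show "subgroup (?colon X) (add_monoid R)"
      proof (rule R.add.subgroupI)
        show "?colon X \<noteq> {}"
          using X K.zero_closed by (auto intro!: exI[of _ "\<zero>\<^bsub>R\<^esub>"])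
        show "\<ominus>\<^bsub>R\<^esub> a \<in> ?colon X" if "a \<in> ?colon X" for a
          using that X by (auto simp: R.l_minus subset_iff intro: K.a_inv_closed)
        show "a \<oplus>\<^bsub>R\<^esub> b \<in> ?colon X" if "a \<in> ?colon X" "b \<in> ?colon X" for a b
          using that X by (auto simp: R.l_distr subset_iff intro: K.a_closed)
      qed auto
      show "x \<otimes>\<^bsub>R\<^esub> a \<in> ?colon X" "a \<otimes>\<^bsub>R\<^esub> x \<in> ?colon X" if "a \<in> ?colon X" "x \<in> carrier R" for a x
      proof -
        have "x \<otimes>\<^bsub>R\<^esub> a \<otimes>\<^bsub>R\<^esub> b \<in> K" if "b \<in> X" for b
          using that \<open>a \<in> ?colon X\<close> \<open>x \<in> carrier R\<close> X K.I_l_closed by (auto simp: R.m_assoc subset_iff)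
        then show "x \<otimes>\<^bsub>R\<^esub> a \<in> ?colon X" "a \<otimes>\<^bsub>R\<^esub> x \<in> ?colon X"
          using that by (auto simp: R.m_comm)
      qed
    qed (rule R.ring_axioms)
    have IR: "reduce_Fp p n ` I \<subseteq> carrier R" "extend_Fp p n I \<subseteq> carrier R"
      using assms(1) ideal.Icarr[OF E(1)] by (auto simp: reduce_Fp_eq intro!: \<Theta>_in_carrier units0_1)
    have "extend_Fp p n I [^]\<^bsub>ideals_set R\<^esub> r \<subseteq> ?colon (extend_Fp p n I)"
    proof (rule Suc.IH)
      show "ideal (?colon (extend_Fp p n I)) R" by (rule colon[OF IR(2)])
      show "\<forall>x\<in>products I r. \<Theta> x 1 \<in> ?colon (extend_Fp p n I)"
      proof
        fix x assume x: "x \<in> products I r"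
        then have xZ: "x \<in> Z" using prodZ by blast
        have xR: "\<Theta> x 1 \<in> carrier R" by (intro \<Theta>_in_carrier xZ units0_1)
        \<comment> \<open>The roles are exchanged: for fixed \<open>x\<close> the elements whose
          product with it lies in \<open>K\<close> form an ideal, so the generators of the extended
          ideal suffice.\<close>
        have "extend_Fp p n I \<subseteq> ?colon {\<Theta> x 1}"
          unfolding extend_Fp_def
        proof (rule R.genideal_minimal)
          show "ideal (?colon {\<Theta> x 1}) R" using xR by (intro colon) simp
          have "\<Theta> g 1 \<otimes>\<^bsub>R\<^esub> \<Theta> x 1 \<in> K" if "g \<in> I" for g
          proof -
            have "x * g \<in> products I (Suc r)" using x that by auto
            then have "\<Theta> (x * g) 1 \<in> K" using Suc.prems(1) by blast
            then show ?thesis using that assms(1) xZ by (auto simp: \<Theta>_mult Z_closed subset_iff mult.commute)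
          qed
          then show "reduce_Fp p n ` I \<subseteq> ?colon {\<Theta> x 1}"
            using IR by (auto simp: reduce_Fp_eq)
        qed
        then show "\<Theta> x 1 \<in> ?colon (extend_Fp p n I)"
          using xR IR(2) by (auto simp: R.m_comm subset_iff)
      qed
    qed
    then have *: "a \<otimes>\<^bsub>R\<^esub> b \<in> K" if "a \<in> extend_Fp p n I [^]\<^bsub>ideals_set R\<^esub> r" "b \<in> extend_Fp p n I" for a b
      using that by blast
    show ?case
    proof
      fix z assume "z \<in> extend_Fp p n I [^]\<^bsub>ideals_set R\<^esub> (Suc r)"
      then show "z \<in> K"
        unfolding powS by (induction rule: ideal_prod.induct) (auto intro: * K.a_closed)
    qed
  qed
  show ?thesis using mem least[OF _ assms(2)] by blast
qed

text \<open>The constant coefficient of \<open>u\<close> is invertible modulo p. A Bezout relation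
  gives a constant multiple of \<open>u\<close> whose constant coefficient is 1 up to a multiple of
  p, and multiples of p can be added freely because p generates part of \<open>frob J q\<close>. The
  normalized form makes sense over B as well.\<close>

lemma units0_normalize:
  assumes u: "u \<in> units0" and uf: "u * f \<in> frob J q" and f: "f \<in> Z"
  shows "\<exists>v\<in>Z. lookup v 0 = 1 \<and> v * f \<in> frob J q"
proof -
  obtain a k where a: "lookup u 0 = of_int a / of_int m ^ k"
    using A_mem lookup_in_A u units0_Z by blast
  then have "\<not> int p dvd a" using u by (simp add: units0_def of_int_in_pA_iff)
  then have "coprime a (int p)"
    using p by (metis coprime_commute prime_imp_coprime prime_int_nat_transfer prime_nat_int_transfer)
  then obtain b c where bc: "b * a + c * int p = 1"
    by (metis bezout_int coprime_imp_gcd_eq_1)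
  define w where "w = const_mpoly (of_int (b * m ^ k) :: rat)"
  have w: "w \<in> Z"
    unfolding w_def by (intro const_in_mpolys subring_of_int[OF A])
  define v where "v = w * u + of_int c * of_nat p"
  have "lookup v 0 = of_int (b * m ^ k) * (of_int a / of_int m ^ k) + of_int c * of_nat p"
    by (simp add: v_def w_def lookup_add lookup_mult_zero a lookup_of_int lookup_of_nat)
  also have "\<dots> = of_int (b * a + c * int p)"
    using m0 by simp
  finally have v0: "lookup v 0 = 1" by (simp only: bc of_int_1)
  have vZ: "v \<in> Z"
    unfolding v_def using w units0_Z[OF u] by (intro subring_intros[OF Z])
  have "v * f = w * (u * f) + (of_int c * f) * of_nat p"
    by (simp add: v_def algebra_simps)
  also have "\<dots> \<in> frob J q"
    by (intro span_over_add span_over_mult[OF Z w uf] span_over_mult_gen[OF Z] subring_mult[OF Z]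
        subring_of_int[OF Z] f) simp
  finally show ?thesis using v0 vZ by blast
qed

proposition power_subset_frobenius_power_iff:
  assumes I: "I \<subseteq> Z" and J: "ideal J (set_ring Z)"
  shows "extend_Fp p n I [^]\<^bsub>ideals_set R\<^esub> r \<subseteq> frobenius_power R (extend_Fp p n J) q \<longleftrightarrow>
    (\<forall>x\<in>products I r. \<exists>v\<in>Z. lookup v 0 = 1 \<and> v * x \<in> frob J q)"
proof -
  have "(\<exists>u\<in>units0. u * x \<in> frob J q) \<longleftrightarrow> (\<exists>v\<in>Z. lookup v 0 = 1 \<and> v * x \<in> frob J q)" if "x \<in> Z" for x
    using units0_normalize[OF _ _ that] of_int_in_pA_iff'[of 1] prime_gt_1_nat[OF p]
    by (fastforce simp: units0_def)
  then show ?thesis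
    using ideal_power_subset_iff[OF I frobenius_power_iff(2)[OF J subring_0[OF Z]]]
      frobenius_power_iff(1)[OF J] products_subset[OF Z I, of r] by (simp add: subset_iff)
qed

end

subsection \<open>The functional equation at natural numbers\<close>

lemma pderiv_fract_Fract:
  "b \<noteq> 0 \<Longrightarrow> pderiv_fract i (Fract a b) = Fract (pderiv_mpoly i a * b - a * pderiv_mpoly i b) (b * b)"
  by (simp add: Fract_def pderiv_fract.abs_eq)

lemma pderiv_fract_add: "pderiv_fract i (x + y) = pderiv_fract i x + pderiv_fract i y"
proof -
  obtain a b where x: "x = Fract a b" "b \<noteq> 0" by (cases x) auto
  obtain c d where y: "y = Fract c d" "d \<noteq> 0" by (cases y) auto
  show ?thesis
    using x y by (simp add: pderiv_fract_Fract eq_fract pderiv_mpoly_add pderiv_mpoly_mult) (simp add: algebra_simps)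
qed

lemma pderiv_fract_mult: "pderiv_fract i (x * y) = pderiv_fract i x * y + x * pderiv_fract i y"
proof -
  obtain a b where x: "x = Fract a b" "b \<noteq> 0" by (cases x) auto
  obtain c d where y: "y = Fract c d" "d \<noteq> 0" by (cases y) auto
  show ?thesis
    using x y by (simp add: pderiv_fract_Fract eq_fract pderiv_mpoly_add pderiv_mpoly_mult) (simp add: algebra_simps)
qed

lemma pderiv_fract_0: "pderiv_fract i 0 = 0"
  using pderiv_fract_add[of i 0 0] by (simp only: add_0_left add_cancel_right_right)

lemma pderiv_fract_1: "pderiv_fract i 1 = 0"
  using pderiv_fract_mult[of i 1 1] by (simp only: mult_1_left mult_1_right add_cancel_right_right)

lemma pderiv_fract_of_nat: "pderiv_fract i (of_nat k) = 0"
  by (induction k) (auto simp: pderiv_fract_0 pderiv_fract_1 pderiv_fract_add)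

lemma pderiv_mpoly_1: "pderiv_mpoly i (1 :: 'a::comm_ring_1 mpoly) = 0"
  using pderiv_mpoly_mult[of i "1 :: 'a mpoly" 1] by simp

definition of_mpoly :: "'a::idom mpoly \<Rightarrow> 'a mpoly fract" where
  "of_mpoly f = Fract f 1"

lemma of_mpoly_simps [simp]:
  "of_mpoly 0 = 0" "of_mpoly 1 = 1" "of_mpoly (f + g) = of_mpoly f + of_mpoly g"
  "of_mpoly (f * g) = of_mpoly f * of_mpoly g" "of_mpoly f = of_mpoly g \<longleftrightarrow> f = g"
  by (simp_all add: of_mpoly_def eq_fract Zero_fract_def One_fract_def)

lemma of_mpoly_eq_0_iff [simp]: "of_mpoly f = 0 \<longleftrightarrow> f = 0"
  using of_mpoly_simps(5)[of f 0] by (simp del: of_mpoly_simps(5))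

lemma of_mpoly_power [simp]: "of_mpoly (f ^ k) = of_mpoly f ^ k"
  by (induction k) auto

lemma of_mpoly_prod: "of_mpoly (prod f I) = (\<Prod>i\<in>I. of_mpoly (f i))"
  by (induction I rule: infinite_finite_induct) auto

lemma of_mpoly_of_nat [simp]: "of_mpoly (of_nat k) = of_nat k"
  by (induction k) auto

lemma pderiv_of_mpoly: "pderiv_fract i (of_mpoly f) = of_mpoly (pderiv_mpoly i f)"
  by (simp add: of_mpoly_def pderiv_fract_Fract pderiv_mpoly_1)

lemma pderiv_fract_power:
  "x \<noteq> 0 \<Longrightarrow> pderiv_fract i (x ^ k) = x ^ k * (of_nat k * (pderiv_fract i x / x))"
  by (induction k) (auto simp: pderiv_fract_1 pderiv_fract_mult field_simps)

lemma pderiv_fract_prod_power: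
  fixes x :: "nat \<Rightarrow> 'a::idom mpoly fract"
  assumes "\<And>j. j < r \<Longrightarrow> x j \<noteq> 0"
  shows "pderiv_fract i (\<Prod>j<r. x j ^ \<alpha> j) =
    (\<Prod>j<r. x j ^ \<alpha> j) * (\<Sum>j<r. of_nat (\<alpha> j) * (pderiv_fract i (x j) / x j))"
  using assms by (induction r) (auto simp: pderiv_fract_1 pderiv_fract_mult pderiv_fract_power algebra_simps)

section \<open>Specialization of s at natural numbers\<close>

definition monomial_at :: "(nat \<Rightarrow> nat) \<Rightarrow> (nat \<Rightarrow>\<^sub>0 nat) \<Rightarrow> nat" where
  "monomial_at \<alpha> \<gamma> = (\<Prod>j\<in>keys \<gamma>. \<alpha> j ^ lookup \<gamma> j)"

lemma monomial_at_superset: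
  "finite S \<Longrightarrow> keys \<gamma> \<subseteq> S \<Longrightarrow> monomial_at \<alpha> \<gamma> = (\<Prod>j\<in>S. \<alpha> j ^ lookup \<gamma> j)"
  unfolding monomial_at_def by (rule prod.mono_neutral_left) (auto simp: in_keys_iff)

lemma monomial_at_add: "monomial_at \<alpha> (\<gamma> + \<delta>) = monomial_at \<alpha> \<gamma> * monomial_at \<alpha> \<delta>"
proof -
  let ?S = "keys \<gamma> \<union> keys \<delta>"
  have "keys (\<gamma> + \<delta>) \<subseteq> ?S" by (rule keys_add)
  then show ?thesis
    by (simp add: monomial_at_superset[of ?S] lookup_add power_add prod.distrib)
qed

lemma monomial_at_simps [simp]: "monomial_at \<alpha> 0 = 1" "monomial_at \<alpha> (Poly_Mapping.single j k) = \<alpha> j ^ k"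
  by (auto simp: monomial_at_def)

text \<open>Substitution of \<open>\<alpha> j\<close> for the variable of index \<open>j\<close>.
  For a \<open>bs_fun\<close> these variables are the s_j, and the value is a rational function of
  X.\<close>

definition eval_at :: "(nat \<Rightarrow> nat) \<Rightarrow> 'a::comm_ring_1 mpoly \<Rightarrow> 'a" where
  "eval_at \<alpha> u = (\<Sum>\<gamma>\<in>keys u. lookup u \<gamma> * of_nat (monomial_at \<alpha> \<gamma>))"

lemma eval_at_superset:
  "finite S \<Longrightarrow> keys u \<subseteq> S \<Longrightarrow>
    eval_at \<alpha> u = (\<Sum>\<gamma>\<in>S. lookup u \<gamma> * of_nat (monomial_at \<alpha> \<gamma>))"
  unfolding eval_at_def by (rule sum.mono_neutral_left) (auto simp: in_keys_iff)

lemma eval_at_add [simp]: "eval_at \<alpha> (u + v) = eval_at \<alpha> u + eval_at \<alpha> v"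
proof -
  let ?S = "keys u \<union> keys v"
  have "keys (u + v) \<subseteq> ?S" by (rule keys_add)
  then show ?thesis
    by (simp add: eval_at_superset[of ?S] lookup_add distrib_right sum.distrib)
qed

lemma eval_at_single [simp]: "eval_at \<alpha> (Poly_Mapping.single \<gamma> c) = c * of_nat (monomial_at \<alpha> \<gamma>)"
  by (auto simp: eval_at_def)

lemma eval_at_0 [simp]: "eval_at \<alpha> 0 = 0"
  by (simp add: eval_at_def)

lemma eval_at_mult [simp]: "eval_at \<alpha> (u * v) = eval_at \<alpha> u * eval_at \<alpha> v"
proof (induction u rule: poly_mapping_add_induct)
  case (single \<gamma> c)
  show ?case
    by (induction v rule: poly_mapping_add_induct)
      (auto simp: mult_single monomial_at_add distrib_left)
qed (auto simp: distrib_right)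

lemma eval_at_1 [simp]: "eval_at \<alpha> 1 = 1"
  using eval_at_single[of \<alpha> 0 1] by simp

lemma eval_at_of_nat [simp]: "eval_at \<alpha> (of_nat k) = of_nat k"
  by (induction k) auto

lemma eval_at_diff [simp]: "eval_at \<alpha> (u - v) = eval_at \<alpha> u - eval_at \<alpha> v"
  using eval_at_add[of \<alpha> "u - v" v] by simp

lemma eval_at_sum: "eval_at \<alpha> (sum u I) = (\<Sum>i\<in>I. eval_at \<alpha> (u i))"
  by (induction I rule: infinite_finite_induct) auto

lemma eval_at_prod: "eval_at \<alpha> (prod u I) = (\<Prod>i\<in>I. eval_at \<alpha> (u i))"
  by (induction I rule: infinite_finite_induct) auto

lemma eval_at_map_pderiv: "eval_at \<alpha> (Poly_Mapping.map (pderiv_fract i) u) = pderiv_fract i (eval_at \<alpha> u)"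
proof (induction u rule: poly_mapping_add_induct)
  case zero
  show ?case by (simp add: pderiv_fract_0 map_eq_zero_iff[THEN iffD2])
next
  case (single \<gamma> c)
  show ?case
    by (simp add: map_single_zero pderiv_fract_0 pderiv_fract_mult pderiv_fract_of_nat)
next
  case (add f g)
  then show ?case
    by (simp add: map_add_hom[of "pderiv_fract i", OF pderiv_fract_0 pderiv_fract_add] pderiv_fract_add)
qed

definition gen_power :: "'a::comm_ring_1 list \<Rightarrow> (nat \<Rightarrow> nat) \<Rightarrow> 'a" where
  "gen_power fs \<alpha> = (\<Prod>j<length fs. fs ! j ^ \<alpha> j)"

definition of_scalar :: "complex \<Rightarrow> complex mpoly fract" where
  "of_scalar z = of_mpoly (const_mpoly z)"

lemma bs_const_eq: "bs_const z = const_mpoly (of_scalar z)"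
  by (simp add: bs_const_def of_scalar_def of_mpoly_def)

lemma of_scalar_simps [simp]:
  "of_scalar 0 = 0" "of_scalar 1 = 1" "of_scalar (x + y) = of_scalar x + of_scalar y"
  "of_scalar (x * y) = of_scalar x * of_scalar y"
  by (simp_all add: of_scalar_def single_add mult_single flip: of_mpoly_simps(4) del: of_mpoly_simps(4))

lemma of_scalar_of_nat [simp]: "of_scalar (of_nat k) = of_nat k"
  by (induction k) auto

lemma of_scalar_diff [simp]: "of_scalar (x - y) = of_scalar x - of_scalar y"
  using of_scalar_simps(3)[of "x - y" y] by (simp del: of_scalar_simps(3))

lemma of_scalar_prod: "of_scalar (prod f I) = (\<Prod>i\<in>I. of_scalar (f i))"
  by (induction I rule: infinite_finite_induct) auto

lemma eval_at_bs_const [simp]: "eval_at \<alpha> (bs_const z) = of_scalar z"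
  by (simp add: bs_const_eq)

lemma eval_at_poly_bs_const:
  "eval_at \<alpha> (poly (map_poly bs_const b) x) = of_scalar (poly b z)" if "eval_at \<alpha> x = of_scalar z"
proof (induction b)
  case 0
  show ?case by simp
next
  case (pCons a b)
  have "bs_const 0 = 0" by (simp add: bs_const_eq)
  then show ?case
    using pCons that by (simp add: map_poly_pCons)
qed

text \<open>At a natural number the denominator \<open>fact k\<close> disappears, and the value is 0
  when \<open>k > \<alpha> j\<close>; the latter removes negative powers of the generators.\<close>

lemma eval_at_s_binomial: "eval_at \<alpha> (s_binomial j k) = of_nat (\<alpha> j choose k)"
proof -
  have "eval_at \<alpha> (s_binomial j k) = of_scalar ((1 / fact k) * (\<Prod>l<k. of_nat (\<alpha> j) - of_nat l))"
    by (simp only: s_binomial_def eval_at_mult eval_at_prod eval_at_diff eval_at_bs_const eval_at_single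
        eval_at_of_nat monomial_at_simps power_one_right mult_1 of_scalar_simps of_scalar_diff
        of_scalar_prod of_scalar_of_nat)
  also have "(1 / fact k) * (\<Prod>l<k. of_nat (\<alpha> j) - of_nat l) = (of_nat (\<alpha> j) gchoose k :: complex)"
    by (simp add: gbinomial_prod_rev atLeast0LessThan)
  also have "\<dots> = of_nat (\<alpha> j choose k)"
    by (simp add: binomial_gbinomial)
  finally show ?thesis by simp
qed

context
  fixes fs :: "complex mpoly list" and \<alpha> :: "nat \<Rightarrow> nat"
  assumes nz: "\<And>j. j < length fs \<Longrightarrow> fs ! j \<noteq> 0"
begin

text \<open>The correction term in \<open>pderiv_fs\<close> is the logarithmic derivative of the
  formal power product. At \<alpha> it becomes that of the actual power product, so the twisted
  derivation turns into the ordinary one.\<close>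

lemma eval_at_pderiv_fs:
  "of_mpoly (gen_power fs \<alpha>) * eval_at \<alpha> (pderiv_fs fs i u) =
    pderiv_fract i (of_mpoly (gen_power fs \<alpha>) * eval_at \<alpha> u)"
proof -
  have log: "Fract (pderiv_mpoly i (fs ! j)) (fs ! j) = pderiv_fract i (of_mpoly (fs ! j)) / of_mpoly (fs ! j)"
    if "j < length fs" for j
    unfolding pderiv_of_mpoly by (simp add: of_mpoly_def)
  have "pderiv_fract i (of_mpoly (gen_power fs \<alpha>)) = of_mpoly (gen_power fs \<alpha>) *
      (\<Sum>j<length fs. of_nat (\<alpha> j) * (pderiv_fract i (of_mpoly (fs ! j)) / of_mpoly (fs ! j)))"
    unfolding gen_power_def of_mpoly_prod of_mpoly_power using nz by (intro pderiv_fract_prod_power) auto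
  moreover have "eval_at \<alpha> (\<Sum>j<length fs. X_var j * const_mpoly (Fract (pderiv_mpoly i (fs ! j)) (fs ! j))) =
      (\<Sum>j<length fs. of_nat (\<alpha> j) * (pderiv_fract i (of_mpoly (fs ! j)) / of_mpoly (fs ! j)))"
    unfolding eval_at_sum by (intro sum.cong refl) (simp add: log)
  ultimately show ?thesis
    by (simp add: pderiv_fs_def eval_at_map_pderiv pderiv_fract_mult algebra_simps)
qed

lemma eval_at_multi_pderiv_fs:
  assumes L: "\<And>i g. i < n \<Longrightarrow> g \<in> L \<Longrightarrow> pderiv_mpoly i g \<in> L"
    and u: "of_mpoly (gen_power fs \<alpha>) * eval_at \<alpha> u \<in> of_mpoly ` L"
  shows "of_mpoly (gen_power fs \<alpha>) * eval_at \<alpha> (multi_pderiv_fs n fs \<beta> u) \<in> of_mpoly ` L"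
proof -
  let ?Q = "\<lambda>u. of_mpoly (gen_power fs \<alpha>) * eval_at \<alpha> u \<in> of_mpoly ` L"
  have one: "?Q (pderiv_fs fs i u)" if "i < n" "?Q u" for i u
    using that L unfolding eval_at_pderiv_fs by (auto simp: pderiv_of_mpoly)
  have pow: "?Q ((pderiv_fs fs i ^^ k) u)" if "i < n" "?Q u" for i k u
    using that(2) by (induction k) (simp_all add: one[OF that(1)])
  have "?Q (fold (\<lambda>i. pderiv_fs fs i ^^ lookup \<beta> i) xs u)" if "set xs \<subseteq> {..<n}" "?Q u" for xs u
    using that by (induction xs arbitrary: u) (simp_all add: pow)
  from this[of "[0..<n]" u] show ?thesis
    unfolding multi_pderiv_fs_def using u by (simp add: atLeast0LessThan)
qed

text \<open>Multiplication by \<open>gen_power fs \<alpha>\<close> shifts the exponents of the term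
  to \<alpha> + c. Either some entry is negative and a binomial coefficient is 0, or this is a
  multi-index of degree one higher, since the entries of \<open>c\<close> sum to 1.\<close>

lemma eval_at_bs_term:
  assumes c: "length c = length fs" "sum_list c = 1"
    and L: "\<And>\<alpha>'. (\<Sum>j<length fs. \<alpha>' j) = Suc (\<Sum>j<length fs. \<alpha> j) \<Longrightarrow> gen_power fs \<alpha>' \<in> L"
    and L': "0 \<in> L" "\<And>g k. g \<in> L \<Longrightarrow> of_nat k * g \<in> L"
  shows "of_mpoly (gen_power fs \<alpha>) * eval_at \<alpha> (bs_term fs c) \<in> of_mpoly ` L"
proof -
  let ?N = "{j. j < length fs \<and> c ! j < 0}"
  define M where "M = (\<Prod>j\<in>?N. \<alpha> j choose nat (- (c ! j)))"
  have ev: "eval_at \<alpha> (bs_term fs c) = of_nat M * (\<Prod>j<length fs. power_int (of_mpoly (fs ! j)) (c ! j))"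
    by (simp add: bs_term_def eval_at_prod eval_at_s_binomial M_def of_mpoly_def)
  show ?thesis
  proof (cases "\<exists>j<length fs. int (\<alpha> j) + c ! j < 0")
    case True
    then obtain j where j: "j < length fs" "int (\<alpha> j) + c ! j < 0" by blast
    then have "\<alpha> j < nat (- (c ! j))" "j \<in> ?N" by auto
    then have "M = 0" unfolding M_def by (auto intro!: bexI[of _ j] simp: prod_zero_iff)
    then have "of_mpoly (gen_power fs \<alpha>) * eval_at \<alpha> (bs_term fs c) = of_mpoly 0"
      by (simp add: ev)
    then show ?thesis using L'(1) by blast
  next
    case False
    define \<alpha>' where "\<alpha>' j = nat (int (\<alpha> j) + c ! j)" for j
    have \<alpha>': "int (\<alpha>' j) = int (\<alpha> j) + c ! j" if "j < length fs" for j
    proof -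
      have "0 \<le> int (\<alpha> j) + c ! j" using False that by (meson not_less)
      then show ?thesis by (simp add: \<alpha>'_def)
    qed
    have "int (\<Sum>j<length fs. \<alpha>' j) = (\<Sum>j<length fs. int (\<alpha> j) + c ! j)"
      using \<alpha>' by simp
    also have "\<dots> = int (\<Sum>j<length fs. \<alpha> j) + sum_list c"
      using c(1) by (simp add: sum.distrib sum_list_sum_nth atLeast0LessThan)
    finally have "(\<Sum>j<length fs. \<alpha>' j) = Suc (\<Sum>j<length fs. \<alpha> j)"
      using c(2) by linarith
    then have gL: "gen_power fs \<alpha>' \<in> L" by (rule L)
    have "of_mpoly (fs ! j) ^ \<alpha> j * power_int (of_mpoly (fs ! j)) (c ! j) = of_mpoly (fs ! j) ^ \<alpha>' j"
      if "j < length fs" for j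
    proof -
      have "of_mpoly (fs ! j) ^ \<alpha>' j = power_int (of_mpoly (fs ! j)) (int (\<alpha>' j))" by simp
      also have "\<dots> = power_int (of_mpoly (fs ! j)) (int (\<alpha> j)) * power_int (of_mpoly (fs ! j)) (c ! j)"
        unfolding \<alpha>'[OF that] using nz[OF that] by (subst power_int_add) auto
      finally show ?thesis by simp
    qed
    then have "of_mpoly (gen_power fs \<alpha>) * (\<Prod>j<length fs. power_int (of_mpoly (fs ! j)) (c ! j)) =
        of_mpoly (gen_power fs \<alpha>')"
      by (simp add: gen_power_def of_mpoly_prod flip: prod.distrib)
    then have "of_mpoly (gen_power fs \<alpha>) * eval_at \<alpha> (bs_term fs c) = of_mpoly (of_nat M * gen_power fs \<alpha>')"
      by (simp add: ev algebra_simps)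
    then show ?thesis using L'(2)[OF gL] by blast
  qed
qed

end

text \<open>The product of the denominators, each scaled to have constant coefficient 1. This
  normalization survives every change of the coefficient ring, so that \<open>h\<close> can still be
  cancelled modulo p.\<close>

lemma common_denominator:
  assumes "finite W" "W \<subseteq> regular_at_origin n"
  shows "\<exists>h\<in>mpolys n UNIV. lookup h 0 = 1 \<and>
    (\<forall>w\<in>W. \<exists>g\<in>mpolys n UNIV. of_mpoly h * w = of_mpoly g)"
  using assms
proof induction
  case empty
  show ?case
    using subring_1[OF unital_subring_mpolys[OF unital_subring_UNIV, of n]] by (intro bexI[of _ 1]) auto
next
  case (insert w W)
  note P = unital_subring_mpolys[OF unital_subring_UNIV, of n]
  obtain h where h: "h \<in> mpolys n UNIV" "lookup h 0 = 1"
    "\<And>w. w \<in> W \<Longrightarrow> \<exists>g\<in>mpolys n UNIV. of_mpoly h * w = of_mpoly g"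
    using insert by auto
  obtain g k where gk: "w = Fract g k" "g \<in> mpolys n UNIV" "k \<in> mpolys n UNIV" "lookup k 0 \<noteq> 0"
    using insert.prems by (auto simp: regular_at_origin_def)
  define c where "c = (const_mpoly (1 / lookup k 0) :: complex mpoly)"
  have c: "c \<in> mpolys n UNIV" unfolding c_def by (intro const_in_mpolys) simp
  have "k \<noteq> 0" using gk(4) by auto
  then have kw: "of_mpoly k * w = of_mpoly g" by (simp add: gk(1) of_mpoly_def eq_fract)
  show ?case
  proof (rule bexI[of _ "h * (c * k)"], intro conjI ballI)
    show "h * (c * k) \<in> mpolys n UNIV" by (intro subring_mult[OF P] h c gk)
    show "lookup (h * (c * k)) 0 = 1"
      using gk(4) by (simp add: lookup_mult_zero h(2) c_def)
    fix v assume "v \<in> insert w W"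
    then show "\<exists>g\<in>mpolys n UNIV. of_mpoly (h * (c * k)) * v = of_mpoly g"
    proof
      assume "v = w"
      then have "of_mpoly (h * (c * k)) * v = of_mpoly (h * c * g)"
        using kw by (simp add: mult.assoc)
      moreover have "h * c * g \<in> mpolys n UNIV" by (intro subring_mult[OF P] h c gk)
      ultimately show ?thesis by blast
    next
      assume "v \<in> W"
      then obtain g' where g': "g' \<in> mpolys n UNIV" "of_mpoly h * v = of_mpoly g'" using h(3) by blast
      have "of_mpoly (h * (c * k)) * v = of_mpoly (c * k) * (of_mpoly h * v)"
        by (simp add: algebra_simps)
      also have "\<dots> = of_mpoly (c * k * g')" by (simp add: g'(2))
      finally have "of_mpoly (h * (c * k)) * v = of_mpoly (c * k * g')" .
      moreover have "c * k * g' \<in> mpolys n UNIV" by (intro subring_mult[OF P] c gk g')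
      ultimately show ?thesis by blast
    qed
  qed
qed

text \<open>Closed under all differential operators with coefficients in B[X]. Keeping L abstract
  allows the functional equation to be exploited before p and J are known.\<close>

definition differential_submodule :: "nat \<Rightarrow> 'a::comm_ring_1 set \<Rightarrow> 'a mpoly set \<Rightarrow> bool" where
  "differential_submodule n B L \<longleftrightarrow> 0 \<in> L \<and> (\<forall>x\<in>L. \<forall>y\<in>L. x + y \<in> L) \<and>
     (\<forall>g\<in>mpolys n B. \<forall>x\<in>L. g * x \<in> L) \<and> (\<forall>i<n. \<forall>x\<in>L. pderiv_mpoly i x \<in> L)"

text \<open>
  Specializing \<open>s\<close> at \<open>\<alpha> \<in> \<nat>\<^sup>r\<close> and clearing denominators turns the functional equation into a
  membership that survives every reduction of the coefficients, since the binomial coefficients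
  become natural numbers.
\<close>

proposition local_bs_equation_specialize:
  assumes nz: "set fs \<subseteq> - {0}" and eq: "local_bs_equation n fs b"
  shows "\<exists>E h. finite E \<and> lookup h 0 = 1 \<and>
    (\<forall>B \<alpha> L. unital_subring B \<and> E \<subseteq> B \<longrightarrow> h \<in> mpolys n B \<and>
      (differential_submodule n B L \<and>
       (\<forall>\<alpha>'. (\<Sum>j<length fs. \<alpha>' j) = Suc (\<Sum>j<length fs. \<alpha> j) \<longrightarrow> gen_power fs \<alpha>' \<in> L) \<longrightarrow>
       h * const_mpoly (poly b (of_nat (\<Sum>j<length fs. \<alpha> j))) * gen_power fs \<alpha> \<in> L))"
proof -
  obtain C P where C: "finite C" "\<And>c. c \<in> C \<Longrightarrow> length c = length fs" "\<And>c. c \<in> C \<Longrightarrow> sum_list c = 1"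
    "\<And>c. c \<in> C \<Longrightarrow> P c \<in> local_diffops n (length fs)"
    and eq: "poly (map_poly bs_const b) (\<Sum>j<length fs. X_var j) =
         (\<Sum>c\<in>C. apply_diffop n fs (P c) (bs_term fs c))"
    using eq unfolding local_bs_equation_def by blast
  \<comment> \<open>All coefficients of the operators, as rational functions of X; they are finitely
    many, so one denominator serves for all.\<close>
  define W where "W = (\<Union>c\<in>C. \<Union>\<beta>\<in>keys (P c).
    lookup (lookup (P c) \<beta>) ` keys (lookup (P c) \<beta>))"
  have "finite W" unfolding W_def using C(1) by auto
  have "w \<in> regular_at_origin n" if w: "w \<in> W" for w
  proof -
    obtain c \<beta> \<gamma> where "c \<in> C" "\<beta> \<in> keys (P c)"
      "\<gamma> \<in> keys (lookup (P c) \<beta>)" "w = lookup (lookup (P c) \<beta>) \<gamma>"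
      using w unfolding W_def by auto
    then show ?thesis
      using C(4)[of c] unfolding local_diffops_def mpolys_def by simp
  qed
  then have "W \<subseteq> regular_at_origin n" by (rule subsetI)
  from common_denominator[OF \<open>finite W\<close> this] obtain h where h: "h \<in> mpolys n UNIV" "lookup h 0 = 1"
    "\<forall>w\<in>W. \<exists>g\<in>mpolys n UNIV. of_mpoly h * w = of_mpoly g"
    by (elim bexE conjE) (rule that)
  define num where "num w = (SOME g. g \<in> mpolys n UNIV \<and> of_mpoly h * w = of_mpoly g)" for w
  have num: "num w \<in> mpolys n UNIV \<and> of_mpoly h * w = of_mpoly (num w)" if "w \<in> W" for w
    unfolding num_def using bspec[OF h(3) that] unfolding Bex_def by (rule someI_ex)
  define coeffs :: "complex mpoly \<Rightarrow> complex set" where "coeffs f = lookup f ` keys f" for f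
  have coeffs: "f \<in> mpolys n B" if "f \<in> mpolys n UNIV" "coeffs f \<subseteq> B" for f B
    using that unfolding mpolys_def coeffs_def by fastforce
  \<comment> \<open>Only the coefficients of \<open>h\<close> and of the cleared numerators enter.
    They do not depend on \<alpha> or L, so one subring serves for all p, J and e.\<close>
  define E where "E = coeffs h \<union> (\<Union>w\<in>W. coeffs (num w))"
  have "finite E" using \<open>finite W\<close> by (auto simp: E_def coeffs_def)
  have hB: "h \<in> mpolys n B" if "E \<subseteq> B" for B
    using that by (intro coeffs[OF h(1)]) (simp add: E_def)
  have main: "h * const_mpoly (poly b (of_nat (\<Sum>j<length fs. \<alpha> j))) * gen_power fs \<alpha> \<in> L"
    if B: "unital_subring B" "E \<subseteq> B" and L0: "differential_submodule n B L"
      "\<forall>\<alpha>'. (\<Sum>j<length fs. \<alpha>' j) = Suc (\<Sum>j<length fs. \<alpha> j) \<longrightarrow> gen_power fs \<alpha>' \<in> L"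
    for B \<alpha> L
  proof -
    have L: "0 \<in> L" "\<And>x y. x \<in> L \<Longrightarrow> y \<in> L \<Longrightarrow> x + y \<in> L"
      "\<And>g x. g \<in> mpolys n B \<Longrightarrow> x \<in> L \<Longrightarrow> g * x \<in> L" "\<And>i x. i < n \<Longrightarrow> x \<in> L \<Longrightarrow> pderiv_mpoly i x \<in> L"
      "\<And>\<alpha>'. (\<Sum>j<length fs. \<alpha>' j) = Suc (\<Sum>j<length fs. \<alpha> j) \<Longrightarrow> gen_power fs \<alpha>' \<in> L"
      using L0 unfolding differential_submodule_def by blast+
    have nz': "fs ! j \<noteq> 0" if "j < length fs" for j
      using nz that nth_mem by blast
    note PB = unital_subring_mpolys[OF B(1), of n]
    have sumL: "sum f I \<in> of_mpoly ` L" if "\<And>i. i \<in> I \<Longrightarrow> f i \<in> of_mpoly ` L" for f I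
      using that
    proof (induction I rule: infinite_finite_induct)
      case (insert i I)
      then obtain x y where "x \<in> L" "y \<in> L" "f i = of_mpoly x" "sum f I = of_mpoly y" by blast
      then show ?case using insert L(2) by (auto intro!: image_eqI[of _ _ "x + y"])
    qed (auto intro!: image_eqI[of _ _ 0] L(1))
    let ?F = "of_mpoly (gen_power fs \<alpha>)"
    have summand: "of_mpoly h * (?F * eval_at \<alpha> (lookup (P c) \<beta> * multi_pderiv_fs n fs \<beta> (bs_term fs c))) \<in> of_mpoly ` L"
      if c: "c \<in> C" and \<beta>: "\<beta> \<in> keys (P c)" for c \<beta>
    proof -
      let ?Q = "lookup (P c) \<beta>"
      \<comment> \<open>The operator coefficient at s = \<alpha>, multiplied by \<open>h\<close>: a
        combination of the cleared numerators with natural number coefficients, hence a polynomial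
        over B.\<close>
      define q where "q = (\<Sum>\<gamma>\<in>keys ?Q. num (lookup ?Q \<gamma>) * of_nat (monomial_at \<alpha> \<gamma>))"
      have inW: "lookup ?Q \<gamma> \<in> W" if "\<gamma> \<in> keys ?Q" for \<gamma>
        using c \<beta> that unfolding W_def by blast
      have hq: "of_mpoly h * eval_at \<alpha> ?Q = of_mpoly q"
      proof -
        have "of_mpoly q = (\<Sum>\<gamma>\<in>keys ?Q. of_mpoly (num (lookup ?Q \<gamma>)) * of_nat (monomial_at \<alpha> \<gamma>))"
          unfolding q_def by (induction rule: finite_induct[OF finite_keys[of ?Q]]) auto
        also have "\<dots> = (\<Sum>\<gamma>\<in>keys ?Q. of_mpoly h * lookup ?Q \<gamma> * of_nat (monomial_at \<alpha> \<gamma>))"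
          using inW num by (intro sum.cong refl) auto
        also have "\<dots> = of_mpoly h * eval_at \<alpha> ?Q"
          by (simp add: eval_at_def sum_distrib_left mult.assoc)
        finally show ?thesis ..
      qed
      have qB: "q \<in> mpolys n B"
        unfolding q_def
      proof (intro subring_sum[OF PB] subring_mult[OF PB] subring_of_nat[OF PB])
        fix \<gamma> assume \<gamma>: "\<gamma> \<in> keys ?Q"
        show "num (lookup ?Q \<gamma>) \<in> mpolys n B"
        proof -
          have "coeffs (num (lookup ?Q \<gamma>)) \<subseteq> E"
            unfolding E_def using inW[OF \<gamma>] by (intro le_supI2 UN_upper)
          also note B(2)
          finally show ?thesis
            by (rule coeffs[OF conjunct1[OF num[OF inW[OF \<gamma>]]]])
        qed
      qed
      have "?F * eval_at \<alpha> (multi_pderiv_fs n fs \<beta> (bs_term fs c)) \<in> of_mpoly ` L"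
      proof (rule eval_at_multi_pderiv_fs[OF nz' L(4)])
        show "?F * eval_at \<alpha> (bs_term fs c) \<in> of_mpoly ` L"
          by (rule eval_at_bs_term[OF nz' C(2)[OF c] C(3)[OF c] L(5) L(1) L(3)[OF subring_of_nat[OF PB]]])
      qed
      then obtain g where g: "g \<in> L" "?F * eval_at \<alpha> (multi_pderiv_fs n fs \<beta> (bs_term fs c)) = of_mpoly g"
        by blast
      have "of_mpoly h * (?F * eval_at \<alpha> (?Q * multi_pderiv_fs n fs \<beta> (bs_term fs c))) =
          (of_mpoly h * eval_at \<alpha> ?Q) * (?F * eval_at \<alpha> (multi_pderiv_fs n fs \<beta> (bs_term fs c)))"
        by (simp add: algebra_simps)
      also have "\<dots> = of_mpoly (q * g)" by (simp add: hq g(2))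
      finally show ?thesis using L(3)[OF qB g(1)] by blast
    qed
    have ev: "eval_at \<alpha> (poly (map_poly bs_const b) (\<Sum>j<length fs. X_var j)) =
        of_scalar (poly b (of_nat (\<Sum>j<length fs. \<alpha> j)))"
      by (rule eval_at_poly_bs_const) (simp add: eval_at_sum del: of_nat_sum, simp)
    have "of_mpoly (h * const_mpoly (poly b (of_nat (\<Sum>j<length fs. \<alpha> j))) * gen_power fs \<alpha>) =
        of_mpoly h * (?F * eval_at \<alpha> (poly (map_poly bs_const b) (\<Sum>j<length fs. X_var j)))"
      unfolding ev by (simp add: of_scalar_def algebra_simps)
    also have "\<dots> = (\<Sum>c\<in>C. \<Sum>\<beta>\<in>keys (P c).
        of_mpoly h * (?F * eval_at \<alpha> (lookup (P c) \<beta> * multi_pderiv_fs n fs \<beta> (bs_term fs c))))"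
      unfolding eq by (simp add: eval_at_sum apply_diffop_def sum_distrib_left)
    also have "\<dots> \<in> of_mpoly ` L" by (intro sumL summand)
    finally show ?thesis
      unfolding image_iff of_mpoly_simps(5) by blast
  qed
  show ?thesis
    by (intro exI[of _ E] exI[of _ h] conjI allI impI; (elim conjE)?)
      (rule \<open>finite E\<close> h(2) hB main; assumption)+
qed

subsection \<open>Frobenius powers over a subring of the complex numbers\<close>

text \<open>\<open>D\<close> is a product of denominators of the coefficients. The values of
  \<open>b\<close> at natural numbers are then p-integral for every prime p not dividing
  \<open>D\<close>.\<close>

lemma poly_common_denominator:
  fixes b :: "rat poly"
  shows "\<exists>D::int. D \<noteq> 0 \<and> (\<forall>k::nat. \<exists>z::int. poly b (of_nat k) * of_int D = of_int z)"
proof (induction b)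
  case 0
  show ?case by (intro exI[of _ 1]) (auto intro!: exI[of _ 0])
next
  case (pCons a b)
  then obtain D :: int where D: "D \<noteq> 0" "\<And>k::nat. \<exists>z::int. poly b (of_nat k) * of_int D = of_int z" by blast
  obtain c d where cd: "quotient_of a = (c, d)" by (cases "quotient_of a")
  have d: "d > 0" "a = of_int c / of_int d"
    using quotient_of_denom_pos[OF cd] quotient_of_div[OF cd] by auto
  have "\<exists>z::int. poly (pCons a b) (of_nat k) * of_int (d * D) = of_int z" for k :: nat
  proof -
    obtain z :: int where "poly b (of_nat k) * of_int D = of_int z" using D(2) by blast
    moreover have "poly (pCons a b) (of_nat k) * of_int (d * D) =
        a * of_int d * of_int D + of_nat k * of_int d * (poly b (of_nat k) * of_int D)"
      by (simp add: algebra_simps)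
    moreover have "a * of_int d = of_int c" using d by simp
    ultimately have "poly (pCons a b) (of_nat k) * of_int (d * D) = of_int (c * D + int k * d * z)" by simp
    then show ?thesis by blast
  qed
  then show ?case using D(1) d(1) by (intro exI[of _ "d * D"]) auto
qed

lemma
  fixes M :: "'a::comm_ring_1 set"
  assumes zero: "0 \<in> M" and diff: "\<forall>x\<in>M. \<forall>y\<in>M. x - y \<in> M"
  shows diff_closed_imp_add_closed: "x \<in> M \<Longrightarrow> y \<in> M \<Longrightarrow> x + y \<in> M"
    and diff_closed_imp_of_int_mult_closed: "x \<in> M \<Longrightarrow> of_int k * x \<in> M"
proof -
  show add: "x + y \<in> M" if "x \<in> M" "y \<in> M" for x y
    using diff[rule_format, OF that(1) diff[rule_format, OF zero that(2)]] by simp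
  have nat: "of_nat j * x \<in> M" if "x \<in> M" for j x
    using that by (induction j) (auto simp: distrib_right intro: zero add)
  show "of_int k * x \<in> M" if "x \<in> M"
  proof (cases "k \<ge> 0")
    case True
    then show ?thesis using nat[OF that, of "nat k"] by simp
  next
    case False
    then show ?thesis using diff[rule_format, OF zero nat[OF that, of "nat (- k)"]] by simp
  qed
qed

text \<open>
  A maximal such \<open>M\<close> is the kernel of a \<open>\<int>\<close>-linear map \<open>B \<rightarrow> \<int>/p\<int>\<close> with \<open>1 \<mapsto> 1\<close>, which lets one
  descend from \<open>B\<close> to the prime field.
\<close>

lemma maximal_subgroup_avoiding_1:
  fixes B :: "'a::comm_ring_1 set"
  assumes B: "unital_subring B" and p: "prime p" and ninv: "\<forall>g\<in>B. of_nat p * g \<noteq> 1"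
  shows "\<exists>M\<subseteq>B. (\<forall>x\<in>M. \<forall>y\<in>M. x - y \<in> M) \<and> (\<forall>g\<in>B. of_nat p * g \<in> M) \<and> 1 \<notin> M \<and>
    (\<forall>x\<in>B. \<exists>k. x - of_int k \<in> M)"
proof -
  \<comment> \<open>Additive subgroups between pB and B that omit 1. Ideals would not do: all
    residue fields of B above p may be larger than the prime field, and then no proper ideal has
    every element of B congruent to an integer.\<close>
  define \<A> where "\<A> = {M. M \<subseteq> B \<and> (\<forall>x\<in>M. \<forall>y\<in>M. x - y \<in> M) \<and> (\<forall>g\<in>B. of_nat p * g \<in> M) \<and> 1 \<notin> M}"
  let ?P = "(\<lambda>g. of_nat p * g) ` B"
  have "?P \<subseteq> B" by (auto intro!: subring_intros[OF B])
  moreover have "x - y \<in> ?P" if "x \<in> ?P" "y \<in> ?P" for x y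
    using that subring_diff[OF B] by (auto simp flip: right_diff_distrib)
  moreover have "1 \<notin> ?P" using ninv by force
  ultimately have "?P \<in> \<A>" unfolding \<A>_def by simp
  then have "\<A> \<noteq> {}" by blast
  moreover have "\<Union>\<C> \<in> \<A>" if ne: "\<C> \<noteq> {}" and ch: "subset.chain \<A> \<C>" for \<C>
  proof -
    have sub: "M \<in> \<A>" if "M \<in> \<C>" for M using ch that by (auto simp: subset.chain_def)
    have lin: "M \<subseteq> M' \<or> M' \<subseteq> M" if "M \<in> \<C>" "M' \<in> \<C>" for M M'
      using ch that by (auto simp: subset.chain_def)
    have "x - y \<in> \<Union>\<C>" if "x \<in> M" "M \<in> \<C>" "y \<in> M'" "M' \<in> \<C>" for x y M M'
    proof -
      have "x - y \<in> M \<or> x - y \<in> M'"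
        using lin[OF that(2,4)] sub[OF that(2)] sub[OF that(4)] that(1,3) unfolding \<A>_def by blast
      then show ?thesis using that(2,4) by blast
    qed
    moreover have "M \<subseteq> B" "1 \<notin> M" if "M \<in> \<C>" for M
      using sub[OF that] by (auto simp: \<A>_def)
    then have "\<Union>\<C> \<subseteq> B" "1 \<notin> \<Union>\<C>" by blast+
    moreover have "of_nat p * g \<in> \<Union>\<C>" if "g \<in> B" for g
      using ne sub that by (auto simp: \<A>_def)
    ultimately show ?thesis by (auto simp: \<A>_def)
  qed
  ultimately obtain M where M: "M \<in> \<A>" and max: "\<And>X. X \<in> \<A> \<Longrightarrow> M \<subseteq> X \<Longrightarrow> X = M"
    using subset_Zorn_nonempty[of \<A>] by blast
  have MB: "M \<subseteq> B" and diff0: "\<forall>x\<in>M. \<forall>y\<in>M. x - y \<in> M"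
    and pB: "\<And>g. g \<in> B \<Longrightarrow> of_nat p * g \<in> M" and M1: "1 \<notin> M"
    using M by (auto simp: \<A>_def)
  note diff = diff0[rule_format]
  have M0: "0 \<in> M" using pB[OF subring_0[OF B]] by simp
  note add = diff_closed_imp_add_closed[OF M0 diff0] and mult = diff_closed_imp_of_int_mult_closed[OF M0 diff0]
  have "\<exists>k. x - of_int k \<in> M" if x: "x \<in> B" for x
  proof (cases "x \<in> M")
    case True
    then show ?thesis by (intro exI[of _ 0]) simp
  next
    case False
    \<comment> \<open>M + \<int>x is a strictly larger subgroup, so maximality forces it to contain
      1.\<close>
    define M' where "M' = {y + of_int k * x |y k. y \<in> M}"
    have "M \<subseteq> M'"
    proof
      fix y assume "y \<in> M"
      then show "y \<in> M'"
        unfolding M'_def by (intro CollectI exI[of _ y] exI[of _ 0]) simp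
    qed
    moreover have "x \<in> M'"
      unfolding M'_def using M0 by (intro CollectI exI[of _ 0] exI[of _ 1]) simp
    moreover have "M' \<subseteq> B"
      unfolding M'_def using MB x by (auto intro!: subring_intros[OF B])
    moreover have "y - z \<in> M'" if yz: "y \<in> M'" "z \<in> M'" for y z
    proof -
      obtain y' k z' l where "y' \<in> M" "z' \<in> M" "y = y' + of_int k * x" "z = z' + of_int l * x"
        using yz unfolding M'_def by blast
      then show ?thesis
        unfolding M'_def using diff by (auto intro!: exI[of _ "y' - z'"] exI[of _ "k - l"] simp: algebra_simps)
    qed
    ultimately have "1 \<in> M'"
      using max[of M'] False pB unfolding \<A>_def by blast
    then obtain y k where yk: "y \<in> M" "1 = y + of_int k * x" unfolding M'_def by blast
    have "\<not> int p dvd k"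
    proof
      assume "int p dvd k"
      then obtain j where "k = int p * j" by blast
      then have "of_int k * x = of_nat p * (of_int j * x)" by (simp add: mult.assoc)
      then have "of_int k * x \<in> M" using pB[of "of_int j * x"] x by (simp add: subring_intros[OF B])
      then show False using yk add M1 by metis
    qed
    then have "coprime (int p) k" using p by (simp add: prime_imp_coprime)
    \<comment> \<open>As \<open>of_int k * x\<close> is congruent to 1 modulo M, the inverse
      \<open>c\<close> of \<open>k\<close> modulo p is the integer congruent to
      \<open>x\<close>.\<close>
    then obtain u c where uc: "u * int p + c * k = 1" by (metis bezout_int coprime_imp_gcd_eq_1)
    have "x = of_int (u * int p + c * k) * x" by (simp add: uc)
    also have "\<dots> = of_nat p * (of_int u * x) + of_int c * (of_int k * x)" by (simp add: algebra_simps)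
    also have "of_int k * x = 1 - y" using yk(2) by (simp add: algebra_simps)
    finally have "x - of_int c = of_nat p * (of_int u * x) - of_int c * y" by (simp add: algebra_simps)
    also have "\<dots> \<in> M" using x yk(1) by (intro diff pB mult) (auto intro: subring_intros[OF B])
    finally show ?thesis by blast
  qed
  then show ?thesis using MB diff pB M1 by (intro exI[of _ M]) blast
qed

lemma products_image:
  assumes "h 1 = 1" "\<And>x y. h (x * y) = h x * h y"
  shows "products (h ` G) r = h ` products G r"
proof (induction r)
  case 0
  show ?case using assms(1) by simp
next
  case (Suc r)
  have "products (h ` G) (Suc r) = {x * g |x g. x \<in> h ` products G r \<and> g \<in> h ` G}"
    by (simp only: products.simps Suc)
  also have "\<dots> = h ` products G (Suc r)"
    using assms(2) by (auto simp: image_iff) metis+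
  finally show ?case .
qed

section \<open>Stability of Frobenius powers under derivations\<close>

lemma pderiv_mpoly_power:
  "pderiv_mpoly i (f ^ Suc k) = of_nat (Suc k) * f ^ k * pderiv_mpoly i f"
  by (induction k) (simp_all add: pderiv_mpoly_mult pderiv_mpoly_1 algebra_simps)

text \<open>The analogue of \<open>frob\<close> over B[X]; \<open>Y\<close> will be the image of
  J.\<close>

definition frobenius_span :: "nat \<Rightarrow> complex set \<Rightarrow> nat \<Rightarrow> nat \<Rightarrow> complex mpoly set \<Rightarrow> complex mpoly set" where
  "frobenius_span n B p q Y = span_over (mpolys n B) ({y ^ q |y. y \<in> Y} \<union> {of_nat p})"

text \<open>
  The contraction to \<open>B[X]\<close> of the extension of that ideal to the localization at the origin;
  denominators with constant term \<open>1\<close> suffice.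
\<close>

definition local_frobenius_span :: "nat \<Rightarrow> complex set \<Rightarrow> nat \<Rightarrow> nat \<Rightarrow> complex mpoly set \<Rightarrow> complex mpoly set" where
  "local_frobenius_span n B p q Y = {x \<in> mpolys n B. \<exists>h\<in>mpolys n B.
     lookup h 0 = 1 \<and> h * x \<in> frobenius_span n B p q Y}"

context
  fixes n p q :: nat and B :: "complex set" and Y :: "complex mpoly set"
  assumes B: "unital_subring B" and q: "p dvd q" "q > 0" and Y: "Y \<subseteq> mpolys n B"
begin

abbreviation "FS \<equiv> frobenius_span n B p q Y"
abbreviation "LFS \<equiv> local_frobenius_span n B p q Y"

lemma PB: "unital_subring (mpolys n B)"
  using B by (rule unital_subring_mpolys)

lemma frobenius_span_p: "x \<in> mpolys n B \<Longrightarrow> x * of_nat p \<in> FS"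
  unfolding frobenius_span_def by (rule span_over_mult_gen[OF PB]) auto

lemma frobenius_span_add: "x \<in> FS \<Longrightarrow> y \<in> FS \<Longrightarrow> x + y \<in> FS"
  unfolding frobenius_span_def by (rule span_over_add)

lemma frobenius_span_diff: "x \<in> FS \<Longrightarrow> y \<in> FS \<Longrightarrow> x - y \<in> FS"
  unfolding frobenius_span_def by (rule span_over_diff[OF PB])

lemma frobenius_span_mult: "g \<in> mpolys n B \<Longrightarrow> x \<in> FS \<Longrightarrow> g * x \<in> FS"
  unfolding frobenius_span_def by (rule span_over_mult[OF PB])

text \<open>By the Leibniz rule it suffices that the derivative of each generator lies in
  pB[X].\<close>

lemma pderiv_frobenius_span:
  assumes "x \<in> FS"
  shows "pderiv_mpoly i x \<in> FS"
proof -
  let ?K = "{x. pderiv_mpoly i x \<in> FS}"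
  have "x \<in> ?K"
  proof (rule span_over_least[OF assms[unfolded frobenius_span_def]])
    show "0 \<in> ?K" by (simp add: frobenius_span_def span_over.zero)
    show "x + y \<in> ?K" if "x \<in> ?K" "y \<in> ?K" for x y
      using that by (simp add: pderiv_mpoly_add frobenius_span_add)
    fix c g assume c: "c \<in> mpolys n B" and g: "g \<in> {y ^ q |y. y \<in> Y} \<union> {of_nat p}"
    have dc: "pderiv_mpoly i c \<in> mpolys n B" by (rule pderiv_in_mpolys[OF B c])
    have gI: "g \<in> FS"
      unfolding frobenius_span_def using g by (rule span_over_superset[OF PB])
    have "\<exists>d\<in>mpolys n B. pderiv_mpoly i g = d * of_nat p"
      using g
    proof
      assume "g \<in> {y ^ q |y. y \<in> Y}"
      then obtain y where y: "y \<in> Y" "g = y ^ q" by blast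
      \<comment> \<open>Here \<open>p dvd q\<close> enters, that is, e \<ge> 1: the derivative of
        \<open>y ^ q\<close> carries the factor q.\<close>
      obtain k where k: "q = p * k" using q(1) by blast
      obtain j where j: "q = Suc j" using q(2) gr0_conv_Suc by blast
      have "pderiv_mpoly i g = of_nat k * y ^ j * pderiv_mpoly i y * of_nat p"
        unfolding y(2) by (subst j, subst pderiv_mpoly_power) (simp only: j[symmetric] k of_nat_mult ac_simps)
      moreover have "of_nat k * y ^ j * pderiv_mpoly i y \<in> mpolys n B"
        using y(1) Y by (intro subring_intros[OF PB] pderiv_in_mpolys[OF B]) auto
      ultimately show ?thesis by blast
    next
      assume "g \<in> {of_nat p}"
      then have "pderiv_mpoly i g = 0 * of_nat p"
        by (simp add: pderiv_mpoly_single flip: single_of_nat)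
      then show ?thesis using subring_0[OF PB] by blast
    qed
    then obtain d where d: "d \<in> mpolys n B" "pderiv_mpoly i g = d * of_nat p" by blast
    have "pderiv_mpoly i (c * g) = pderiv_mpoly i c * g + (c * d) * of_nat p"
      by (simp add: pderiv_mpoly_mult d(2) mult.assoc)
    also have "\<dots> \<in> FS"
      by (intro frobenius_span_add frobenius_span_mult[OF dc gI] frobenius_span_p subring_mult[OF PB] c d)
    finally show "c * g \<in> ?K" by simp
  qed
  then show ?thesis by simp
qed

lemma local_frobenius_spanI:
  "x \<in> mpolys n B \<Longrightarrow> h \<in> mpolys n B \<Longrightarrow> lookup h 0 = 1 \<Longrightarrow> h * x \<in> FS
    \<Longrightarrow> x \<in> LFS"
  by (auto simp: local_frobenius_span_def)

lemma local_frobenius_spanE: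
  assumes "x \<in> LFS"
  obtains h where "x \<in> mpolys n B" "h \<in> mpolys n B" "lookup h 0 = 1" "h * x \<in> FS"
  using assms by (auto simp: local_frobenius_span_def)

lemma frobenius_span_subset_local:
  assumes "x \<in> FS"
  shows "x \<in> LFS"
proof (rule local_frobenius_spanI[of _ 1])
  have "{y ^ q |y. y \<in> Y} \<union> {of_nat p} \<subseteq> mpolys n B"
    using Y by (auto intro: subring_intros[OF PB])
  from span_over_subset[OF PB this] show "x \<in> mpolys n B"
    using assms unfolding frobenius_span_def by blast
qed (use assms subring_1[OF PB] in auto)

lemma local_frobenius_span_0: "0 \<in> LFS"
  by (rule frobenius_span_subset_local) (simp add: frobenius_span_def span_over.zero)

lemma local_frobenius_span_add:
  assumes "x \<in> LFS" "y \<in> LFS"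
  shows "x + y \<in> LFS"
proof -
  obtain h where h: "x \<in> mpolys n B" "h \<in> mpolys n B" "lookup h 0 = 1" "h * x \<in> FS"
    using assms(1) by (rule local_frobenius_spanE)
  obtain k where k: "y \<in> mpolys n B" "k \<in> mpolys n B" "lookup k 0 = 1" "k * y \<in> FS"
    using assms(2) by (rule local_frobenius_spanE)
  have "h * k * (x + y) = k * (h * x) + h * (k * y)" by (simp add: algebra_simps)
  also have "\<dots> \<in> FS"
    by (intro frobenius_span_add frobenius_span_mult h k)
  finally show ?thesis
    using h k by (intro local_frobenius_spanI[of _ "h * k"] subring_add[OF PB] subring_mult[OF PB])
      (auto simp: lookup_mult_zero)
qed

lemma local_frobenius_span_mult:
  assumes g: "g \<in> mpolys n B" and x: "x \<in> LFS"
  shows "g * x \<in> LFS"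
proof -
  obtain h where h: "x \<in> mpolys n B" "h \<in> mpolys n B" "lookup h 0 = 1" "h * x \<in> FS"
    using x by (rule local_frobenius_spanE)
  then show ?thesis
    using frobenius_span_mult[OF g h(4)] g
    by (intro local_frobenius_spanI[of _ h] subring_mult[OF PB]) (auto simp: mult.left_commute)
qed

text \<open>Quotient rule: differentiating x = (h x) / h leads to the denominator
  \<open>h * h\<close>, whose constant coefficient is again 1.\<close>

lemma local_frobenius_span_pderiv:
  assumes "x \<in> LFS"
  shows "pderiv_mpoly i x \<in> LFS"
proof -
  obtain h where h: "x \<in> mpolys n B" "h \<in> mpolys n B" "lookup h 0 = 1" "h * x \<in> FS"
    using assms by (rule local_frobenius_spanE)
  have "h * h * pderiv_mpoly i x = h * pderiv_mpoly i (h * x) - pderiv_mpoly i h * (h * x)"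
    by (simp add: pderiv_mpoly_mult algebra_simps)
  also have "\<dots> \<in> FS"
    by (intro frobenius_span_diff frobenius_span_mult pderiv_frobenius_span h pderiv_in_mpolys[OF B])
  finally show ?thesis
    using h by (intro local_frobenius_spanI[of _ "h * h"] subring_mult[OF PB] pderiv_in_mpolys[OF B])
      (auto simp: lookup_mult_zero)
qed

lemma differential_submodule_LFS: "differential_submodule n B LFS"
  unfolding differential_submodule_def
  by (intro conjI ballI allI impI)
    (rule local_frobenius_span_0 local_frobenius_span_add local_frobenius_span_mult local_frobenius_span_pderiv | assumption)+

lemma local_frobenius_span_cancel:
  assumes x: "x \<in> mpolys n B" and h: "h \<in> mpolys n B" "lookup h 0 = 1"
    and hx: "h * x \<in> LFS"
  shows "x \<in> LFS"
proof -
  obtain k where k: "k \<in> mpolys n B" "lookup k 0 = 1" "k * (h * x) \<in> FS"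
    using hx by (rule local_frobenius_spanE)
  then show ?thesis
    using x h by (intro local_frobenius_spanI[of _ "k * h"] subring_mult[OF PB])
      (auto simp: lookup_mult_zero mult.assoc)
qed

lemma span_over_subset_local_frobenius_span:
  assumes "x \<in> span_over (mpolys n B) G" "G \<subseteq> LFS"
  shows "x \<in> LFS"
  by (rule span_over_least[OF assms(1)])
    (use assms(2) in \<open>auto intro: local_frobenius_span_0 local_frobenius_span_add local_frobenius_span_mult\<close>)

end

section \<open>Descent from B to A, and the meaning of \<open>nu\<close>\<close>

context mod_p_reduction
begin

lemma of_rat_A_subset:
  fixes B :: "'a::field_char_0 set"
  assumes B: "unital_subring B" and mB: "1 / of_int m \<in> B"
  shows "of_rat ` A \<subseteq> B"
proof
  fix x :: 'a assume "x \<in> of_rat ` A"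
  then obtain y where "y \<in> A" "x = of_rat y" by (rule imageE)
  then obtain a k where "x = of_rat (of_int a / of_int m ^ k)"
    using A_mem[of y] by metis
  then have "x = of_int a * (1 / of_int m) ^ k"
    by (simp add: of_rat_divide of_rat_power power_divide)
  also have "\<dots> \<in> B"
    by (intro subring_intros[OF B] mB)
  finally show "x \<in> B" .
qed

text \<open>The functional with kernel M need not be multiplicative, but M is stable under
  multiplication by A. So polynomials with coefficients in M form a module over A[X], and modulo
  this module a factor from B[X] can be replaced by one from A[X] whenever the other factor has
  coefficients in A. This covers the q-th powers from J and \<open>x\<close> itself.\<close>

lemma frob_descent:
  assumes B: "unital_subring B" and mB: "1 / of_int m \<in> B"
    and ninv: "\<forall>g\<in>B. of_nat p * g \<noteq> 1"
    and J: "J \<subseteq> Z" and x: "x \<in> Z"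
    and h: "h \<in> mpolys n B" "lookup h 0 = 1"
    and hx: "h * of_rat_mpoly x \<in> frobenius_span n B p q (of_rat_mpoly ` J)"
  shows "\<exists>v\<in>Z. lookup v 0 = 1 \<and> v * x \<in> frob J q"
proof -
  from maximal_subgroup_avoiding_1[OF B p ninv]
  obtain M where MB: "M \<subseteq> B" and M: "\<forall>x\<in>M. \<forall>y\<in>M. x - y \<in> M" "\<forall>g\<in>B. of_nat p * g \<in> M"
    and M1: "1 \<notin> M" and Mk: "\<forall>x\<in>B. \<exists>k. x - of_int k \<in> M"
    by (elim exE conjE) (rule that)
  note diff = M(1)[rule_format] and pB = M(2)[rule_format] and Mk = Mk[rule_format]
  have M0: "0 \<in> M" using pB[OF subring_0[OF B]] by simp
  note add = diff_closed_imp_add_closed[OF M0 M(1)] and mult_int = diff_closed_imp_of_int_mult_closed[OF M0 M(1)]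
  note AB = of_rat_A_subset[OF B mB]
  \<comment> \<open>Integers prime to p act invertibly on B/M. This extends the stability of M from
    \<int> to A, whose denominators are powers of m.\<close>
  have cancel: "x \<in> M" if "x \<in> B" "of_int d * x \<in> M" "\<not> int p dvd d" for x d
  proof -
    have "coprime (int p) d" using p that(3) by (simp add: prime_imp_coprime)
    then obtain u c where uc: "u * int p + c * d = 1" by (metis bezout_int coprime_imp_gcd_eq_1)
    have "x = of_int (u * int p + c * d) * x" by (simp add: uc)
    also have "\<dots> = of_nat p * (of_int u * x) + of_int c * (of_int d * x)" by (simp add: algebra_simps)
    also have "\<dots> \<in> M"
      by (intro add mult_int pB subring_mult[OF B] subring_of_int[OF B] that(1,2))
    finally show ?thesis .
  qed
  have m0': "(of_int m :: complex) \<noteq> 0" using m0 by simp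
  have mult_A: "of_rat a * x \<in> M" if a: "a \<in> A" and x: "x \<in> M" for a x
  proof -
    obtain z k where z: "a = of_int z / of_int m ^ k" using A_mem[OF a] by blast
    have aB: "of_rat a \<in> B" using AB a by blast
    then have axB: "of_rat a * x \<in> B" using x MB by (auto intro: subring_intros[OF B])
    have "of_int (m ^ k) * (of_rat a * x) = of_int z * x"
      using m0' by (simp add: z of_rat_divide of_rat_power)
    then have "of_int (m ^ k) * (of_rat a * x) \<in> M" using mult_int[OF x] by (simp only:)
    then show ?thesis by (rule cancel[OF axB _ p_not_dvd_pow])
  qed
  \<comment> \<open>M meets A only in pA: an integer prime to p in M would bring 1 into M.\<close>
  have M_A: "a \<in> pA" if a: "a \<in> A" "of_rat a \<in> M" for a
  proof -
    obtain z k where z: "a = of_int z / of_int m ^ k" using A_mem[OF a(1)] by blast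
    have "of_int (m ^ k) * of_rat a = (of_int z :: complex)"
      using m0' by (simp add: z of_rat_divide of_rat_power)
    then have "of_int z * 1 \<in> M" using mult_int[OF a(2), of "m ^ k"] by simp
    then have "int p dvd z" using cancel[of 1 z] M1 subring_1[OF B] by blast
    then show ?thesis unfolding z by (simp add: of_int_in_pA_iff)
  qed
  let ?PB = "mpolys n B"
  note PB = unital_subring_mpolys[OF B, of n]
  define MX where "MX = mpolys n M"
  have MX_iff: "f \<in> MX \<longleftrightarrow> (\<forall>u. lookup f u \<in> M) \<and> (\<forall>u. lookup f u \<noteq> 0 \<longrightarrow> keys u \<subseteq> {..<n})" for f
    unfolding MX_def by (rule mpolys_iff[OF M0])
  have MX_diff: "f - g \<in> MX" if "f \<in> MX" "g \<in> MX" for f g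
    using that diff unfolding MX_iff lookup_minus by (metis diff_self)
  have MX_0: "0 \<in> MX" by (simp add: MX_iff M0)
  have MX_add: "f + g \<in> MX" if "f \<in> MX" "g \<in> MX" for f g
    using MX_diff[OF that(1) MX_diff[OF MX_0 that(2)]] by simp
  have MX_sum: "sum f I \<in> MX" if "\<And>i. i \<in> I \<Longrightarrow> f i \<in> MX" for f :: "(nat \<Rightarrow>\<^sub>0 nat) \<Rightarrow> _" and I
    using that by (induction I rule: infinite_finite_induct) (auto intro: MX_0 MX_add)
  have MX_mult: "of_rat_mpoly g * f \<in> MX" if g: "g \<in> Z" and f: "f \<in> MX" for g f
  proof -
    have "of_rat_mpoly g * f = (\<Sum>u\<in>keys (of_rat_mpoly g). \<Sum>v\<in>keys f.
        Poly_Mapping.single (u + v) (of_rat (lookup g u) * lookup f v))"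
      using mult_eq_sum_single[of "of_rat_mpoly g" f] by simp
    also have "\<dots> \<in> MX"
    proof (intro MX_sum, unfold MX_def, rule single_in_mpolys)
      fix u v assume uv: "u \<in> keys (of_rat_mpoly g)" "v \<in> keys f"
      show "of_rat (lookup g u) * lookup f v \<in> M"
        using f by (intro mult_A lookup_in_A g) (simp add: MX_iff)
      have "lookup g u \<noteq> 0" using uv(1) by (simp add: in_keys_iff)
      then have "keys u \<subseteq> {..<n}" using g by (simp add: mpolys_iff subring_0[OF A])
      moreover have "keys v \<subseteq> {..<n}" using f uv(2) by (simp add: MX_def mpolys_def)
      ultimately show "keys (u + v) \<subseteq> {..<n}" using keys_add[of u v] by blast
    qed
    finally show ?thesis .
  qed
  have lift: "\<exists>c'\<in>Z. c - of_rat_mpoly c' \<in> MX" if c: "c \<in> ?PB" for c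
  proof -
    obtain k where k: "\<And>x. x \<in> B \<Longrightarrow> x - of_int (k x) \<in> M" using Mk by metis
    define c' where "c' = of_int_mpoly (Poly_Mapping.map k c)"
    \<comment> \<open>\<open>Poly_Mapping.map\<close> applies \<open>k\<close> to nonzero
      coefficients only; the integer \<open>k 0\<close> itself may be nonzero.\<close>
    have look: "lookup (Poly_Mapping.map k c) u = (if lookup c u = 0 then 0 else k (lookup c u))" for u
      by (simp add: Poly_Mapping.map.rep_eq when_def)
    have cB: "lookup c u \<in> B" "lookup c u \<noteq> 0 \<Longrightarrow> keys u \<subseteq> {..<n}" for u
      using c by (auto simp: mpolys_iff[OF subring_0[OF B]])
    have "Poly_Mapping.map k c \<in> mpolys n UNIV"
      using cB(2) by (auto simp: mpolys_iff look split: if_splits)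
    then have "c' \<in> Z" unfolding c'_def by (rule of_int_mpoly_in_mpolys[OF _ A])
    moreover have "c - of_rat_mpoly c' \<in> MX"
      using k[OF cB(1)] M0 cB(2) unfolding MX_iff
      by (auto simp: lookup_minus c'_def look split: if_splits)
    ultimately show ?thesis by blast
  qed
  let ?K = "{f. \<exists>g\<in>frob J q. f - of_rat_mpoly g \<in> MX}"
  have "h * of_rat_mpoly x \<in> ?K"
  proof (rule span_over_least[OF hx[unfolded frobenius_span_def]])
    show "0 \<in> ?K" using MX_0 by (auto intro!: bexI[of _ 0] span_over.zero)
    show "f + g \<in> ?K" if fg: "f \<in> ?K" "g \<in> ?K" for f g
    proof -
      obtain f' g' where *: "f' \<in> frob J q" "f - of_rat_mpoly f' \<in> MX" "g' \<in> frob J q" "g - of_rat_mpoly g' \<in> MX"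
        using fg by blast
      have "f + g - of_rat_mpoly (f' + g') = (f - of_rat_mpoly f') + (g - of_rat_mpoly g')" by simp
      also have "\<dots> \<in> MX" by (intro MX_add *)
      finally show ?thesis using span_over_add[OF *(1,3)] by blast
    qed
    fix c g assume c: "c \<in> ?PB" and g: "g \<in> {y ^ q |y. y \<in> of_rat_mpoly ` J} \<union> {of_nat p}"
    from g show "c * g \<in> ?K"
    proof
      assume "g \<in> {y ^ q |y. y \<in> of_rat_mpoly ` J}"
      then obtain y where y: "y \<in> J" "g = of_rat_mpoly (y ^ q)" by auto
      obtain c' where c': "c' \<in> Z" "c - of_rat_mpoly c' \<in> MX" using lift[OF c] by blast
      \<comment> \<open>Only the multiplier \<open>c\<close> has to be approximated, since
        \<open>y ^ q\<close> already has coefficients in A.\<close>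
      have "c * g - of_rat_mpoly (c' * y ^ q) = of_rat_mpoly (y ^ q) * (c - of_rat_mpoly c')"
        by (simp add: y(2) algebra_simps)
      also have "\<dots> \<in> MX"
        using y(1) J by (intro MX_mult c' subring_power[OF Z]) auto
      finally have "c * g - of_rat_mpoly (c' * y ^ q) \<in> MX" .
      moreover have "c' * y ^ q \<in> frob J q"
        using y(1) by (intro span_over_mult_gen[OF Z] c') auto
      ultimately show ?thesis by blast
    next
      assume "g \<in> {of_nat p}"
      then have "c * g - of_rat_mpoly 0 \<in> MX"
        using pB c by (auto simp: MX_iff mpolys_iff[OF subring_0[OF B]] mult.commute[of c] lookup_of_nat_mult)
      then show ?thesis using span_over.zero by blast
    qed
  qed
  then obtain g where g: "g \<in> frob J q" "h * of_rat_mpoly x - of_rat_mpoly g \<in> MX" by blast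
  obtain h' where h': "h' \<in> Z" "h - of_rat_mpoly h' \<in> MX" using lift[OF h(1)] by blast
  have gZ: "g \<in> Z" using g(1) span_over_subset[OF Z frob_subset[OF J]] by blast
  have "of_rat_mpoly (h' * x - g) = (h * of_rat_mpoly x - of_rat_mpoly g) - of_rat_mpoly x * (h - of_rat_mpoly h')"
    by (simp add: algebra_simps)
  also have "\<dots> \<in> MX" by (intro MX_diff g MX_mult x h')
  finally have "of_rat_mpoly (h' * x - g) \<in> MX" .
  then have "of_rat (lookup (h' * x - g) u) \<in> M" for u
    unfolding MX_iff of_rat_mpoly_simps(5) by blast
  moreover have dZ: "h' * x - g \<in> Z" using h' x gZ by (intro subring_intros[OF Z])
  ultimately have "h' * x - g \<in> pZ"
    using M_A lookup_in_A[OF dZ] unfolding pZ_iff[OF dZ] by blast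
  then have "(h' * x - g) + g \<in> frob J q"
    using g(1) pZ_subset_frob by (intro span_over_add) auto
  then have hx': "h' * x \<in> frob J q" by simp
  \<comment> \<open>The constant coefficient of \<open>h'\<close> is congruent to 1 modulo M; were
    it in pA, it would lie in M, and so would 1.\<close>
  have "h' \<in> units0"
  proof -
    have "lookup (h - of_rat_mpoly h') 0 \<in> M" using h'(2) unfolding MX_iff by blast
    then have *: "1 - of_rat (lookup h' 0) \<in> M" using h(2) by (simp add: lookup_minus)
    have "lookup h' 0 \<notin> pA"
    proof
      assume "lookup h' 0 \<in> pA"
      then obtain y where "y \<in> A" "lookup h' 0 = of_nat p * y" unfolding pA_def by blast
      then have "of_rat (lookup h' 0) \<in> M" using pB[of "of_rat y"] AB by (simp add: of_rat_mult image_subset_iff)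
      from add[OF * this] M1 show False by simp
    qed
    then show ?thesis using h'(1) by (simp add: units0_def)
  qed
  then show ?thesis using units0_normalize[OF _ hx' x] by blast
qed

lemma vars_ideal_lookup_0: "f \<in> vars_ideal n (mpoly_ring n A) \<Longrightarrow> lookup f 0 = 0"
proof -
  assume "f \<in> vars_ideal n (mpoly_ring n A)"
  moreover have "X_var ` {..<n} \<subseteq> Z"
    using X_var_in_mpolys[OF subring_1[OF A]] by auto
  ultimately have f: "f \<in> span_over Z (X_var ` {..<n})"
    unfolding vars_ideal_def mpoly_ring_eq_set_ring by (simp only: genideal_set_ring[OF Z])
  have "lookup (Poly_Mapping.single i 1) i \<noteq> (0::nat)" for i :: nat by simp
  then have ne: "Poly_Mapping.single i (1::nat) \<noteq> 0" for i :: nat by (metis lookup_zero)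
  have "f \<in> {f. lookup f 0 = 0}"
    by (rule span_over_least[OF f]) (auto simp: lookup_add lookup_mult_zero lookup_single when_def ne[simplified])
  then show ?thesis by simp
qed

definition power_in_frob :: "rat mpoly set \<Rightarrow> rat mpoly set \<Rightarrow> nat \<Rightarrow> nat \<Rightarrow> bool" where
  "power_in_frob I J q r \<longleftrightarrow>
     (\<forall>x\<in>products I r. \<exists>v\<in>Z. lookup v 0 = 1 \<and> v * x \<in> frob J q)"

text \<open>The set below is finite and contains \<open>0\<close>, so its \<open>Max\<close> is not a junk value.\<close>

lemma nu_characterization:
  assumes \<aa>: "\<aa> \<subseteq> Z" and J: "ideal J (set_ring Z)"
    and Jv: "\<And>y. y \<in> J \<Longrightarrow> lookup y 0 = 0"
    and rad: "\<And>g. g \<in> \<aa> \<Longrightarrow> \<exists>k. g ^ k \<in> J"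
    and G: "finite G" "G \<subseteq> \<aa>"
    and N: "N \<in> A" "N \<notin> pA" "\<And>f. f \<in> \<aa> \<Longrightarrow> \<exists>k. const_mpoly N ^ k * f \<in> span_over Z G"
    and q: "q > 0"
  defines "\<nu> \<equiv> Max {r. \<not> extend_Fp p n \<aa> [^]\<^bsub>ideals_set R\<^esub> r \<subseteq> frobenius_power R (extend_Fp p n J) q}"
  shows "\<not> power_in_frob \<aa> J q \<nu>" "power_in_frob \<aa> J q (Suc \<nu>)"
proof -
  note D = ideal_set_ringD[OF Z J]
  have \<nu>: "\<nu> = Max {r. \<not> power_in_frob \<aa> J q r}"
    unfolding \<nu>_def power_in_frob_def power_subset_frobenius_power_iff[OF \<aa> J] ..
  \<comment> \<open>Elements of J have no constant term, so constant coefficients in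
    \<open>frob J q\<close> lie in pA and none of them is 1. The empty product thus puts 0 into the
    set.\<close>
  have "\<not> power_in_frob \<aa> J q 0"
  proof
    assume "power_in_frob \<aa> J q 0"
    then obtain v where v: "lookup v 0 = 1" "v \<in> frob J q"
      by (auto simp: power_in_frob_def)
    have "v \<in> {f \<in> Z. lookup f 0 \<in> pA}"
    proof (rule span_over_least[OF v(2)])
      show "0 \<in> {f \<in> Z. lookup f 0 \<in> pA}" using pA_0 subring_0[OF Z] by simp
      show "f + g \<in> {f \<in> Z. lookup f 0 \<in> pA}"
        if "f \<in> {f \<in> Z. lookup f 0 \<in> pA}" "g \<in> {f \<in> Z. lookup f 0 \<in> pA}" for f g
        using that pA_diff[OF _ pA_diff[OF pA_0], of "lookup f 0" "lookup g 0"]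
        by (simp add: lookup_add subring_add[OF Z])
      fix c g assume c: "c \<in> Z" and g: "g \<in> {y ^ q |y. y \<in> J} \<union> {of_nat p}"
      have "lookup g 0 = of_nat p * (if g = of_nat p then 1 else 0)"
        using g
      proof
        assume "g \<in> {y ^ q |y. y \<in> J}"
        then have "lookup g 0 = 0" using Jv q by (auto simp: lookup_power_zero)
        then show ?thesis using prime_gt_0_nat[OF p] by (auto simp: lookup_of_nat)
      qed (simp add: lookup_of_nat)
      then have "lookup (c * g) 0 = of_nat p * (lookup c 0 * (if g = of_nat p then 1 else 0))"
        by (simp add: lookup_mult_zero mult.left_commute)
      moreover have "lookup c 0 * (if g = of_nat p then 1 else 0) \<in> A"
        using lookup_in_A[OF c] subring_0[OF A] by simp
      ultimately have "lookup (c * g) 0 \<in> pA" unfolding pA_def by blast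
      moreover have "g \<in> Z" using g frob_subset[OF D(1)] by blast
      ultimately show "c * g \<in> {f \<in> Z. lookup f 0 \<in> pA}"
        using c by (simp add: subring_mult[OF Z])
    qed
    then show False using v(1) of_int_in_pA_iff'[of 1] prime_gt_1_nat[OF p] by simp
  qed
  moreover have "finite {r. \<not> power_in_frob \<aa> J q r}"
  proof -
    have GZ: "G \<subseteq> Z" using G \<aa> by blast
    have "\<forall>g\<in>G. \<exists>k. g ^ k \<in> J" using rad G by blast
    then obtain k where k: "\<forall>g\<in>G. g ^ k g \<in> J" by metis
    \<comment> \<open>One exponent for all of \<open>G\<close>: the first factor is at least every
      \<open>k g\<close>, and the factor q makes \<open>g ^ t\<close> the q-th power of an element
      of J.\<close>
    define t where "t = Suc (\<Sum>g\<in>G. k g) * q"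
    have gt: "g ^ t \<in> frob J q" if g: "g \<in> G" for g
    proof -
      have "k g \<le> (\<Sum>g\<in>G. k g)" using G(1) g by (intro member_le_sum) auto
      then have "g ^ Suc (\<Sum>g\<in>G. k g) = g ^ (Suc (\<Sum>g\<in>G. k g) - k g) * g ^ k g"
        by (simp flip: power_add)
      moreover have "g ^ (Suc (\<Sum>g\<in>G. k g) - k g) \<in> Z"
        using g GZ by (intro subring_power[OF Z]) auto
      ultimately have "g ^ Suc (\<Sum>g\<in>G. k g) \<in> J" using D(4) k g by simp
      then show ?thesis
        unfolding t_def power_mult by (intro span_over_superset[OF Z]) auto
    qed
    have "power_in_frob \<aa> J q r" if r: "r \<ge> Suc (card G * t)" for r
      unfolding power_in_frob_def
    proof
      fix x assume x: "x \<in> products \<aa> r"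
      have prG: "products G r \<subseteq> frob J q"
        using r by (intro products_subset_if_powers[OF Z G(1) GZ gt]) (auto intro: span_over_mult[OF Z])
      have xZ: "x \<in> Z" using x products_subset[OF Z \<aa>] by blast
      have CN: "const_mpoly N \<in> Z" by (intro const_in_mpolys N)
      \<comment> \<open>Elements of \<aa> are spanned by \<open>G\<close> only after multiplication
        by powers of \<open>N\<close>; the exponents add up along a product.\<close>
      have "\<exists>K. const_mpoly N ^ K * x \<in> span_over Z (products G r)"
        using x
      proof (induction r arbitrary: x)
        case 0
        then show ?case by (intro exI[of _ 0]) (auto intro!: span_over_superset[OF Z])
      next
        case (Suc r)
        then obtain y g where y: "y \<in> products \<aa> r" "g \<in> \<aa>" "x = y * g" by auto
        obtain K L where KL: "const_mpoly N ^ K * y \<in> span_over Z (products G r)" "const_mpoly N ^ L * g \<in> span_over Z G"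
          using Suc.IH[OF y(1)] N(3)[OF y(2)] by blast
        have "const_mpoly N ^ (K + L) * x = (const_mpoly N ^ K * y) * (const_mpoly N ^ L * g)"
          by (simp add: y(3) power_add algebra_simps)
        also have "\<dots> \<in> span_over Z (products G (Suc r))"
          by (rule span_over_product[OF Z KL]) auto
        finally show ?case by blast
      qed
      then obtain K where K: "const_mpoly N ^ K * x \<in> frob J q"
        using span_over_trans[OF Z _ prG] by blast
      have "lookup (const_mpoly N ^ K) 0 \<notin> pA"
      proof (induction K)
        case 0
        show ?case using units0_1 by (simp add: units0_def)
      next
        case (Suc K)
        have "lookup (const_mpoly N ^ K) 0 \<in> A"
          by (intro lookup_in_A subring_power[OF Z] CN)
        then show ?case using Suc pA_prime N by (auto simp: lookup_mult_zero)
      qed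
      then have "const_mpoly N ^ K \<in> units0" by (simp add: units0_def subring_power[OF Z] CN)
      then show "\<exists>v\<in>Z. lookup v 0 = 1 \<and> v * x \<in> frob J q"
        using units0_normalize[OF _ K xZ] by blast
    qed
    then have "{r. \<not> power_in_frob \<aa> J q r} \<subseteq> {..<Suc (card G * t)}" by (auto simp: not_less[symmetric])
    then show ?thesis by (rule finite_subset) simp
  qed
  ultimately have *: "\<nu> \<in> {r. \<not> power_in_frob \<aa> J q r}" "\<And>r. r \<in> {r. \<not> power_in_frob \<aa> J q r} \<Longrightarrow> r \<le> \<nu>"
    unfolding \<nu> using Max_in[of "{r. \<not> power_in_frob \<aa> J q r}"] Max_ge by blast+
  then show "\<not> power_in_frob \<aa> J q \<nu>" by simp
  show "power_in_frob \<aa> J q (Suc \<nu>)" using *(2)[of "Suc \<nu>"] by auto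
qed

end

section \<open>Choice of the bound and the contradiction modulo p\<close>

theorem proposition3p11:
  fixes m :: int and n :: nat and \<aa> :: "rat mpoly set" and b :: "rat poly"
  assumes "m \<noteq> 0"
    and "ideal \<aa> (mpoly_ring n (int_localization m))" and "\<aa> \<noteq> {0}" and "\<aa> \<subseteq> vars_ideal n (mpoly_ring n (int_localization m))"
    and "is_local_bs_poly n (extend_complex n \<aa>) (map_poly of_rat b)"
  shows "\<exists>N. \<forall>p::nat. prime p \<and> p > N \<longrightarrow>
    (\<forall>J. ideal J (mpoly_ring n (int_localization m)) \<and> J \<subseteq> vars_ideal n (mpoly_ring n (int_localization m)) \<and> \<aa> \<subseteq> radical (mpoly_ring n (int_localization m)) J \<longrightarrow>
      (\<forall>e\<ge>1. residue_Fp p (poly b (of_nat (nu n \<aa> J p e))) = 0))"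
proof -
  define A where "A = int_localization m"
  define Z where "Z = mpolys n A"
  let ?CX = "mpolys n (UNIV :: complex set)"
  have A: "unital_subring A" unfolding A_def by (rule unital_subring_int_localization[OF assms(1)])
  have Z: "unital_subring Z" unfolding Z_def by (rule unital_subring_mpolys[OF A])
  have CX: "unital_subring ?CX" by (rule unital_subring_mpolys) simp
  have ring_Z: "mpoly_ring n (int_localization m) = set_ring Z"
    by (simp add: mpoly_ring_eq_set_ring Z_def A_def)
  have \<aa>_ideal: "ideal \<aa> (set_ring Z)" using assms(2) unfolding ring_Z .
  note \<aa> = ideal_set_ringD[OF Z \<aa>_ideal]
  obtain G N where G: "finite G" "G \<subseteq> \<aa>" and N: "N \<in> A - {0}"
    and GN: "\<forall>f\<in>\<aa>. \<exists>k. const_mpoly N ^ k * f \<in> span_over Z G"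
    using ideal_finitely_generated_up_to_constant[OF A, of \<aa> n] \<aa>_ideal unfolding Z_def by metis
  obtain fs where fs: "set fs \<subseteq> ?CX - {0}" "genideal (mpoly_ring n UNIV) (set fs) = extend_complex n \<aa>"
    "local_bs_equation n fs (map_poly of_rat b)"
    using assms(5) unfolding is_local_bs_poly_def by blast
  have \<aa>_CX: "of_rat_mpoly ` \<aa> \<subseteq> ?CX"
    using \<aa>(1) of_rat_mpoly_in_mpolys[of _ n A UNIV] by (auto simp: Z_def)
  have fs_CX: "set fs \<subseteq> ?CX" using fs(1) by blast
  \<comment> \<open>The generators \<open>fs\<close> may have coefficients outside A; over
    \<complex>[X] they generate the same ideal as \<aa>.\<close>
  have span_eq: "span_over ?CX (set fs) = span_over ?CX (of_rat_mpoly ` \<aa>)"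
    using fs(2) unfolding extend_complex_def mpoly_ring_eq_set_ring of_rat_mpoly_def[symmetric]
    by (simp only: genideal_set_ring[OF CX fs_CX] genideal_set_ring[OF CX \<aa>_CX])
  obtain E1 h where E1: "finite E1" "lookup h 0 = 1"
    and bs: "\<forall>B \<alpha> L. unital_subring B \<and> E1 \<subseteq> B \<longrightarrow> h \<in> mpolys n B \<and>
      (differential_submodule n B L \<and>
       (\<forall>\<alpha>'. (\<Sum>j<length fs. \<alpha>' j) = Suc (\<Sum>j<length fs. \<alpha> j) \<longrightarrow> gen_power fs \<alpha>' \<in> L) \<longrightarrow>
       h * const_mpoly (poly (map_poly of_rat b) (of_nat (\<Sum>j<length fs. \<alpha> j))) * gen_power fs \<alpha> \<in> L)"
  proof -
    have "set fs \<subseteq> - {0}" using fs(1) by blast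
    from local_bs_equation_specialize[OF this fs(3)] show thesis
      by (elim exE conjE) (rule that)
  qed
  have gen: "\<exists>E. finite E \<and> (\<forall>B. unital_subring B \<and> E \<subseteq> B \<longrightarrow> X \<subseteq> span_over (mpolys n B) Y)"
    if "finite X" "X \<subseteq> span_over ?CX Y" for X Y
    using that
  proof induction
    case empty
    show ?case by (intro exI[of _ "{}"]) simp
  next
    case (insert x X)
    then obtain E where E: "finite E" "\<And>B. unital_subring B \<Longrightarrow> E \<subseteq> B \<Longrightarrow> X \<subseteq> span_over (mpolys n B) Y"
      by auto
    obtain E' where E': "finite E'" "\<And>B. unital_subring B \<Longrightarrow> E' \<subseteq> B \<Longrightarrow> x \<in> span_over (mpolys n B) Y"
      using span_over_finite_coeffs[of x n Y] insert.prems by auto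
    show ?case using E E' by (intro exI[of _ "E \<union> E'"]) auto
  qed
  have "set fs \<subseteq> span_over ?CX (of_rat_mpoly ` \<aa>)"
    unfolding span_eq[symmetric] using span_over_superset[OF CX] by blast
  from gen[OF finite_set this] obtain E2 where E2: "finite E2"
    "\<forall>B. unital_subring B \<and> E2 \<subseteq> B \<longrightarrow> set fs \<subseteq> span_over (mpolys n B) (of_rat_mpoly ` \<aa>)"
    by (elim exE conjE) (rule that)
  \<comment> \<open>For the converse containment coefficients can be collected from finitely many
    elements only, hence the detour through \<open>G\<close>.\<close>
  have "of_rat_mpoly ` G \<subseteq> span_over ?CX (set fs)"
    unfolding span_eq using G(2) span_over_superset[OF CX] by blast
  from gen[OF finite_imageI[OF G(1)] this] obtain E3 where E3: "finite E3"
    "\<forall>B. unital_subring B \<and> E3 \<subseteq> B \<longrightarrow> of_rat_mpoly ` G \<subseteq> span_over (mpolys n B) (set fs)"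
    by (elim exE conjE) (rule that)
  \<comment> \<open>\<open>1 / of_int m\<close> embeds A into B, and \<open>1 / of_rat N\<close>
    makes \<open>G\<close> generate the extension of \<aa> to B[X].\<close>
  have "finite (E1 \<union> E2 \<union> E3 \<union> {1 / of_int m, 1 / of_rat N})"
    using E1(1) E2(1) E3(1) by simp
  from finite_subset_subring_almost_no_prime_invertible[OF this]
  obtain B N0 where B: "unital_subring B" and EB: "E1 \<union> E2 \<union> E3 \<union> {1 / of_int m, 1 / of_rat N} \<subseteq> B"
    and N0: "\<And>p::nat. prime p \<Longrightarrow> p > N0 \<Longrightarrow> \<forall>g\<in>B. of_nat p * g \<noteq> 1"
    by blast
  obtain D :: int where D: "D \<noteq> 0" "\<And>k::nat. \<exists>z::int. poly b (of_nat k) * of_int D = of_int z"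
    using poly_common_denominator[of b] by blast
  obtain a k where N_eq: "N = of_int a / of_int m ^ k"
    using N by (auto simp: A_def int_localization_def)
  have "a \<noteq> 0" using N N_eq by auto
  \<comment> \<open>Every larger prime is a non-unit of B and divides none of \<open>m\<close>,
    \<open>D\<close> and the numerator \<open>a\<close> of \<open>N\<close>. Neither J nor e has
    been fixed yet.\<close>
  define bound where "bound = N0 + nat \<bar>m\<bar> + nat \<bar>D\<bar> + nat \<bar>a\<bar>"
  have "residue_Fp p (poly b (of_nat (nu n \<aa> J p e))) = 0"
    if p: "prime p" "p > bound" and J: "ideal J (set_ring Z)" "J \<subseteq> vars_ideal n (set_ring Z)" "\<aa> \<subseteq> radical (set_ring Z) J"
      and e: "e \<ge> 1" for p J e
  proof -
    have ndvd: "\<not> int p dvd x" if "x \<noteq> 0" "nat \<bar>x\<bar> \<le> bound" for x :: int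
      using that p(2) dvd_imp_le_int[of x "int p"] by auto
    interpret M: mod_p_reduction p n m
      by unfold_locales (use p ndvd[of m] assms(1) in \<open>auto simp: bound_def\<close>)
    note Z_eq = Z_def[unfolded A_def] and A_eq = A_def
    define q where "q = p ^ e"
    have q: "p dvd q" "q > 0" using e prime_gt_0_nat[OF p(1)] by (auto simp: q_def)
    let ?contained = "\<lambda>r. \<forall>x\<in>products \<aa> r. \<exists>v\<in>Z. lookup v 0 = 1 \<and> v * x \<in> span_over Z ({y ^ q |y. y \<in> J} \<union> {of_nat p})"
    define \<nu> where "\<nu> = nu n \<aa> J p e"
    have JZ: "J \<subseteq> Z" using ideal_set_ringD(1)[OF Z J(1)] .
    have \<nu>: "\<not> ?contained \<nu>" "?contained (Suc \<nu>)"
    proof -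
      have "N \<notin> M.pA" using ndvd[OF \<open>a \<noteq> 0\<close>] unfolding N_eq M.of_int_in_pA_iff by (simp add: bound_def)
      moreover have "lookup y 0 = 0" if "y \<in> J" for y
        using J(2) that M.vars_ideal_lookup_0 by (auto simp: ring_Z)
      moreover have "\<exists>k. g ^ k \<in> J" if "g \<in> \<aa>" for g
        using J(3) that by (auto simp: radical_def nat_pow_set_ring[OF Z])
      ultimately show "\<not> ?contained \<nu>" "?contained (Suc \<nu>)"
        using M.nu_characterization[of \<aa> J G N q] \<aa>(1) J(1) G N GN q(2)
        unfolding \<nu>_def nu_def q_def[symmetric] Z_eq A_eq M.power_in_frob_def by blast+
    qed
    let ?BX = "mpolys n B"
    note BX = unital_subring_mpolys[OF B, of n]
    have mB: "1 / of_int m \<in> B" using EB by simp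
    have ZB: "of_rat_mpoly x \<in> ?BX" if "x \<in> Z" for x
      using of_rat_mpoly_in_mpolys[of x n A B] M.of_rat_A_subset[OF B mB] that by (simp add: Z_def A_def)
    have \<aa>B: "of_rat_mpoly ` \<aa> \<subseteq> ?BX" using ZB \<aa>(1) by blast
    have YB: "of_rat_mpoly ` J \<subseteq> ?BX" using ZB JZ by blast
    have fs_span: "set fs \<subseteq> span_over ?BX (of_rat_mpoly ` \<aa>)"
      using E2(2) B EB by simp
    have fsB: "set fs \<subseteq> ?BX" using fs_span span_over_subset[OF BX \<aa>B] by blast
    have G_span: "of_rat_mpoly ` G \<subseteq> span_over ?BX (set fs)"
      using E3(2) B EB by simp
    have \<aa>_span: "of_rat_mpoly ` \<aa> \<subseteq> span_over ?BX (set fs)"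
    proof
      fix y assume "y \<in> of_rat_mpoly ` \<aa>"
      then obtain f where f: "f \<in> \<aa>" "y = of_rat_mpoly f" by blast
      then obtain k where "const_mpoly N ^ k * f \<in> span_over Z G" using GN by blast
      then have "of_rat_mpoly (const_mpoly N ^ k * f) \<in> span_over ?BX (of_rat_mpoly ` G)"
        by (rule of_rat_mpoly_span_over) (use ZB in auto)
      then have *: "of_rat_mpoly (const_mpoly N) ^ k * y \<in> span_over ?BX (set fs)"
        using span_over_trans[OF BX _ G_span] f(2) by simp
      have cN: "of_rat_mpoly (const_mpoly N) = const_mpoly (of_rat N)"
        unfolding of_rat_mpoly_def by (rule map_single_zero) simp
      have "const_mpoly (1 / of_rat N) * const_mpoly (of_rat N) = (1 :: complex mpoly)"
        using N by (simp add: mult_single)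
      then have "const_mpoly (1 / of_rat N) ^ k * (of_rat_mpoly (const_mpoly N) ^ k * y) = y"
        unfolding cN by (simp flip: power_mult_distrib mult.assoc)
      moreover have "const_mpoly (1 / of_rat N) ^ k \<in> ?BX"
        using EB by (intro subring_power[OF BX] const_in_mpolys) simp
      ultimately show "y \<in> span_over ?BX (set fs)"
        using span_over_mult[OF BX _ *] by metis
    qed
    define L where "L = local_frobenius_span n B p q (of_rat_mpoly ` J)"
    note L_add = local_frobenius_span_add[OF B q YB, folded L_def]
      and L_mult = local_frobenius_span_mult[OF B q YB, folded L_def]
    \<comment> \<open>Maximality of \<nu> enters here, through containment of the power \<nu> + 1 of
      \<aa>.\<close>
    have prod_L: "of_rat_mpoly ` products \<aa> (Suc \<nu>) \<subseteq> L"
    proof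
      fix y assume "y \<in> of_rat_mpoly ` products \<aa> (Suc \<nu>)"
      then obtain x where x: "x \<in> products \<aa> (Suc \<nu>)" "y = of_rat_mpoly x" by blast
      then obtain v where v: "v \<in> Z" "lookup v 0 = 1" "v * x \<in> span_over Z ({y ^ q |y. y \<in> J} \<union> {of_nat p})"
        using \<nu>(2) by blast
      have xZ: "x \<in> Z" using x(1) products_subset[OF Z \<aa>(1)] by blast
      have "of_rat_mpoly (v * x) \<in> frobenius_span n B p q (of_rat_mpoly ` J)"
        unfolding frobenius_span_def using v(3)
        by (rule of_rat_mpoly_span_over) (use ZB in auto)
      then show "y \<in> L"
        unfolding L_def x(2) using v ZB xZ
        by (intro local_frobenius_spanI[OF B q YB, of _ "of_rat_mpoly v"]) auto
    qed
    have powers_L: "gen_power fs \<alpha>' \<in> L" if "(\<Sum>j<length fs. \<alpha>' j) = Suc \<nu>" for \<alpha>'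
    proof -
      have "gen_power fs \<alpha>' \<in> products (set fs) (Suc \<nu>)"
        unfolding gen_power_def that[symmetric] by (rule prod_list_in_products) simp
      then have "gen_power fs \<alpha>' \<in> span_over ?BX (products (of_rat_mpoly ` \<aa>) (Suc \<nu>))"
        using products_span_over[OF BX fs_span] by blast
      also have "products (of_rat_mpoly ` \<aa>) (Suc \<nu>) = of_rat_mpoly ` products \<aa> (Suc \<nu>)"
        by (rule products_image) auto
      finally show ?thesis
        using span_over_subset_local_frobenius_span[OF B q YB _ prod_L[unfolded L_def]] unfolding L_def by blast
    qed
    have hB: "h \<in> ?BX" using bs B EB by simp
    have bs_L: "h * const_mpoly (of_rat (poly b (of_nat \<nu>))) * gen_power fs \<alpha> \<in> L"
      if "(\<Sum>j<length fs. \<alpha> j) = \<nu>" for \<alpha>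
    proof -
      have "poly (map_poly of_rat b) (of_nat \<nu>) = (of_rat (poly b (of_nat \<nu>)) :: complex)"
        by (induction b) (auto simp: map_poly_pCons of_rat_add of_rat_mult)
      moreover have "h * const_mpoly (poly (map_poly of_rat b) (of_nat (\<Sum>j<length fs. \<alpha> j))) * gen_power fs \<alpha> \<in> L"
      proof (rule mp[OF conjunct2[OF mp[OF bs[THEN spec[of _ B], THEN spec[of _ \<alpha>], THEN spec[of _ L]]]]])
        show "unital_subring B \<and> E1 \<subseteq> B" using B EB by simp
        have "gen_power fs \<alpha>' \<in> L" if "(\<Sum>j<length fs. \<alpha>' j) = Suc (\<Sum>j<length fs. \<alpha> j)" for \<alpha>'
          using that \<open>(\<Sum>j<length fs. \<alpha> j) = \<nu>\<close> by (intro powers_L) simp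
        then show "differential_submodule n B L \<and>
            (\<forall>\<alpha>'. (\<Sum>j<length fs. \<alpha>' j) = Suc (\<Sum>j<length fs. \<alpha> j) \<longrightarrow> gen_power fs \<alpha>' \<in> L)"
          unfolding L_def using differential_submodule_LFS[OF B q YB] by blast
      qed
      ultimately show ?thesis using that by simp
    qed
    obtain z where z: "poly b (of_nat \<nu>) * of_int D = of_int z" using D(2) by blast
    have pD: "\<not> int p dvd D" using ndvd[OF D(1)] by (simp add: bound_def)
    \<comment> \<open>As \<open>D\<close> is prime to p, the value of \<open>b\<close> at \<nu>
      vanishes modulo p exactly when p divides \<open>z\<close>.\<close>
    have "int p dvd z"
    proof (rule ccontr)
      assume "\<not> int p dvd z"
      then have "coprime (int p) z" using p(1) by (simp add: prime_imp_coprime)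
      then obtain c u where uc: "c * int p + u * z = 1" by (metis bezout_int coprime_imp_gcd_eq_1)
      have gens_L: "gen_power fs \<alpha> \<in> L" if \<alpha>: "(\<Sum>j<length fs. \<alpha> j) = \<nu>" for \<alpha>
      proof -
        let ?f = "gen_power fs \<alpha>"
        have fB: "?f \<in> ?BX"
          unfolding gen_power_def using fsB by (intro subring_prod[OF BX] subring_power[OF BX]) auto
        have "of_int D * const_mpoly (of_rat (poly b (of_nat \<nu>))) = (const_mpoly (of_int D * of_rat (poly b (of_nat \<nu>))) :: complex mpoly)"
          by (simp add: mult_single flip: single_of_int)
        also have "of_int D * of_rat (poly b (of_nat \<nu>)) = (of_rat (poly b (of_nat \<nu>) * of_int D) :: complex)"
          by (simp add: of_rat_mult mult.commute)
        also have "const_mpoly \<dots> = (of_int z :: complex mpoly)" unfolding z by simp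
        finally have Dz: "of_int D * const_mpoly (of_rat (poly b (of_nat \<nu>))) = (of_int z :: complex mpoly)" .
        \<comment> \<open>The factor \<open>u * D\<close> turns the value of \<open>b\<close> into
          \<open>u * z\<close>, which is 1 up to a multiple of p. That multiple of p already
          contributes an element of L, so \<open>h * ?f\<close> lies in L.\<close>
        have "of_int (u * D) * (h * const_mpoly (of_rat (poly b (of_nat \<nu>))) * ?f) \<in> L"
          by (rule L_mult[OF subring_of_int[OF BX] bs_L[OF \<alpha>]])
        also have "of_int (u * D) * (h * const_mpoly (of_rat (poly b (of_nat \<nu>))) * ?f) =
            of_int u * (of_int D * const_mpoly (of_rat (poly b (of_nat \<nu>)))) * (h * ?f)"
          by (simp add: algebra_simps)
        also have "\<dots> = of_int (u * z) * (h * ?f)" unfolding Dz by simp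
        finally have 1: "of_int (u * z) * (h * ?f) \<in> L" .
        have "of_int c * (h * ?f) * of_nat p \<in> L"
          unfolding L_def
          by (intro frobenius_span_subset_local[OF B q YB] frobenius_span_p[OF B q YB] subring_mult[OF BX] subring_of_int[OF BX] hB fB)
        with 1 have "of_int c * (h * ?f) * of_nat p + of_int (u * z) * (h * ?f) \<in> L"
          by (rule L_add[rotated])
        also have "of_int c * (h * ?f) * of_nat p + of_int (u * z) * (h * ?f) = of_int (c * int p + u * z) * (h * ?f)"
          by (simp add: algebra_simps)
        finally have "h * ?f \<in> L" unfolding uc by simp
        then show ?thesis
          using local_frobenius_span_cancel[OF B q YB fB hB E1(2)] by (simp add: L_def)
      qed
      \<comment> \<open>Each product of \<nu> generators is some
        \<open>gen_power fs \<alpha>\<close> of degree \<nu>; the change of generators then carries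
        the result over to products of elements of \<aa>.\<close>
      have "products (set fs) \<nu> \<subseteq> L"
        using products_list[of _ fs \<nu>] gens_L by (auto simp: gen_power_def)
      then have all_L: "of_rat_mpoly x \<in> L" if "x \<in> products \<aa> \<nu>" for x
      proof -
        have "of_rat_mpoly x \<in> products (of_rat_mpoly ` \<aa>) \<nu>"
          using that by (subst products_image) auto
        then have "of_rat_mpoly x \<in> span_over ?BX (products (set fs) \<nu>)"
          using products_span_over[OF BX \<aa>_span] by blast
        then show ?thesis
          using span_over_subset_local_frobenius_span[OF B q YB] \<open>products (set fs) \<nu> \<subseteq> L\<close> unfolding L_def by blast
      qed
      have "?contained \<nu>"
      proof
        fix x assume x: "x \<in> products \<aa> \<nu>"
        then have xZ: "x \<in> Z" using products_subset[OF Z \<aa>(1)] by blast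
        obtain k where k: "k \<in> ?BX" "lookup k 0 = 1" "k * of_rat_mpoly x \<in> frobenius_span n B p q (of_rat_mpoly ` J)"
          using all_L[OF x] unfolding L_def by (rule local_frobenius_spanE[OF B q YB])
        have "p > N0" using p(2) by (simp add: bound_def)
        from M.frob_descent[OF B mB N0[OF p(1) this] _ _ k] JZ xZ
        show "\<exists>v\<in>Z. lookup v 0 = 1 \<and> v * x \<in> span_over Z ({y ^ q |y. y \<in> J} \<union> {of_nat p})"
          unfolding Z_eq by blast
      qed
      with \<nu>(1) show False by blast
    qed
    then have "[residue_Fp p (poly b (of_nat \<nu>)) * D = 0] (mod int p)"
      using residue_Fp_cong[OF p(1) pD z] by (metis cong_0_iff cong_trans)
    then have "int p dvd residue_Fp p (poly b (of_nat \<nu>))"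
      using p(1) pD by (simp add: cong_0_iff prime_dvd_mult_iff)
    \<comment> \<open>The representative lies in \<open>{0..<p}\<close>, where 0 is the only
      multiple of p.\<close>
    moreover have "residue_Fp p (poly b (of_nat \<nu>)) \<in> {0..<int p}"
      by (rule residue_Fp_range[OF prime_gt_0_nat[OF p(1)]])
    ultimately show ?thesis
      unfolding \<nu>_def by (auto dest: zdvd_imp_le)
  qed
  then show ?thesis
    unfolding ring_Z by (intro exI[of _ bound]) blast
qed

end
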